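(* Let $R$ be a right coherent ring and $(\mathcal A,\mathcal B)$ be a complete hereditary cotorsion pair in the category of right $R$-modules with $\mathcal B$ closed under countable direct sums. Denote by $\mathfrak I$ the ideal of all morphisms between finitely presented right $R$-modules which factor through some module from $\mathcal A$. Then the following are equivalent for a countably presented module $M$: (1) $M\in\mathcal A$; (2) $M$ is a direct limit of a countable direct system $(C_n,f_n)_{n<\omega}$ of finitely presented modules (with $f_n:C_n\to C_{n+1}$) such that $f_n\in\mathfrak I$ for every $n$ and the inverse system $(\mathrm{Hom}_R(C_n,B),\mathrm{Hom}_R(f_n,B))_{n<\omega}$ is Mittag-Leffler for each $B\in\mathcal B$. If, in addition, $\mathcal A$ is closed under countable direct limits, then these conditions are further equivalent to: (3) $M$ is a direct limit of a countable direct system $(C_n,f_n)_{n<\omega}$ of finitely presented modules such that $f_n\in\mathfrak I$ for every $n$.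
   Context: Rings are associative with unit; modules are unital right $R$-modules. A cotorsion pair is a pair $(\mathcal A,\mathcal B)$ of classes of modules with $\mathcal A=\{X\mid \mathrm{Ext}^1_R(X,B)=0\ \forall B\in\mathcal B\}$ and $\mathcal B=\{Y\mid \mathrm{Ext}^1_R(A,Y)=0\ \forall A\in\mathcal A\}$. It is hereditary if $\mathcal A$ is closed under kernels of epimorphisms (equivalently, $\mathcal B$ is closed under cokernels of monomorphisms), and complete if for every module $M$ there is a short exact sequence $0\to B\to A\to M\to 0$ with $A\in\mathcal A$ and $B\in\mathcal B$. Over a right coherent ring the finitely presented modules are exactly those having a projective resolution by finitely generated projectives. An inverse system of abelian groups $\cdots\to H_{n+1}\xrightarrow{h_n}H_n\to\cdots\to H_1\xrightarrow{h_0}H_0$ is Mittag-Leffler if for each $n$ the descending chain $H_n\supseteq h_n(H_{n+1})\supseteq\cdots\supseteq h_nh_{n+1}\cdots h_{k-1}(H_k)\supseteq\cdots$ is stationary. *)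

theory Defs
  imports "HOL-Algebra.Module" "HOL-Algebra.AbelCoset" "HOL-Algebra.Elementary_Groups" "HOL-Library.Equipollence"
begin

section \<open>Right modules\<close>

text \<open>
  The library locale \<open>module\<close> is restricted to commutative rings. We reuse its record type
  for right modules over an arbitrary ring: the term \<open>a \<odot>\<^bsub>M\<^esub> x\<close> stands for the right action \<open>x \<cdot> a\<close>,
  whence the order of the factors in \<open>ract_assoc\<close>. The fields \<open>mult\<close> and \<open>one\<close> that the record
  inherits from \<open>ring\<close> play no role.
\<close>

locale right_module = R?: ring R + M?: abelian_group M
  for R :: "('r, 'k) ring_scheme" (structure) and M :: "('r, 'm) module" (structure) +
  assumes ract_closed:
      "\<lbrakk>a \<in> carrier R; x \<in> carrier M\<rbrakk> \<Longrightarrow> a \<odot>\<^bsub>M\<^esub> x \<in> carrier M"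
    and ract_add_ring:
      "\<lbrakk>a \<in> carrier R; b \<in> carrier R; x \<in> carrier M\<rbrakk>
        \<Longrightarrow> (a \<oplus>\<^bsub>R\<^esub> b) \<odot>\<^bsub>M\<^esub> x = (a \<odot>\<^bsub>M\<^esub> x) \<oplus>\<^bsub>M\<^esub> (b \<odot>\<^bsub>M\<^esub> x)"
    and ract_add_module:
      "\<lbrakk>a \<in> carrier R; x \<in> carrier M; y \<in> carrier M\<rbrakk>
        \<Longrightarrow> a \<odot>\<^bsub>M\<^esub> (x \<oplus>\<^bsub>M\<^esub> y) = (a \<odot>\<^bsub>M\<^esub> x) \<oplus>\<^bsub>M\<^esub> (a \<odot>\<^bsub>M\<^esub> y)"
    and ract_assoc:
      "\<lbrakk>a \<in> carrier R; b \<in> carrier R; x \<in> carrier M\<rbrakk>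
        \<Longrightarrow> (a \<otimes>\<^bsub>R\<^esub> b) \<odot>\<^bsub>M\<^esub> x = b \<odot>\<^bsub>M\<^esub> (a \<odot>\<^bsub>M\<^esub> x)"
    and ract_one:
      "x \<in> carrier M \<Longrightarrow> \<one>\<^bsub>R\<^esub> \<odot>\<^bsub>M\<^esub> x = x"

text \<open>
  Homomorphisms are extensional (\<open>undefined\<close> off the carrier), so that equality of
  homomorphisms is equality of functions; they are composed with \<^const>\<open>compose\<close>.
\<close>

definition mod_hom ::
  "('r, 'k) ring_scheme \<Rightarrow> ('r, 'm) module \<Rightarrow> ('r, 'n) module \<Rightarrow> ('m \<Rightarrow> 'n) set" where
  "mod_hom R M N =
     {h \<in> hom (add_monoid M) (add_monoid N) \<inter> extensional (carrier M).
        \<forall>a\<in>carrier R. \<forall>x\<in>carrier M. h (a \<odot>\<^bsub>M\<^esub> x) = a \<odot>\<^bsub>N\<^esub> h x}"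

definition mod_iso ::
  "('r, 'k) ring_scheme \<Rightarrow> ('r, 'm) module \<Rightarrow> ('r, 'n) module \<Rightarrow> bool" where
  "mod_iso R M N \<longleftrightarrow> (\<exists>h\<in>mod_hom R M N. bij_betw h (carrier M) (carrier N))"

definition Hom_group ::
  "('r, 'k) ring_scheme \<Rightarrow> ('r, 'm) module \<Rightarrow> ('r, 'n) module \<Rightarrow> ('m \<Rightarrow> 'n) monoid" where
  "Hom_group R M N =
     \<lparr>carrier = mod_hom R M N,
      monoid.mult = (\<lambda>g h. \<lambda>x\<in>carrier M. g x \<oplus>\<^bsub>N\<^esub> h x),
      one = (\<lambda>x\<in>carrier M. \<zero>\<^bsub>N\<^esub>)\<rparr>"

definition short_exact ::
  "('r, 'k) ring_scheme \<Rightarrow> ('r, 'l) module \<Rightarrow> ('l \<Rightarrow> 'm) \<Rightarrow> ('r, 'm) module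
    \<Rightarrow> ('m \<Rightarrow> 'n) \<Rightarrow> ('r, 'n) module \<Rightarrow> bool" where
  "short_exact R L f M g N \<longleftrightarrow>
     f \<in> mod_hom R L M \<and> g \<in> mod_hom R M N \<and>
     inj_on f (carrier L) \<and> f ` carrier L = a_kernel M N g \<and> g ` carrier M = carrier N"

definition regular_module :: "('r, 'k) ring_scheme \<Rightarrow> ('r, 'r) module" where
  "regular_module R =
     \<lparr>carrier = carrier R, monoid.mult = (\<otimes>\<^bsub>R\<^esub>), one = \<one>\<^bsub>R\<^esub>,
      ring.zero = \<zero>\<^bsub>R\<^esub>, ring.add = (\<oplus>\<^bsub>R\<^esub>), module.smult = (\<lambda>a x. x \<otimes>\<^bsub>R\<^esub> a)\<rparr>"

definition direct_sum :: "'i set \<Rightarrow> ('i \<Rightarrow> ('r, 'm) module) \<Rightarrow> ('r, 'i \<Rightarrow> 'm) module" where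
  "direct_sum I Y =
     \<lparr>carrier = {x \<in> \<Pi>\<^sub>E i\<in>I. carrier (Y i). finite {i \<in> I. x i \<noteq> \<zero>\<^bsub>Y i\<^esub>}},
      monoid.mult = undefined, one = undefined,
      ring.zero = (\<lambda>i\<in>I. \<zero>\<^bsub>Y i\<^esub>),
      ring.add = (\<lambda>x y. \<lambda>i\<in>I. x i \<oplus>\<^bsub>Y i\<^esub> y i),
      module.smult = (\<lambda>a x. \<lambda>i\<in>I. a \<odot>\<^bsub>Y i\<^esub> x i)\<rparr>"

definition free_module :: "('r, 'k) ring_scheme \<Rightarrow> 'i set \<Rightarrow> ('r, 'i \<Rightarrow> 'r) module" where
  "free_module R I = direct_sum I (\<lambda>_. regular_module R)"


section \<open>Finiteness conditions\<close>

definition presented_by ::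
  "('r, 'k) ring_scheme \<Rightarrow> 'i set \<Rightarrow> 'j set \<Rightarrow> ('r, 'm) module \<Rightarrow> bool" where
  "presented_by R I J M \<longleftrightarrow>
     (\<exists>q\<in>mod_hom R (free_module R J) (free_module R I). \<exists>p\<in>mod_hom R (free_module R I) M.
        q ` carrier (free_module R J) = a_kernel (free_module R I) M p \<and>
        p ` carrier (free_module R I) = carrier M)"

definition finitely_presented :: "('r, 'k) ring_scheme \<Rightarrow> ('r, 'm) module \<Rightarrow> bool" where
  "finitely_presented R M \<longleftrightarrow>
     right_module R M \<and> (\<exists>(I :: nat set) (J :: nat set). finite I \<and> finite J \<and> presented_by R I J M)"

definition countably_presented :: "('r, 'k) ring_scheme \<Rightarrow> ('r, 'm) module \<Rightarrow> bool" where
  "countably_presented R M \<longleftrightarrow>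
     right_module R M \<and> (\<exists>(I :: nat set) (J :: nat set). presented_by R I J M)"

definition generated_submodule ::
  "('r, 'k) ring_scheme \<Rightarrow> ('r, 'm) module \<Rightarrow> 'm set \<Rightarrow> 'm set" where
  "generated_submodule R M S = \<Inter>{N. submodule N R M \<and> S \<subseteq> N}"

definition right_coherent :: "('r, 'k) ring_scheme \<Rightarrow> bool" where
  "right_coherent R \<longleftrightarrow>
     ring R \<and>
     (\<forall>S. finite S \<and> S \<subseteq> carrier R \<longrightarrow>
        finitely_presented R
          ((regular_module R)\<lparr>carrier := generated_submodule R (regular_module R) S\<rparr>))"


section \<open>First extension group\<close>

text \<open>
  \<open>Ext\<^sup>1(X, Y)\<close> is computed from the canonical free presentation
  \<open>0 \<rightarrow> K \<rightarrow> F \<rightarrow> X \<rightarrow> 0\<close> with \<open>F\<close> free on the set underlying \<open>X\<close>: it is the cokernel of the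
  restriction map \<open>Hom(F, Y) \<rightarrow> Hom(K, Y)\<close>.
\<close>

definition free_cover_map ::
  "('r, 'k) ring_scheme \<Rightarrow> ('r, 'm) module \<Rightarrow> ('m \<Rightarrow> 'r) \<Rightarrow> 'm" where
  "free_cover_map R X =
     (\<lambda>u\<in>carrier (free_module R (carrier X)).
        \<Oplus>\<^bsub>X\<^esub>x\<in>{x \<in> carrier X. u x \<noteq> \<zero>\<^bsub>R\<^esub>}. u x \<odot>\<^bsub>X\<^esub> x)"

definition free_cover_kernel ::
  "('r, 'k) ring_scheme \<Rightarrow> ('r, 'm) module \<Rightarrow> ('r, 'm \<Rightarrow> 'r) module" where
  "free_cover_kernel R X =
     (free_module R (carrier X))
       \<lparr>carrier := a_kernel (free_module R (carrier X)) X (free_cover_map R X)\<rparr>"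

definition Ext1 ::
  "('r, 'k) ring_scheme \<Rightarrow> ('r, 'm) module \<Rightarrow> ('r, 'n) module
    \<Rightarrow> (('m \<Rightarrow> 'r) \<Rightarrow> 'n) set monoid" where
  "Ext1 R X Y =
     Hom_group R (free_cover_kernel R X) Y Mod
       ((\<lambda>g. restrict g (carrier (free_cover_kernel R X)))
          ` mod_hom R (free_module R (carrier X)) Y)"


section \<open>The category of right modules\<close>

text \<open>
  No HOL type contains all modules with carriers of arbitrary type, so we fix a universe:
  a family \<open>\<U>\<close> of subsets of a type, its members being called small, and ``module'' means module
  with small carrier. The conditions below ask only that smallness depends on cardinality, is
  closed under smaller cardinalities and countable unions, and that some infinite set is small
  and \<open>R\<close> is small. They hold for the sets (as opposed to proper classes) of a set-theoretic
  universe, and also for \<open>\<U> = UNIV\<close> over any infinite type into which \<open>R\<close> embeds. A class of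
  modules is then an arbitrary set of objects of \<open>Rmod R \<U>\<close>.
\<close>

definition module_universe :: "('r, 'k) ring_scheme \<Rightarrow> 'm set set \<Rightarrow> bool" where
  "module_universe R \<U> \<longleftrightarrow>
     (\<forall>S\<in>\<U>. \<forall>T. T \<lesssim> S \<longrightarrow> T \<in> \<U>) \<and>
     (\<forall>S :: nat \<Rightarrow> 'm set. (\<forall>n. S n \<in> \<U>) \<longrightarrow> (\<Union>n. S n) \<in> \<U>) \<and>
     (\<exists>S\<in>\<U>. infinite S) \<and>
     (\<exists>S\<in>\<U>. carrier R \<lesssim> S)"

definition Rmod :: "('r, 'k) ring_scheme \<Rightarrow> 'm set set \<Rightarrow> ('r, 'm) module set" where
  "Rmod R \<U> = {M. right_module R M \<and> carrier M \<in> \<U>}"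


section \<open>Cotorsion pairs\<close>

definition cotorsion_pair ::
  "('r, 'k) ring_scheme \<Rightarrow> 'm set set \<Rightarrow> ('r, 'm) module set \<Rightarrow> ('r, 'm) module set \<Rightarrow> bool" where
  "cotorsion_pair R \<U> \<A> \<B> \<longleftrightarrow>
     \<A> = {X \<in> Rmod R \<U>. \<forall>B\<in>\<B>. trivial_group (Ext1 R X B)} \<and>
     \<B> = {Y \<in> Rmod R \<U>. \<forall>A\<in>\<A>. trivial_group (Ext1 R A Y)}"

definition hereditary_cotorsion_pair ::
  "('r, 'k) ring_scheme \<Rightarrow> 'm set set \<Rightarrow> ('r, 'm) module set \<Rightarrow> ('r, 'm) module set \<Rightarrow> bool" where
  "hereditary_cotorsion_pair R \<U> \<A> \<B> \<longleftrightarrow>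
     cotorsion_pair R \<U> \<A> \<B> \<and>
     (\<forall>K\<in>Rmod R \<U>. \<forall>X\<in>\<A>. \<forall>Z\<in>\<A>. \<forall>f g. short_exact R K f X g Z \<longrightarrow> K \<in> \<A>)"

definition complete_cotorsion_pair ::
  "('r, 'k) ring_scheme \<Rightarrow> 'm set set \<Rightarrow> ('r, 'm) module set \<Rightarrow> ('r, 'm) module set \<Rightarrow> bool" where
  "complete_cotorsion_pair R \<U> \<A> \<B> \<longleftrightarrow>
     cotorsion_pair R \<U> \<A> \<B> \<and>
     (\<forall>M\<in>Rmod R \<U>. \<exists>B\<in>\<B>. \<exists>A\<in>\<A>. \<exists>f g. short_exact R B f A g M)"

definition closed_countable_direct_sums ::
  "('r, 'k) ring_scheme \<Rightarrow> 'm set set \<Rightarrow> ('r, 'm) module set \<Rightarrow> bool" where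
  "closed_countable_direct_sums R \<U> \<B> \<longleftrightarrow>
     (\<forall>(I :: nat set) Y. (\<forall>i\<in>I. Y i \<in> \<B>) \<longrightarrow>
        (\<forall>D\<in>Rmod R \<U>. mod_iso R D (direct_sum I Y) \<longrightarrow> D \<in> \<B>))"


section \<open>Direct limits\<close>

definition direct_system ::
  "('r, 'k) ring_scheme \<Rightarrow> 'i set \<Rightarrow> 'i rel \<Rightarrow> ('i \<Rightarrow> ('r, 'm) module)
    \<Rightarrow> ('i \<Rightarrow> 'i \<Rightarrow> 'm \<Rightarrow> 'm) \<Rightarrow> bool" where
  "direct_system R I r C \<phi> \<longleftrightarrow>
     I \<noteq> {} \<and> partial_order_on I r \<and>
     (\<forall>i\<in>I. \<forall>j\<in>I. \<exists>k\<in>I. (i, k) \<in> r \<and> (j, k) \<in> r) \<and>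
     (\<forall>i j. (i, j) \<in> r \<longrightarrow> \<phi> i j \<in> mod_hom R (C i) (C j)) \<and>
     (\<forall>i\<in>I. \<phi> i i = (\<lambda>x\<in>carrier (C i). x)) \<and>
     (\<forall>i j k. (i, j) \<in> r \<and> (j, k) \<in> r \<longrightarrow> compose (carrier (C i)) (\<phi> j k) (\<phi> i j) = \<phi> i k)"

definition cocone ::
  "('r, 'k) ring_scheme \<Rightarrow> 'i set \<Rightarrow> 'i rel \<Rightarrow> ('i \<Rightarrow> ('r, 'm) module)
    \<Rightarrow> ('i \<Rightarrow> 'i \<Rightarrow> 'm \<Rightarrow> 'm) \<Rightarrow> ('r, 'n) module \<Rightarrow> ('i \<Rightarrow> 'm \<Rightarrow> 'n) \<Rightarrow> bool" where
  "cocone R I r C \<phi> N d \<longleftrightarrow>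
     (\<forall>i\<in>I. d i \<in> mod_hom R (C i) N) \<and>
     (\<forall>i j. (i, j) \<in> r \<longrightarrow> compose (carrier (C i)) (d j) (\<phi> i j) = d i)"

definition is_direct_limit ::
  "('r, 'k) ring_scheme \<Rightarrow> 'm set set \<Rightarrow> 'i set \<Rightarrow> 'i rel \<Rightarrow> ('i \<Rightarrow> ('r, 'm) module)
    \<Rightarrow> ('i \<Rightarrow> 'i \<Rightarrow> 'm \<Rightarrow> 'm) \<Rightarrow> ('r, 'm) module \<Rightarrow> bool" where
  "is_direct_limit R \<U> I r C \<phi> L \<longleftrightarrow>
     direct_system R I r C \<phi> \<and> (\<forall>i\<in>I. C i \<in> Rmod R \<U>) \<and> L \<in> Rmod R \<U> \<and>
     (\<exists>c. cocone R I r C \<phi> L c \<and>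
        (\<forall>N\<in>Rmod R \<U>. \<forall>d. cocone R I r C \<phi> N d \<longrightarrow>
           (\<exists>!h. h \<in> mod_hom R L N \<and> (\<forall>i\<in>I. compose (carrier (C i)) h (c i) = d i))))"

definition closed_countable_direct_limits ::
  "('r, 'k) ring_scheme \<Rightarrow> 'm set set \<Rightarrow> ('r, 'm) module set \<Rightarrow> bool" where
  "closed_countable_direct_limits R \<U> \<A> \<longleftrightarrow>
     (\<forall>(I :: nat set) r C \<phi> L.
        (\<forall>i\<in>I. C i \<in> \<A>) \<and> is_direct_limit R \<U> I r C \<phi> L \<longrightarrow> L \<in> \<A>)"

text \<open>\<open>seq_map C f m k\<close> is the composite \<open>f\<^bsub>m+k-1\<^esub> \<circ> \<dots> \<circ> f\<^bsub>m\<^esub>\<close> from \<open>C m\<close> to \<open>C (m + k)\<close>.\<close>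

primrec seq_map ::
  "(nat \<Rightarrow> ('r, 'm) module) \<Rightarrow> (nat \<Rightarrow> 'm \<Rightarrow> 'm) \<Rightarrow> nat \<Rightarrow> nat \<Rightarrow> 'm \<Rightarrow> 'm" where
  "seq_map C f m 0 = (\<lambda>x\<in>carrier (C m). x)"
| "seq_map C f m (Suc k) = compose (carrier (C m)) (f (m + k)) (seq_map C f m k)"

definition is_sequence_limit ::
  "('r, 'k) ring_scheme \<Rightarrow> 'm set set \<Rightarrow> (nat \<Rightarrow> ('r, 'm) module)
    \<Rightarrow> (nat \<Rightarrow> 'm \<Rightarrow> 'm) \<Rightarrow> ('r, 'm) module \<Rightarrow> bool" where
  "is_sequence_limit R \<U> C f L \<longleftrightarrow>
     (\<forall>n. f n \<in> mod_hom R (C n) (C (Suc n))) \<and>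
     is_direct_limit R \<U> UNIV {(i, j). i \<le> j} C (\<lambda>i j. seq_map C f i (j - i)) L"


section \<open>Mittag-Leffler inverse systems\<close>

text \<open>\<open>inv_map h n k\<close> is the composite \<open>h\<^bsub>n\<^esub> \<circ> \<dots> \<circ> h\<^bsub>n+k-1\<^esub>\<close> from \<open>H (n + k)\<close> to \<open>H n\<close>.\<close>

primrec inv_map :: "(nat \<Rightarrow> 'g \<Rightarrow> 'g) \<Rightarrow> nat \<Rightarrow> nat \<Rightarrow> 'g \<Rightarrow> 'g" where
  "inv_map h n 0 = id"
| "inv_map h n (Suc k) = inv_map h n k \<circ> h (n + k)"

definition Mittag_Leffler :: "(nat \<Rightarrow> 'g monoid) \<Rightarrow> (nat \<Rightarrow> 'g \<Rightarrow> 'g) \<Rightarrow> bool" where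
  "Mittag_Leffler H h \<longleftrightarrow>
     (\<forall>n. comm_group (H n) \<and> h n \<in> hom (H (Suc n)) (H n)) \<and>
     (\<forall>n. \<exists>k0. \<forall>k\<ge>k0.
        inv_map h n k ` carrier (H (n + k)) = inv_map h n k0 ` carrier (H (n + k0)))"


section \<open>The ideal of morphisms factoring through a class\<close>

definition factor_ideal ::
  "('r, 'k) ring_scheme \<Rightarrow> ('r, 'm) module set \<Rightarrow> ('r, 'm) module \<Rightarrow> ('r, 'm) module
    \<Rightarrow> ('m \<Rightarrow> 'm) set" where
  "factor_ideal R \<A> C D =
     {f \<in> mod_hom R C D. finitely_presented R C \<and> finitely_presented R D \<and>
        (\<exists>X\<in>\<A>. \<exists>g\<in>mod_hom R C X. \<exists>h\<in>mod_hom R X D. f = compose (carrier C) h g)}"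

end

theory Submission
  imports Defs "HOL-Algebra.Free_Abelian_Groups"
begin

text \<open>
  For a sequence \<open>(C\<^sub>n, f\<^sub>n)\<close> let \<open>G\<close> consist of the families \<open>(x\<^sub>n)\<close> with \<open>x\<^sub>n\<^sub>+\<^sub>1 = f\<^sub>n(x\<^sub>n)\<close> for all large \<open>n\<close>,
  and \<open>Z\<close> of those with \<open>x\<^sub>n = 0\<close> for all large \<open>n\<close>. Then \<open>0 \<rightarrow> Z \<rightarrow> G \<rightarrow> lim C\<^sub>n \<rightarrow> 0\<close> is exact, and both \<open>Z\<close> and
  \<open>G\<close> are isomorphic to the direct sum of the \<open>C\<^sub>n\<close>. Since \<open>\<B>\<close> is closed under countable direct sums and,
  by heredity, under cokernels of monomorphisms, it is closed under limits of sequences.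

  Let \<open>M = lim C\<^sub>n\<close> be in \<open>\<A>\<close> with \<open>C\<^sub>n\<close> finitely presented. Special precovers \<open>0 \<rightarrow> B\<^sub>n \<rightarrow> A\<^sub>n \<rightarrow> C\<^sub>n \<rightarrow> 0\<close> can be
  arranged into a sequence, and \<open>lim A\<^sub>n \<rightarrow> M\<close> splits because its kernel \<open>lim B\<^sub>n\<close> is in \<open>\<B>\<close>. The
  composite \<open>C\<^sub>n \<rightarrow> M \<rightarrow> lim A\<^sub>m\<close> factors through some \<open>A\<^sub>m\<close>, so that some \<open>C\<^sub>n \<rightarrow> C\<^sub>k\<close> factors through \<open>A\<^sub>m\<close>; pass
  to a subsequence. The Mittag-Leffler property comes from the vanishing of \<open>Ext\<^sup>1(M, B\<^sup>(\<^sup>\<omega>\<^sup>))\<close>.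

  Conversely, an extension of \<open>M\<close> by \<open>B\<close> in \<open>\<B>\<close> has sections over every \<open>C\<^sub>n\<close> if the \<open>f\<^sub>n\<close> factor through
  \<open>\<A>\<close>, and the obstruction to making them compatible lies in the first derived limit of
  \<open>Hom(C\<^sub>n, B)\<close>, which the Mittag-Leffler property kills.
\<close>

section \<open>Right modules\<close>

text \<open>What shapes the proof is less the algebra than the place where modules live. The classes
  and the universal property in the statement see only modules over \<open>'m\<close> with carrier
  in \<open>\<U>\<close>, whereas free modules, direct sums and families live over other types. So
  vanishing of Ext and its consequences are stated across types, and a module is copied into
  \<open>Rmod R \<U>\<close> only where a class, a stage of a sequence or the universal property of
  \<open>M\<close> requires it.

  Limits appear in two forms for the same reason. The locale \<open>sequence_colimit\<close>
  describes a limit by its elements, in any type; limits that are constructed have this form. Of a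
  limit that is given, only the universal property against small modules is used, so that uniqueness
  of mediating maps has to replace arguments with elements.

  Both directions meet in one equation: for given \<open>y\<close>, solve
  \<open>x n = h n (x (Suc n)) + y n\<close>. Vanishing Ext provides solutions from which the
  Mittag-Leffler property follows; conversely that property provides solutions from which vanishing
  Ext follows.\<close>

lemma right_moduleI:
  assumes "ring R"
    and add: "\<And>x y. \<lbrakk>x \<in> carrier M; y \<in> carrier M\<rbrakk> \<Longrightarrow> x \<oplus>\<^bsub>M\<^esub> y \<in> carrier M"
    and zero: "\<zero>\<^bsub>M\<^esub> \<in> carrier M"
    and assoc: "\<And>x y z. \<lbrakk>x \<in> carrier M; y \<in> carrier M; z \<in> carrier M\<rbrakk>
      \<Longrightarrow> (x \<oplus>\<^bsub>M\<^esub> y) \<oplus>\<^bsub>M\<^esub> z = x \<oplus>\<^bsub>M\<^esub> (y \<oplus>\<^bsub>M\<^esub> z)"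
    and comm: "\<And>x y. \<lbrakk>x \<in> carrier M; y \<in> carrier M\<rbrakk> \<Longrightarrow> x \<oplus>\<^bsub>M\<^esub> y = y \<oplus>\<^bsub>M\<^esub> x"
    and l_zero: "\<And>x. x \<in> carrier M \<Longrightarrow> \<zero>\<^bsub>M\<^esub> \<oplus>\<^bsub>M\<^esub> x = x"
    and smult: "\<And>a x. \<lbrakk>a \<in> carrier R; x \<in> carrier M\<rbrakk> \<Longrightarrow> a \<odot>\<^bsub>M\<^esub> x \<in> carrier M"
    and add_ring: "\<And>a b x. \<lbrakk>a \<in> carrier R; b \<in> carrier R; x \<in> carrier M\<rbrakk>
      \<Longrightarrow> (a \<oplus>\<^bsub>R\<^esub> b) \<odot>\<^bsub>M\<^esub> x = (a \<odot>\<^bsub>M\<^esub> x) \<oplus>\<^bsub>M\<^esub> (b \<odot>\<^bsub>M\<^esub> x)"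
    and add_module: "\<And>a x y. \<lbrakk>a \<in> carrier R; x \<in> carrier M; y \<in> carrier M\<rbrakk>
      \<Longrightarrow> a \<odot>\<^bsub>M\<^esub> (x \<oplus>\<^bsub>M\<^esub> y) = (a \<odot>\<^bsub>M\<^esub> x) \<oplus>\<^bsub>M\<^esub> (a \<odot>\<^bsub>M\<^esub> y)"
    and smult_assoc: "\<And>a b x. \<lbrakk>a \<in> carrier R; b \<in> carrier R; x \<in> carrier M\<rbrakk>
      \<Longrightarrow> (a \<otimes>\<^bsub>R\<^esub> b) \<odot>\<^bsub>M\<^esub> x = b \<odot>\<^bsub>M\<^esub> (a \<odot>\<^bsub>M\<^esub> x)"
    and one: "\<And>x. x \<in> carrier M \<Longrightarrow> \<one>\<^bsub>R\<^esub> \<odot>\<^bsub>M\<^esub> x = x"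
    and smult_zero: "\<And>x. x \<in> carrier M \<Longrightarrow> \<zero>\<^bsub>R\<^esub> \<odot>\<^bsub>M\<^esub> x = \<zero>\<^bsub>M\<^esub>"
  shows "right_module R M"
proof -
  interpret R: ring R by fact
  \<comment> \<open>Negatives come for free: \<open>-1\<close> acts as negation as soon as
    \<open>0\<close> acts as zero. Hence the hypothesis \<open>smult_zero\<close> in place of
    inverses, which are awkward to exhibit for modules of representatives.\<close>
  have "\<exists>y\<in>carrier M. y \<oplus>\<^bsub>M\<^esub> x = \<zero>\<^bsub>M\<^esub>" if "x \<in> carrier M" for x
  proof
    show "(\<ominus>\<^bsub>R\<^esub> \<one>\<^bsub>R\<^esub>) \<odot>\<^bsub>M\<^esub> x \<in> carrier M" using that by (simp add: smult)
    have "((\<ominus>\<^bsub>R\<^esub> \<one>\<^bsub>R\<^esub>) \<odot>\<^bsub>M\<^esub> x) \<oplus>\<^bsub>M\<^esub> x = ((\<ominus>\<^bsub>R\<^esub> \<one>\<^bsub>R\<^esub>) \<oplus>\<^bsub>R\<^esub> \<one>\<^bsub>R\<^esub>) \<odot>\<^bsub>M\<^esub> x"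
      using that by (simp add: add_ring one)
    then show "((\<ominus>\<^bsub>R\<^esub> \<one>\<^bsub>R\<^esub>) \<odot>\<^bsub>M\<^esub> x) \<oplus>\<^bsub>M\<^esub> x = \<zero>\<^bsub>M\<^esub>"
      using that by (simp add: R.l_neg smult_zero)
  qed
  then have "abelian_group M"
    by (intro abelian_groupI add zero assoc comm l_zero)
  then show ?thesis
    unfolding right_module_def right_module_axioms_def
    using assms by blast
qed

context right_module
begin

lemma smult_l_null: "x \<in> carrier M \<Longrightarrow> \<zero>\<^bsub>R\<^esub> \<odot>\<^bsub>M\<^esub> x = \<zero>\<^bsub>M\<^esub>"
  using ract_add_ring[of "\<zero>\<^bsub>R\<^esub>" "\<zero>\<^bsub>R\<^esub>" x] ract_closed[of "\<zero>\<^bsub>R\<^esub>" x]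
  by (simp add: M.add.r_cancel_one')

lemma smult_r_null: "a \<in> carrier R \<Longrightarrow> a \<odot>\<^bsub>M\<^esub> \<zero>\<^bsub>M\<^esub> = \<zero>\<^bsub>M\<^esub>"
  using ract_add_module[of a "\<zero>\<^bsub>M\<^esub>" "\<zero>\<^bsub>M\<^esub>"] ract_closed[of a "\<zero>\<^bsub>M\<^esub>"]
  by (simp add: M.add.r_cancel_one')

lemma smult_minus_one: "x \<in> carrier M \<Longrightarrow> (\<ominus>\<^bsub>R\<^esub> \<one>\<^bsub>R\<^esub>) \<odot>\<^bsub>M\<^esub> x = \<ominus>\<^bsub>M\<^esub> x"
  using ract_add_ring[of "\<ominus>\<^bsub>R\<^esub> \<one>\<^bsub>R\<^esub>" "\<one>\<^bsub>R\<^esub>" x] ract_closed[of "\<ominus>\<^bsub>R\<^esub> \<one>\<^bsub>R\<^esub>" x]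
  by (simp add: R.l_neg smult_l_null ract_one M.minus_equality)

lemma diff_self [simp]: "x \<in> carrier M \<Longrightarrow> x \<ominus>\<^bsub>M\<^esub> x = \<zero>\<^bsub>M\<^esub>"
  by (simp add: M.minus_eq M.r_neg)

lemma diff_zero [simp]: "x \<in> carrier M \<Longrightarrow> x \<ominus>\<^bsub>M\<^esub> \<zero>\<^bsub>M\<^esub> = x"
  by (simp add: M.minus_eq M.add.inv_one[simplified])

lemma diff_eq_zero_iff:
  "\<lbrakk>x \<in> carrier M; y \<in> carrier M\<rbrakk> \<Longrightarrow> x \<ominus>\<^bsub>M\<^esub> y = \<zero>\<^bsub>M\<^esub> \<longleftrightarrow> x = y"
  by (metis M.a_inv_closed M.minus_eq M.minus_equality M.minus_minus M.r_neg)

lemma add_diff_cancel: "\<lbrakk>x \<in> carrier M; y \<in> carrier M\<rbrakk> \<Longrightarrow> y \<oplus>\<^bsub>M\<^esub> (x \<ominus>\<^bsub>M\<^esub> y) = x"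
  by (metis M.a_comm M.a_inv_closed M.minus_eq M.r_neg2 M.a_lcomm)

lemma smult_r_diff:
  "\<lbrakk>a \<in> carrier R; x \<in> carrier M; y \<in> carrier M\<rbrakk>
    \<Longrightarrow> a \<odot>\<^bsub>M\<^esub> (x \<ominus>\<^bsub>M\<^esub> y) = (a \<odot>\<^bsub>M\<^esub> x) \<ominus>\<^bsub>M\<^esub> (a \<odot>\<^bsub>M\<^esub> y)"
  using ract_add_module[of a "x \<ominus>\<^bsub>M\<^esub> y" y] ract_closed
  by (simp add: M.minus_eq M.a_assoc M.l_neg M.r_neg M.add.inv_solve_right')

end

text \<open>Module laws are equations, so they pass along any surjection that respects the
  operations; injectivity is not asked for. One lemma thus serves both quotients and copies along a
  bijection.\<close>

lemma right_module_image:
  assumes "right_module R N" and onto: "h ` carrier N = carrier Q"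
    and add: "\<And>x y. \<lbrakk>x \<in> carrier N; y \<in> carrier N\<rbrakk> \<Longrightarrow> h x \<oplus>\<^bsub>Q\<^esub> h y = h (x \<oplus>\<^bsub>N\<^esub> y)"
    and smult: "\<And>a x. \<lbrakk>a \<in> carrier R; x \<in> carrier N\<rbrakk> \<Longrightarrow> a \<odot>\<^bsub>Q\<^esub> h x = h (a \<odot>\<^bsub>N\<^esub> x)"
    and zero: "\<zero>\<^bsub>Q\<^esub> = h \<zero>\<^bsub>N\<^esub>"
  shows "right_module R Q"
proof -
  interpret N: right_module R N by fact
  have [simp]: "h x \<in> carrier Q" if "x \<in> carrier N" for x using onto that by auto
  have E: "(\<And>x. x \<in> carrier N \<Longrightarrow> P (h x)) \<Longrightarrow> y \<in> carrier Q \<Longrightarrow> P y" for y P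
    unfolding onto[symmetric] by auto
  note [simp] = add smult zero N.ract_closed
  show ?thesis
  proof (rule right_moduleI)
    fix x y z assume "x \<in> carrier Q" "y \<in> carrier Q" "z \<in> carrier Q"
    then obtain x' y' z' where "x = h x'" "y = h y'" "z = h z'"
      "x' \<in> carrier N" "y' \<in> carrier N" "z' \<in> carrier N" unfolding onto[symmetric] by blast
    then show "x \<oplus>\<^bsub>Q\<^esub> y \<oplus>\<^bsub>Q\<^esub> z = x \<oplus>\<^bsub>Q\<^esub> (y \<oplus>\<^bsub>Q\<^esub> z)" by (simp add: N.a_assoc)
  next
    fix x y assume "x \<in> carrier Q" "y \<in> carrier Q"
    then obtain x' y' where "x = h x'" "y = h y'" "x' \<in> carrier N" "y' \<in> carrier N"
      unfolding onto[symmetric] by blast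
    then show "x \<oplus>\<^bsub>Q\<^esub> y = y \<oplus>\<^bsub>Q\<^esub> x" "x \<oplus>\<^bsub>Q\<^esub> y \<in> carrier Q"
      "\<And>a. a \<in> carrier R \<Longrightarrow> a \<odot>\<^bsub>Q\<^esub> (x \<oplus>\<^bsub>Q\<^esub> y) = a \<odot>\<^bsub>Q\<^esub> x \<oplus>\<^bsub>Q\<^esub> a \<odot>\<^bsub>Q\<^esub> y"
      by (simp_all add: N.ract_add_module) (simp add: N.a_comm)
  next
    show "ring R" by (rule N.R.ring_axioms)
  qed (erule E[rotated], simp add: N.ract_add_ring N.ract_assoc N.ract_one N.smult_l_null; fail
    | simp)+
qed

section \<open>Homomorphisms\<close>

lemma mod_homI:
  assumes "\<And>x. x \<in> carrier M \<Longrightarrow> h x \<in> carrier N"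
    and "\<And>x y. \<lbrakk>x \<in> carrier M; y \<in> carrier M\<rbrakk> \<Longrightarrow> h (x \<oplus>\<^bsub>M\<^esub> y) = h x \<oplus>\<^bsub>N\<^esub> h y"
    and "\<And>a x. \<lbrakk>a \<in> carrier R; x \<in> carrier M\<rbrakk> \<Longrightarrow> h (a \<odot>\<^bsub>M\<^esub> x) = a \<odot>\<^bsub>N\<^esub> h x"
    and "h \<in> extensional (carrier M)"
  shows "h \<in> mod_hom R M N"
  using assms by (simp add: mod_hom_def hom_def)

lemma mod_hom_restrictI:
  assumes "right_module R M"
    and "\<And>x. x \<in> carrier M \<Longrightarrow> h x \<in> carrier N"
    and "\<And>x y. \<lbrakk>x \<in> carrier M; y \<in> carrier M\<rbrakk> \<Longrightarrow> h (x \<oplus>\<^bsub>M\<^esub> y) = h x \<oplus>\<^bsub>N\<^esub> h y"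
    and "\<And>a x. \<lbrakk>a \<in> carrier R; x \<in> carrier M\<rbrakk> \<Longrightarrow> h (a \<odot>\<^bsub>M\<^esub> x) = a \<odot>\<^bsub>N\<^esub> h x"
  shows "restrict h (carrier M) \<in> mod_hom R M N"
proof -
  interpret right_module R M by fact
  show ?thesis by (rule mod_homI) (simp_all add: assms ract_closed)
qed

lemma mod_hom_closed: "\<lbrakk>h \<in> mod_hom R M N; x \<in> carrier M\<rbrakk> \<Longrightarrow> h x \<in> carrier N"
  and mod_hom_add: "\<lbrakk>h \<in> mod_hom R M N; x \<in> carrier M; y \<in> carrier M\<rbrakk> \<Longrightarrow> h (x \<oplus>\<^bsub>M\<^esub> y) = h x \<oplus>\<^bsub>N\<^esub> h y"
  and mod_hom_smult: "\<lbrakk>h \<in> mod_hom R M N; a \<in> carrier R; x \<in> carrier M\<rbrakk> \<Longrightarrow> h (a \<odot>\<^bsub>M\<^esub> x) = a \<odot>\<^bsub>N\<^esub> h x"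
  and mod_hom_extensional: "h \<in> mod_hom R M N \<Longrightarrow> h \<in> extensional (carrier M)"
  by (auto simp: mod_hom_def hom_def)

lemma mod_hom_eqI:
  assumes "g \<in> mod_hom R M N" "h \<in> mod_hom R M N'" "\<And>x. x \<in> carrier M \<Longrightarrow> g x = h x"
  shows "g = h"
  using assms mod_hom_extensional by (metis extensionalityI)

locale module_hom = M: right_module R M + N: right_module R N
  for R :: "('r, 'k) ring_scheme" and M :: "('r, 'm) module" and N :: "('r, 'n) module" +
  fixes h assumes hom: "h \<in> mod_hom R M N"
begin

lemma closed [simp]: "x \<in> carrier M \<Longrightarrow> h x \<in> carrier N"
  and add [simp]: "\<lbrakk>x \<in> carrier M; y \<in> carrier M\<rbrakk> \<Longrightarrow> h (x \<oplus>\<^bsub>M\<^esub> y) = h x \<oplus>\<^bsub>N\<^esub> h y"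
  and smult [simp]: "\<lbrakk>a \<in> carrier R; x \<in> carrier M\<rbrakk> \<Longrightarrow> h (a \<odot>\<^bsub>M\<^esub> x) = a \<odot>\<^bsub>N\<^esub> h x"
  using hom by (simp_all add: mod_hom_closed mod_hom_add mod_hom_smult)

lemma zero [simp]: "h \<zero>\<^bsub>M\<^esub> = \<zero>\<^bsub>N\<^esub>"
  using add[of "\<zero>\<^bsub>M\<^esub>" "\<zero>\<^bsub>M\<^esub>"] closed[of "\<zero>\<^bsub>M\<^esub>"] by (simp add: N.add.r_cancel_one')

lemma minus [simp]: "x \<in> carrier M \<Longrightarrow> h (\<ominus>\<^bsub>M\<^esub> x) = \<ominus>\<^bsub>N\<^esub> h x"
  using add[of "\<ominus>\<^bsub>M\<^esub> x" x] by (simp add: M.l_neg N.minus_equality)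

lemma diff [simp]:
  "\<lbrakk>x \<in> carrier M; y \<in> carrier M\<rbrakk> \<Longrightarrow> h (x \<ominus>\<^bsub>M\<^esub> y) = h x \<ominus>\<^bsub>N\<^esub> h y"
  by (simp add: M.minus_eq N.minus_eq)

end

lemma module_homI:
  "\<lbrakk>right_module R M; right_module R N; h \<in> mod_hom R M N\<rbrakk> \<Longrightarrow> module_hom R M N h"
  by (simp add: module_hom_def module_hom_axioms_def)

lemma mod_hom_comp:
  assumes "right_module R L" "f \<in> mod_hom R L M" "g \<in> mod_hom R M N"
  shows "compose (carrier L) g f \<in> mod_hom R L N"
  unfolding compose_def
  using assms by (intro mod_hom_restrictI) (simp_all add: mod_hom_closed mod_hom_add mod_hom_smult)

lemma mod_hom_id: "right_module R M \<Longrightarrow> (\<lambda>x\<in>carrier M. x) \<in> mod_hom R M M"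
  by (intro mod_hom_restrictI) auto

lemma mod_hom_sum:
  assumes "right_module R M" "right_module R N" "f \<in> mod_hom R M N" "g \<in> mod_hom R M N"
  shows "(\<lambda>x\<in>carrier M. f x \<oplus>\<^bsub>N\<^esub> g x) \<in> mod_hom R M N"
proof -
  interpret f: module_hom R M N f using assms by (simp add: module_homI)
  interpret g: module_hom R M N g using assms by (simp add: module_homI)
  show ?thesis
    by (intro mod_hom_restrictI) (simp_all add: assms(1) f.N.a_ac f.N.ract_add_module)
qed

lemma mod_hom_diff:
  assumes "right_module R M" "right_module R N" "f \<in> mod_hom R M N" "g \<in> mod_hom R M N"
  shows "(\<lambda>x\<in>carrier M. f x \<ominus>\<^bsub>N\<^esub> g x) \<in> mod_hom R M N"
proof -
  interpret f: module_hom R M N f using assms by (simp add: module_homI)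
  interpret g: module_hom R M N g using assms by (simp add: module_homI)
  show ?thesis
    by (intro mod_hom_restrictI)
      (simp_all add: assms(1) f.N.a_ac f.N.minus_add f.N.minus_eq f.N.smult_r_diff[unfolded f.N.minus_eq])
qed

lemma mod_hom_zero:
  assumes "right_module R M" "right_module R N"
  shows "(\<lambda>x\<in>carrier M. \<zero>\<^bsub>N\<^esub>) \<in> mod_hom R M N"
proof -
  interpret M: right_module R M by fact
  interpret N: right_module R N by fact
  show ?thesis by (intro mod_hom_restrictI) (simp_all add: assms(1) N.smult_r_null)
qed

text \<open>An additive relation is single-valued once the only value over zero is zero, because two
  values over the same point differ by a value over zero. Maps given by representatives are built
  this way: the relation ranges over all representatives, and independence of the choice shrinks to
  the single condition \<open>zero\<close>.\<close>

lemma mod_hom_of_graph: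
  assumes "right_module R X" "right_module R Y"
    and total: "\<And>x. x \<in> carrier X \<Longrightarrow> \<exists>y. P x y"
    and rng: "\<And>x y. P x y \<Longrightarrow> x \<in> carrier X \<and> y \<in> carrier Y"
    and add: "\<And>x y x' y'. \<lbrakk>P x y; P x' y'\<rbrakk> \<Longrightarrow> P (x \<oplus>\<^bsub>X\<^esub> x') (y \<oplus>\<^bsub>Y\<^esub> y')"
    and smult: "\<And>a x y. \<lbrakk>a \<in> carrier R; P x y\<rbrakk> \<Longrightarrow> P (a \<odot>\<^bsub>X\<^esub> x) (a \<odot>\<^bsub>Y\<^esub> y)"
    and zero: "\<And>y. P \<zero>\<^bsub>X\<^esub> y \<Longrightarrow> y = \<zero>\<^bsub>Y\<^esub>"
  shows "\<exists>h\<in>mod_hom R X Y. \<forall>x y. P x y \<longrightarrow> h x = y"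
proof -
  interpret X: right_module R X by fact
  interpret Y: right_module R Y by fact
  have func: "y = y'" if "P x y" "P x y'" for x y y'
  proof -
    have "P (x \<oplus>\<^bsub>X\<^esub> (\<ominus>\<^bsub>R\<^esub> \<one>\<^bsub>R\<^esub>) \<odot>\<^bsub>X\<^esub> x) (y \<oplus>\<^bsub>Y\<^esub> (\<ominus>\<^bsub>R\<^esub> \<one>\<^bsub>R\<^esub>) \<odot>\<^bsub>Y\<^esub> y')"
      using that by (intro add smult) auto
    then have "y \<ominus>\<^bsub>Y\<^esub> y' = \<zero>\<^bsub>Y\<^esub>"
      using rng that zero by (auto simp: X.smult_minus_one Y.smult_minus_one X.r_neg Y.minus_eq)
    then show ?thesis using rng that Y.diff_eq_zero_iff by blast
  qed
  define h where "h = (\<lambda>x\<in>carrier X. SOME y. P x y)"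
  have h: "P x (h x)" if "x \<in> carrier X" for x
    using someI_ex[OF total[OF that]] that by (simp add: h_def)
  show ?thesis
  proof (intro bexI allI impI)
    show "h x = y" if "P x y" for x y
      using that func h rng by blast
    show "h \<in> mod_hom R X Y"
    proof (rule mod_homI)
      show "h \<in> extensional (carrier X)" by (simp add: h_def)
      show "h x \<in> carrier Y" if "x \<in> carrier X" for x using h[OF that] rng by blast
      show "h (x \<oplus>\<^bsub>X\<^esub> y) = h x \<oplus>\<^bsub>Y\<^esub> h y" if "x \<in> carrier X" "y \<in> carrier X" for x y
        using that by (intro func[OF h add[OF h h]]) auto
      show "h (a \<odot>\<^bsub>X\<^esub> x) = a \<odot>\<^bsub>Y\<^esub> h x" if "a \<in> carrier R" "x \<in> carrier X" for a x
        using that by (intro func[OF h smult[OF _ h]]) (auto simp: X.ract_closed)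
    qed
  qed
qed

lemma mod_hom_descend:
  assumes "right_module R F" "right_module R X" "right_module R Y"
    and "p \<in> mod_hom R F X" "g \<in> mod_hom R F Y" "p ` carrier F = carrier X"
    and ker: "\<And>u. \<lbrakk>u \<in> carrier F; p u = \<zero>\<^bsub>X\<^esub>\<rbrakk> \<Longrightarrow> g u = \<zero>\<^bsub>Y\<^esub>"
  shows "\<exists>h\<in>mod_hom R X Y. \<forall>u\<in>carrier F. h (p u) = g u"
proof -
  interpret p: module_hom R F X p using assms by (simp add: module_homI)
  interpret g: module_hom R F Y g using assms by (simp add: module_homI)
  have "\<exists>h\<in>mod_hom R X Y. \<forall>x y. (\<exists>u\<in>carrier F. x = p u \<and> y = g u) \<longrightarrow> h x = y"
  proof (rule mod_hom_of_graph)
    fix x y x' y' 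
    assume "\<exists>u\<in>carrier F. x = p u \<and> y = g u" "\<exists>u\<in>carrier F. x' = p u \<and> y' = g u"
    then obtain u v where "u \<in> carrier F" "v \<in> carrier F" "x = p u" "y = g u" "x' = p v" "y' = g v"
      by blast
    then show "\<exists>u\<in>carrier F. x \<oplus>\<^bsub>X\<^esub> x' = p u \<and> y \<oplus>\<^bsub>Y\<^esub> y' = g u"
      by (intro bexI[of _ "u \<oplus>\<^bsub>F\<^esub> v"]) auto
  next
    fix a x y
    assume "a \<in> carrier R" "\<exists>u\<in>carrier F. x = p u \<and> y = g u"
    then show "\<exists>u\<in>carrier F. a \<odot>\<^bsub>X\<^esub> x = p u \<and> a \<odot>\<^bsub>Y\<^esub> y = g u"
      by (metis p.M.ract_closed p.smult g.smult)
  qed (use assms in \<open>auto simp: image_iff\<close>, metis imageE)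
  then show ?thesis by blast
qed

lemma mod_hom_lift_inj:
  assumes "right_module R X" "right_module R Y" "right_module R Z"
    and "f \<in> mod_hom R Y Z" "inj_on f (carrier Y)" "s \<in> mod_hom R X Z"
    and im: "\<And>x. x \<in> carrier X \<Longrightarrow> s x \<in> f ` carrier Y"
  shows "\<exists>h\<in>mod_hom R X Y. \<forall>x\<in>carrier X. f (h x) = s x"
proof -
  interpret f: module_hom R Y Z f using assms by (simp add: module_homI)
  interpret s: module_hom R X Z s using assms by (simp add: module_homI)
  have "\<exists>h\<in>mod_hom R X Y. \<forall>x y. (x \<in> carrier X \<and> y \<in> carrier Y \<and> s x = f y) \<longrightarrow> h x = y"
  proof (rule mod_hom_of_graph)
    show "y = \<zero>\<^bsub>Y\<^esub>" if "\<zero>\<^bsub>X\<^esub> \<in> carrier X \<and> y \<in> carrier Y \<and> s \<zero>\<^bsub>X\<^esub> = f y" for y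
      using that inj_onD[OF assms(5), of y "\<zero>\<^bsub>Y\<^esub>"] by simp
    show "\<exists>y. x \<in> carrier X \<and> y \<in> carrier Y \<and> s x = f y" if "x \<in> carrier X" for x
      using im[OF that] that by blast
  qed (use assms in \<open>auto simp: s.M.ract_closed f.M.ract_closed\<close>)
  then show ?thesis using im by (metis imageE)
qed

lemma mod_iso_inverse:
  assumes "right_module R X" "right_module R Y"
    and f: "f \<in> mod_hom R X Y" "bij_betw f (carrier X) (carrier Y)"
  obtains g where "g \<in> mod_hom R Y X" "bij_betw g (carrier Y) (carrier X)"
    "\<And>x. x \<in> carrier X \<Longrightarrow> g (f x) = x" "\<And>y. y \<in> carrier Y \<Longrightarrow> f (g y) = y"
proof -
  have "\<exists>g\<in>mod_hom R Y X. \<forall>y\<in>carrier Y. f (g y) = (\<lambda>x\<in>carrier Y. x) y"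
    using mod_hom_id[OF assms(2)] assms(1,2) f
    by (intro mod_hom_lift_inj) (simp_all add: bij_betw_def del: restrict_apply, simp)
  then obtain g where g: "g \<in> mod_hom R Y X" "\<And>y. y \<in> carrier Y \<Longrightarrow> f (g y) = y" by auto
  moreover have gf: "g (f x) = x" if "x \<in> carrier X" for x
    using that f g by (metis bij_betw_def inj_onD mod_hom_closed)
  moreover have "bij_betw g (carrier Y) (carrier X)"
    by (rule bij_betwI[of _ _ _ f]) (use f g gf mod_hom_closed in \<open>auto simp: bij_betw_def\<close>)
  ultimately show thesis using that by blast
qed

section \<open>Submodules, quotients and products\<close>

text \<open>Negatives are covered by the action of \<open>-1\<close>. Kernels, images, preimages and
  equalizers of homomorphisms all have this form.\<close>

definition module_closed :: "('r, 'k) ring_scheme \<Rightarrow> ('r, 'm) module \<Rightarrow> 'm set \<Rightarrow> bool" where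
  "module_closed R M S \<longleftrightarrow> S \<subseteq> carrier M \<and> \<zero>\<^bsub>M\<^esub> \<in> S \<and>
     (\<forall>x\<in>S. \<forall>y\<in>S. x \<oplus>\<^bsub>M\<^esub> y \<in> S) \<and> (\<forall>a\<in>carrier R. \<forall>x\<in>S. a \<odot>\<^bsub>M\<^esub> x \<in> S)"

lemma module_closedI:
  assumes "S \<subseteq> carrier M" "\<zero>\<^bsub>M\<^esub> \<in> S" "\<And>x y. \<lbrakk>x \<in> S; y \<in> S\<rbrakk> \<Longrightarrow> x \<oplus>\<^bsub>M\<^esub> y \<in> S"
    "\<And>a x. \<lbrakk>a \<in> carrier R; x \<in> S\<rbrakk> \<Longrightarrow> a \<odot>\<^bsub>M\<^esub> x \<in> S"
  shows "module_closed R M S"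
  using assms by (simp add: module_closed_def)

lemma right_module_sub:
  assumes "right_module R M" "module_closed R M S"
  shows "right_module R (M\<lparr>carrier := S\<rparr>)"
proof -
  interpret right_module R M by fact
  have [simp]: "x \<in> carrier M" if "x \<in> S" for x
    using assms(2) that by (auto simp: module_closed_def)
  show ?thesis
    using assms(2)
    by (intro right_moduleI)
      (simp_all add: module_closed_def R.ring_axioms a_ac ract_add_ring
        ract_add_module ract_assoc ract_one smult_l_null)
qed

lemma mod_hom_incl:
  assumes "right_module R M" "module_closed R M S"
  shows "(\<lambda>x\<in>S. x) \<in> mod_hom R (M\<lparr>carrier := S\<rparr>) M"
  using mod_hom_restrictI[OF right_module_sub[OF assms], of "\<lambda>x. x" M] assms(2)
  by (auto simp: module_closed_def)

lemma mod_hom_corestrict: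
  assumes "h \<in> mod_hom R L M" "\<And>x. x \<in> carrier L \<Longrightarrow> h x \<in> S"
  shows "h \<in> mod_hom R L (M\<lparr>carrier := S\<rparr>)"
  using assms by (intro mod_homI) (auto simp: mod_hom_add mod_hom_smult mod_hom_extensional)

lemma mod_hom_restrict_sub:
  assumes "h \<in> mod_hom R M N" "module_closed R M S"
  shows "restrict h S \<in> mod_hom R (M\<lparr>carrier := S\<rparr>) N"
  using assms
  by (intro mod_homI)
    (auto simp: mod_hom_add mod_hom_smult mod_hom_closed module_closed_def subset_iff)

lemma (in module_hom) kernel_closed: "module_closed R M {x \<in> carrier M. h x = \<zero>\<^bsub>N\<^esub>}"
  by (rule module_closedI) (auto simp: M.ract_closed N.smult_r_null)

lemma (in module_hom) image_closed: "module_closed R N (h ` carrier M)"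
proof (rule module_closedI)
  show "\<zero>\<^bsub>N\<^esub> \<in> h ` carrier M" using zero by (metis M.zero_closed image_eqI)
qed (auto simp: image_iff M.ract_closed, metis add M.a_closed, metis smult M.ract_closed)

lemma (in module_hom) vimage_closed:
  assumes "module_closed R N S"
  shows "module_closed R M {x \<in> carrier M. h x \<in> S}"
  using assms by (intro module_closedI) (auto simp: M.ract_closed module_closed_def)

text \<open>Representatives instead of cosets keep the quotient inside the type of \<open>N\<close>.\<close>

lemma quotient_module_exists:
  fixes N :: "('r, 'n) module"
  assumes "right_module R N" "module_closed R N K"
  obtains Q q where "right_module R Q" "carrier Q \<subseteq> carrier N" "q \<in> mod_hom R N Q"
    "q ` carrier N = carrier Q" "\<And>x. x \<in> carrier N \<Longrightarrow> q x = \<zero>\<^bsub>Q\<^esub> \<longleftrightarrow> x \<in> K"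
proof -
  interpret N: right_module R N by fact
  have KN: "\<And>x. x \<in> K \<Longrightarrow> x \<in> carrier N" and K0: "\<zero>\<^bsub>N\<^esub> \<in> K"
    and Kadd: "\<And>x y. \<lbrakk>x \<in> K; y \<in> K\<rbrakk> \<Longrightarrow> x \<oplus>\<^bsub>N\<^esub> y \<in> K"
    and Ksm: "\<And>a x. \<lbrakk>a \<in> carrier R; x \<in> K\<rbrakk> \<Longrightarrow> a \<odot>\<^bsub>N\<^esub> x \<in> K"
    using assms(2) by (auto simp: module_closed_def)
  have Kneg: "\<ominus>\<^bsub>N\<^esub> x \<in> K" if "x \<in> K" for x
    using Ksm[of "\<ominus>\<^bsub>R\<^esub> \<one>\<^bsub>R\<^esub>" x] that KN by (simp add: N.smult_minus_one)
  \<comment> \<open>\<open>E x\<close> is the coset of \<open>x\<close>, and \<open>r\<close> picks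
    one element of each coset. Congruent arguments have the same coset, hence the same pick, so
    \<open>r x = r y\<close> expresses congruence modulo \<open>K\<close>; the operations of the
    quotient are those of \<open>N\<close> followed by \<open>r\<close>.\<close>
  define E where "E x = {y \<in> carrier N. y \<ominus>\<^bsub>N\<^esub> x \<in> K}" for x
  define r where "r = (\<lambda>x\<in>carrier N. SOME y. y \<in> E x)"
  have self: "x \<in> E x" if "x \<in> carrier N" for x
    using that K0 by (simp add: E_def)
  have rE: "r x \<in> E x" if "x \<in> carrier N" for x
    using someI[of "\<lambda>y. y \<in> E x", OF self[OF that]] that by (simp add: r_def)
  have rN: "r x \<in> carrier N" and rK: "r x \<ominus>\<^bsub>N\<^esub> x \<in> K" if "x \<in> carrier N" for x
    using rE[OF that] by (auto simp: E_def)
  have Esub: "E x \<subseteq> E y" if "x \<in> carrier N" "y \<in> carrier N" "x \<ominus>\<^bsub>N\<^esub> y \<in> K" for x y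
  proof
    fix z assume z: "z \<in> E x"
    then have "z \<ominus>\<^bsub>N\<^esub> y = (z \<ominus>\<^bsub>N\<^esub> x) \<oplus>\<^bsub>N\<^esub> (x \<ominus>\<^bsub>N\<^esub> y)"
      using that by (simp add: E_def N.minus_eq N.a_assoc N.r_neg1)
    then show "z \<in> E y" using z that Kadd by (auto simp: E_def)
  qed
  have sym: "y \<ominus>\<^bsub>N\<^esub> x \<in> K" if "x \<in> carrier N" "y \<in> carrier N" "x \<ominus>\<^bsub>N\<^esub> y \<in> K" for x y
    using Kneg[OF that(3)] that by (simp add: N.minus_eq N.minus_add N.a_comm)
  have req: "r x = r y" if "x \<in> carrier N" "y \<in> carrier N" "x \<ominus>\<^bsub>N\<^esub> y \<in> K" for x y
  proof -
    have "E x = E y" using Esub sym that by blast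
    then show ?thesis using that by (simp add: r_def)
  qed
  have r_eq_iff: "r x = r y \<longleftrightarrow> x \<ominus>\<^bsub>N\<^esub> y \<in> K" if "x \<in> carrier N" "y \<in> carrier N" for x y
  proof
    assume "r x = r y"
    then have "y \<in> E x" using self[OF that(2)] rK[OF that(1)] rK[OF that(2)] rN that Esub sym
      by (metis (no_types, lifting) E_def mem_Collect_eq subsetD)
    then show "x \<ominus>\<^bsub>N\<^esub> y \<in> K" using that sym by (simp add: E_def)
  qed (use req that in blast)
  have rr: "r (r x) = r x" if "x \<in> carrier N" for x
    using req rK rN that by blast
  have radd: "r (r x \<oplus>\<^bsub>N\<^esub> y) = r (x \<oplus>\<^bsub>N\<^esub> y)" if "x \<in> carrier N" "y \<in> carrier N" for x y
  proof (rule req)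
    have "(r x \<oplus>\<^bsub>N\<^esub> y) \<ominus>\<^bsub>N\<^esub> (x \<oplus>\<^bsub>N\<^esub> y) = r x \<ominus>\<^bsub>N\<^esub> x"
      using that rN N.r_neg[of y] N.a_lcomm[of y "\<ominus>\<^bsub>N\<^esub> x" "\<ominus>\<^bsub>N\<^esub> y"]
      by (simp add: N.minus_eq N.minus_add N.a_assoc)
    then show "(r x \<oplus>\<^bsub>N\<^esub> y) \<ominus>\<^bsub>N\<^esub> (x \<oplus>\<^bsub>N\<^esub> y) \<in> K" using rK that by simp
  qed (use that rN in auto)
  have radd': "r (y \<oplus>\<^bsub>N\<^esub> r x) = r (y \<oplus>\<^bsub>N\<^esub> x)" if "x \<in> carrier N" "y \<in> carrier N" for x y
    using radd[OF that] that rN by (simp add: N.a_comm)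
  have rsm: "r (a \<odot>\<^bsub>N\<^esub> r x) = r (a \<odot>\<^bsub>N\<^esub> x)" if "x \<in> carrier N" "a \<in> carrier R" for a x
    using that rN rK Ksm by (intro req) (simp_all add: N.ract_closed flip: N.smult_r_diff)
  define Q :: "('r, 'n) module" where "Q = \<lparr>carrier = r ` carrier N, monoid.mult = undefined, one = undefined,
      ring.zero = r \<zero>\<^bsub>N\<^esub>, ring.add = (\<lambda>x y. r (x \<oplus>\<^bsub>N\<^esub> y)), module.smult = (\<lambda>a x. r (a \<odot>\<^bsub>N\<^esub> x))\<rparr>"
  have "right_module R Q"
    by (rule right_module_image[OF assms(1), of r])
      (simp_all add: Q_def rN radd radd' rsm)
  moreover have "r \<in> mod_hom R N Q"
    by (rule mod_homI) (auto simp: Q_def radd radd' rsm rN, simp add: r_def)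
  moreover have "r x = \<zero>\<^bsub>Q\<^esub> \<longleftrightarrow> x \<in> K" if "x \<in> carrier N" for x
    using that r_eq_iff[of x "\<zero>\<^bsub>N\<^esub>"] by (simp add: Q_def)
  moreover have "carrier Q \<subseteq> carrier N" "r ` carrier N = carrier Q"
    using rN by (auto simp: Q_def)
  ultimately show thesis using that by blast
qed

section \<open>Products, direct sums and transport of structure\<close>

definition product_module :: "'i set \<Rightarrow> ('i \<Rightarrow> ('r, 'm) module) \<Rightarrow> ('r, 'i \<Rightarrow> 'm) module" where
  "product_module I Y =
     \<lparr>carrier = \<Pi>\<^sub>E i\<in>I. carrier (Y i), monoid.mult = undefined, one = undefined,
      ring.zero = (\<lambda>i\<in>I. \<zero>\<^bsub>Y i\<^esub>),
      ring.add = (\<lambda>x y. \<lambda>i\<in>I. x i \<oplus>\<^bsub>Y i\<^esub> y i),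
      module.smult = (\<lambda>a x. \<lambda>i\<in>I. a \<odot>\<^bsub>Y i\<^esub> x i)\<rparr>"

lemma right_module_product:
  assumes "ring R" "\<And>i. i \<in> I \<Longrightarrow> right_module R (Y i)"
  shows "right_module R (product_module I Y)"
proof -
  interpret R: ring R by fact
  note M = assms(2)[THEN right_module.axioms(2)]
  note ac = abelian_group.axioms(1)[OF M]
  show ?thesis
  proof (rule right_moduleI[OF \<open>ring R\<close>])
    fix x y z
    assume "x \<in> carrier (product_module I Y)" "y \<in> carrier (product_module I Y)"
      "z \<in> carrier (product_module I Y)"
    then show "x \<oplus>\<^bsub>product_module I Y\<^esub> y \<oplus>\<^bsub>product_module I Y\<^esub> z
        = x \<oplus>\<^bsub>product_module I Y\<^esub> (y \<oplus>\<^bsub>product_module I Y\<^esub> z)"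
      by (simp add: product_module_def PiE_iff abelian_monoid.a_assoc[OF ac] cong: restrict_cong)
  next
    fix x y
    assume "x \<in> carrier (product_module I Y)" "y \<in> carrier (product_module I Y)"
    then show "x \<oplus>\<^bsub>product_module I Y\<^esub> y \<in> carrier (product_module I Y)"
      and "x \<oplus>\<^bsub>product_module I Y\<^esub> y = y \<oplus>\<^bsub>product_module I Y\<^esub> x"
      and "\<And>a. a \<in> carrier R \<Longrightarrow> a \<odot>\<^bsub>product_module I Y\<^esub> (x \<oplus>\<^bsub>product_module I Y\<^esub> y)
        = a \<odot>\<^bsub>product_module I Y\<^esub> x \<oplus>\<^bsub>product_module I Y\<^esub> a \<odot>\<^bsub>product_module I Y\<^esub> y"
      by (simp_all add: product_module_def PiE_iff abelian_monoid.a_closed[OF ac]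
        abelian_monoid.a_comm[OF ac] right_module.ract_add_module[OF assms(2)] cong: restrict_cong)
  next
    fix x a
    assume x: "x \<in> carrier (product_module I Y)" and a: "a \<in> carrier R"
    then show "a \<odot>\<^bsub>product_module I Y\<^esub> x \<in> carrier (product_module I Y)"
      by (simp add: product_module_def PiE_iff right_module.ract_closed[OF assms(2)])
    fix b
    assume "b \<in> carrier R"
    then show "(a \<oplus>\<^bsub>R\<^esub> b) \<odot>\<^bsub>product_module I Y\<^esub> x
        = a \<odot>\<^bsub>product_module I Y\<^esub> x \<oplus>\<^bsub>product_module I Y\<^esub> b \<odot>\<^bsub>product_module I Y\<^esub> x"
      and "(a \<otimes>\<^bsub>R\<^esub> b) \<odot>\<^bsub>product_module I Y\<^esub> x
        = b \<odot>\<^bsub>product_module I Y\<^esub> (a \<odot>\<^bsub>product_module I Y\<^esub> x)"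
      using x a by (simp_all add: product_module_def PiE_iff right_module.ract_add_ring[OF assms(2)]
        right_module.ract_assoc[OF assms(2)] cong: restrict_cong)
  next
    fix x
    assume "x \<in> carrier (product_module I Y)"
    then show "\<zero>\<^bsub>product_module I Y\<^esub> \<oplus>\<^bsub>product_module I Y\<^esub> x = x"
      and "\<one>\<^bsub>R\<^esub> \<odot>\<^bsub>product_module I Y\<^esub> x = x"
      and "\<zero>\<^bsub>R\<^esub> \<odot>\<^bsub>product_module I Y\<^esub> x = \<zero>\<^bsub>product_module I Y\<^esub>"
      by (simp_all add: product_module_def PiE_iff right_module.ract_one[OF assms(2)]
        abelian_monoid.l_zero[OF ac] right_module.smult_l_null[OF assms(2)] extensional_restrict
        cong: restrict_cong)
  qed (simp add: product_module_def PiE_iff abelian_monoid.zero_closed[OF ac])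
qed

lemma direct_sum_eq_sub:
  "direct_sum I Y = (product_module I Y)\<lparr>carrier :=
     {x \<in> \<Pi>\<^sub>E i\<in>I. carrier (Y i). finite {i \<in> I. x i \<noteq> \<zero>\<^bsub>Y i\<^esub>}}\<rparr>"
  by (simp add: direct_sum_def product_module_def)

lemma direct_sum_closed:
  assumes "ring R" "\<And>i. i \<in> I \<Longrightarrow> right_module R (Y i)"
  shows "module_closed R (product_module I Y)
     {x \<in> \<Pi>\<^sub>E i\<in>I. carrier (Y i). finite {i \<in> I. x i \<noteq> \<zero>\<^bsub>Y i\<^esub>}}"
proof -
  note M = assms(2)[THEN right_module.axioms(2)]
  note ac = abelian_group.axioms(1)[OF M]
  note [simp] = abelian_monoid.a_closed[OF ac] abelian_monoid.zero_closed[OF ac]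
    abelian_monoid.l_zero[OF ac] right_module.ract_closed[OF assms(2)]
    right_module.smult_r_null[OF assms(2)]
  show ?thesis
  proof (rule module_closedI)
    fix x y
    assume *: "x \<in> {x \<in> \<Pi>\<^sub>E i\<in>I. carrier (Y i). finite {i \<in> I. x i \<noteq> \<zero>\<^bsub>Y i\<^esub>}}"
      "y \<in> {x \<in> \<Pi>\<^sub>E i\<in>I. carrier (Y i). finite {i \<in> I. x i \<noteq> \<zero>\<^bsub>Y i\<^esub>}}"
    have "x i \<oplus>\<^bsub>Y i\<^esub> y i = \<zero>\<^bsub>Y i\<^esub>" if "i \<in> I" "x i = \<zero>\<^bsub>Y i\<^esub>" "y i = \<zero>\<^bsub>Y i\<^esub>" for i
      using that by simp
    then have "{i \<in> I. x i \<oplus>\<^bsub>Y i\<^esub> y i \<noteq> \<zero>\<^bsub>Y i\<^esub>}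
        \<subseteq> {i \<in> I. x i \<noteq> \<zero>\<^bsub>Y i\<^esub>} \<union> {i \<in> I. y i \<noteq> \<zero>\<^bsub>Y i\<^esub>}" by blast
    then have "finite {i \<in> I. x i \<oplus>\<^bsub>Y i\<^esub> y i \<noteq> \<zero>\<^bsub>Y i\<^esub>}"
      using * by (elim finite_subset) simp
    then show "x \<oplus>\<^bsub>product_module I Y\<^esub> y
        \<in> {x \<in> \<Pi>\<^sub>E i\<in>I. carrier (Y i). finite {i \<in> I. x i \<noteq> \<zero>\<^bsub>Y i\<^esub>}}"
      using * by (simp add: product_module_def PiE_iff cong: conj_cong)
  next
    fix a x
    assume *: "a \<in> carrier R" "x \<in> {x \<in> \<Pi>\<^sub>E i\<in>I. carrier (Y i). finite {i \<in> I. x i \<noteq> \<zero>\<^bsub>Y i\<^esub>}}"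
    have "a \<odot>\<^bsub>Y i\<^esub> x i = \<zero>\<^bsub>Y i\<^esub>" if "i \<in> I" "x i = \<zero>\<^bsub>Y i\<^esub>" for i
      using that * by simp
    then have "{i \<in> I. a \<odot>\<^bsub>Y i\<^esub> x i \<noteq> \<zero>\<^bsub>Y i\<^esub>} \<subseteq> {i \<in> I. x i \<noteq> \<zero>\<^bsub>Y i\<^esub>}" by blast
    then have "finite {i \<in> I. a \<odot>\<^bsub>Y i\<^esub> x i \<noteq> \<zero>\<^bsub>Y i\<^esub>}"
      using * by (elim finite_subset) simp
    then show "a \<odot>\<^bsub>product_module I Y\<^esub> x
        \<in> {x \<in> \<Pi>\<^sub>E i\<in>I. carrier (Y i). finite {i \<in> I. x i \<noteq> \<zero>\<^bsub>Y i\<^esub>}}"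
      using * by (simp add: product_module_def PiE_iff cong: conj_cong)
  next
    show "\<zero>\<^bsub>product_module I Y\<^esub>
        \<in> {x \<in> \<Pi>\<^sub>E i\<in>I. carrier (Y i). finite {i \<in> I. x i \<noteq> \<zero>\<^bsub>Y i\<^esub>}}"
      by (simp add: product_module_def PiE_iff cong: conj_cong)
  qed (auto simp: product_module_def)
qed

lemma right_module_direct_sum:
  assumes "ring R" "\<And>i. i \<in> I \<Longrightarrow> right_module R (Y i)"
  shows "right_module R (direct_sum I Y)"
  unfolding direct_sum_eq_sub
  by (rule right_module_sub[OF right_module_product[OF assms] direct_sum_closed[OF assms]])

text \<open>The factors may have different types: the pushout extension that proves membership in
  \<open>\<A>\<close> is a quotient of such a pair.\<close>

definition pair_module :: "('r, 'm) module \<Rightarrow> ('r, 'n) module \<Rightarrow> ('r, 'm \<times> 'n) module" where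
  "pair_module M N =
     \<lparr>carrier = carrier M \<times> carrier N, monoid.mult = undefined, one = undefined,
      ring.zero = (\<zero>\<^bsub>M\<^esub>, \<zero>\<^bsub>N\<^esub>),
      ring.add = (\<lambda>x y. (fst x \<oplus>\<^bsub>M\<^esub> fst y, snd x \<oplus>\<^bsub>N\<^esub> snd y)),
      module.smult = (\<lambda>a x. (a \<odot>\<^bsub>M\<^esub> fst x, a \<odot>\<^bsub>N\<^esub> snd x))\<rparr>"

lemma right_module_pair:
  assumes "right_module R M" "right_module R N"
  shows "right_module R (pair_module M N)"
proof -
  interpret M: right_module R M by fact
  interpret N: right_module R N by fact
  show ?thesis
    by (rule right_moduleI)
      (auto simp: pair_module_def M.R.ring_axioms M.a_ac N.a_ac M.ract_closed N.ract_closed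
        M.ract_add_ring N.ract_add_ring M.ract_add_module N.ract_add_module M.ract_assoc N.ract_assoc
        M.ract_one N.ract_one M.smult_l_null N.smult_l_null)
qed

text \<open>Transport of structure along an injection into \<open>S\<close>. The type of
  \<open>S\<close> is unrelated to that of \<open>N\<close>, which is how modules of functions come
  to be represented over the type of the universe.\<close>

lemma module_transfer:
  fixes N :: "('r, 'n) module" and S :: "'m set"
  assumes "right_module R N" "carrier N \<lesssim> S"
  obtains N' h where "right_module R N'" "carrier N' \<subseteq> S" "h \<in> mod_hom R N N'"
    "bij_betw h (carrier N) (carrier N')"
proof -
  interpret N: right_module R N by fact
  obtain i where i: "inj_on i (carrier N)" "i ` carrier N \<subseteq> S"
    using assms(2) by (auto simp: lepoll_def)
  define j where "j = inv_into (carrier N) i"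
  have [simp]: "j (i x) = x" if "x \<in> carrier N" for x
    using i that by (simp add: j_def)
  define N' :: "('r, 'm) module" where "N' = \<lparr>carrier = i ` carrier N, monoid.mult = undefined, one = undefined,
      ring.zero = i \<zero>\<^bsub>N\<^esub>, ring.add = (\<lambda>x y. i (j x \<oplus>\<^bsub>N\<^esub> j y)), module.smult = (\<lambda>a x. i (a \<odot>\<^bsub>N\<^esub> j x))\<rparr>"
  have "right_module R N'"
    by (rule right_module_image[OF assms(1), of i]) (simp_all add: N'_def)
  moreover have "restrict i (carrier N) \<in> mod_hom R N N'"
    by (rule mod_hom_restrictI[OF assms(1)]) (auto simp: N'_def)
  moreover have "bij_betw (restrict i (carrier N)) (carrier N) (carrier N')"
    using i by (simp add: N'_def bij_betw_def inj_on_def)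
  ultimately show thesis using that i by (simp add: N'_def)
qed

section \<open>Free modules\<close>

lemma (in ring) right_module_regular: "right_module R (regular_module R)"
  by (rule right_moduleI)
    (simp_all add: regular_module_def ring_axioms a_ac m_assoc l_distr r_distr)

lemma (in ring) right_module_free: "right_module R (free_module R I)"
  unfolding free_module_def
  by (rule right_module_direct_sum) (simp_all add: ring_axioms right_module_regular)

definition free_basis :: "('r, 'k) ring_scheme \<Rightarrow> 'i set \<Rightarrow> 'i \<Rightarrow> 'i \<Rightarrow> 'r" where
  "free_basis R I i = (\<lambda>j\<in>I. if j = i then \<one>\<^bsub>R\<^esub> else \<zero>\<^bsub>R\<^esub>)"

lemma carrier_free:
  "carrier (free_module R I) = {u \<in> I \<rightarrow>\<^sub>E carrier R. finite {i \<in> I. u i \<noteq> \<zero>\<^bsub>R\<^esub>}}"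
  by (simp add: free_module_def direct_sum_def regular_module_def)

lemma zero_free: "\<zero>\<^bsub>free_module R I\<^esub> = (\<lambda>i\<in>I. \<zero>\<^bsub>R\<^esub>)"
  and add_free: "u \<oplus>\<^bsub>free_module R I\<^esub> v = (\<lambda>i\<in>I. u i \<oplus>\<^bsub>R\<^esub> v i)"
  and smult_free: "a \<odot>\<^bsub>free_module R I\<^esub> u = (\<lambda>i\<in>I. u i \<otimes>\<^bsub>R\<^esub> a)"
  by (simp_all add: free_module_def direct_sum_def regular_module_def)

lemma (in ring) free_basis_closed: "free_basis R I i \<in> carrier (free_module R I)"
proof -
  have "{j \<in> I. free_basis R I i j \<noteq> \<zero>} \<subseteq> {i}" by (auto simp: free_basis_def)
  then show ?thesis
    by (auto simp: carrier_free free_basis_def finite_subset)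
qed

text \<open>Induction on a finite set that bounds the support: an element with a coordinate at
  \<open>k\<close> is one supported on the smaller set plus a multiple of the basis vector at
  \<open>k\<close>. Applied to preimages and kernels, this reduces statements about a free module to
  its basis.\<close>

lemma (in ring) free_span:
  assumes S: "module_closed R (free_module R I) S" and basis: "\<And>i. i \<in> I \<Longrightarrow> free_basis R I i \<in> S"
  shows "S = carrier (free_module R I)"
proof
  show "carrier (free_module R I) \<subseteq> S"
  proof
    fix u assume u: "u \<in> carrier (free_module R I)"
    have "\<forall>u\<in>carrier (free_module R I). {i \<in> I. u i \<noteq> \<zero>} \<subseteq> A \<longrightarrow> u \<in> S" if "finite A" for A
      using that
    proof (induction A)
      case empty
      have "u = (\<lambda>i\<in>I. \<zero>)" if "u \<in> carrier (free_module R I)" "{i \<in> I. u i \<noteq> \<zero>} \<subseteq> {}" for u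
        using that by (intro extensionalityI[of _ I]) (auto simp: carrier_free PiE_iff)
      then show ?case using S by (auto simp: module_closed_def zero_free)
    next
      case (insert k A)
      show ?case
      proof (intro ballI impI)
        fix u assume u: "u \<in> carrier (free_module R I)" and supp: "{i \<in> I. u i \<noteq> \<zero>} \<subseteq> insert k A"
        show "u \<in> S"
        proof (cases "k \<in> I")
          case False
          then show ?thesis using u supp insert.IH by blast
        next
          case True
          define v where "v = (\<lambda>i\<in>I. if i = k then \<zero> else u i)"
          have uR: "u i \<in> carrier R" if "i \<in> I" for i using u that by (auto simp: carrier_free)
          have sv: "{i \<in> I. v i \<noteq> \<zero>} \<subseteq> {i \<in> I. u i \<noteq> \<zero>} - {k}" by (auto simp: v_def)
          then have "v \<in> carrier (free_module R I)"
            using u finite_subset[OF sv] uR by (auto simp: carrier_free v_def)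
          then have "v \<in> S" using insert.IH sv supp by blast
          moreover have "u k \<odot>\<^bsub>free_module R I\<^esub> free_basis R I k \<in> S"
            using S basis[OF True] uR[OF True] by (auto simp: module_closed_def)
          moreover have "u = v \<oplus>\<^bsub>free_module R I\<^esub> (u k \<odot>\<^bsub>free_module R I\<^esub> free_basis R I k)"
            using u uR uR[OF True]
            by (intro extensionalityI[of _ I])
              (auto simp: add_free smult_free free_basis_def v_def carrier_free PiE_iff)
          ultimately show ?thesis using S by (metis module_closed_def)
        qed
      qed
    qed
    from this[of "{i \<in> I. u i \<noteq> \<zero>}"] show "u \<in> S" using u by (simp add: carrier_free)
  qed
qed (use S in \<open>simp add: module_closed_def\<close>)

lemma equalizer_closed:
  assumes "right_module R M" "right_module R N" "g \<in> mod_hom R M N" "h \<in> mod_hom R M N"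
  shows "module_closed R M {x \<in> carrier M. g x = h x}"
proof -
  interpret g: module_hom R M N g using assms by (simp add: module_homI)
  interpret h: module_hom R M N h using assms by (simp add: module_homI)
  show ?thesis by (rule module_closedI) (auto simp: g.M.ract_closed)
qed

text \<open>The set where two homomorphisms agree is closed, so it is everything once it contains
  the basis.\<close>

lemma (in ring) free_hom_eqI:
  assumes "right_module R N" "g \<in> mod_hom R (free_module R I) N" "h \<in> mod_hom R (free_module R I) N"
    and "\<And>i. i \<in> I \<Longrightarrow> g (free_basis R I i) = h (free_basis R I i)"
  shows "g = h"
proof (rule mod_hom_eqI[OF assms(2,3)])
  have "{u \<in> carrier (free_module R I). g u = h u} = carrier (free_module R I)"
    using assms
    by (intro free_span equalizer_closed right_module_free) (auto simp: free_basis_closed)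
  then show "g u = h u" if "u \<in> carrier (free_module R I)" for u using that by blast
qed

text \<open>The homomorphism out of the free module that sends the basis vector at \<open>i\<close>
  to \<open>b i\<close>. The sum runs over the support of \<open>u\<close>, which is finite even
  when \<open>I\<close> is not; for \<open>b\<close> the identity on a module it is the canonical
  free cover.\<close>

definition linear_combination ::
  "('r, 'm) module \<Rightarrow> ('r, 'k) ring_scheme \<Rightarrow> 'i set \<Rightarrow> ('i \<Rightarrow> 'm) \<Rightarrow> ('i \<Rightarrow> 'r) \<Rightarrow> 'm" where
  "linear_combination N R I b =
     (\<lambda>u\<in>carrier (free_module R I). \<Oplus>\<^bsub>N\<^esub>i\<in>{i \<in> I. u i \<noteq> \<zero>\<^bsub>R\<^esub>}. u i \<odot>\<^bsub>N\<^esub> b i)"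

lemma (in right_module) finsum_smult_distr:
  assumes "finite A" "a \<in> carrier R" "g \<in> A \<rightarrow> carrier M"
  shows "a \<odot>\<^bsub>M\<^esub> (\<Oplus>\<^bsub>M\<^esub>i\<in>A. g i) = (\<Oplus>\<^bsub>M\<^esub>i\<in>A. a \<odot>\<^bsub>M\<^esub> g i)"
  using assms
proof (induction A)
  case (insert i A)
  then have "(\<lambda>i. a \<odot>\<^bsub>M\<^esub> g i) \<in> A \<rightarrow> carrier M" by (auto intro: ract_closed)
  with insert show ?case by (simp add: Pi_iff ract_add_module ract_closed)
qed (simp add: smult_r_null)

lemma linear_combination_hom:
  assumes "right_module R N" and b: "\<And>i. i \<in> I \<Longrightarrow> b i \<in> carrier N"
  shows "linear_combination N R I b \<in> mod_hom R (free_module R I) N"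
    and "i \<in> I \<Longrightarrow> linear_combination N R I b (free_basis R I i) = b i"
proof -
  interpret N: right_module R N by fact
  let ?F = "free_module R I"
  interpret F: right_module R ?F by (rule N.R.right_module_free)
  \<comment> \<open>The sum may run over any finite set containing the support. Two elements and
    their sum can then be compared over one index set, although their supports differ.\<close>
  have eq: "linear_combination N R I b u = (\<Oplus>\<^bsub>N\<^esub>i\<in>A. u i \<odot>\<^bsub>N\<^esub> b i)"
    if "u \<in> carrier ?F" "finite A" "{i \<in> I. u i \<noteq> \<zero>\<^bsub>R\<^esub>} \<subseteq> A" "A \<subseteq> I" for u A
    unfolding linear_combination_def using that b
    by (auto simp: carrier_free N.smult_l_null intro!: N.add.finprod_mono_neutral_cong_left N.ract_closed)
  show "linear_combination N R I b \<in> mod_hom R ?F N"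
  proof (rule mod_homI)
    fix u assume u: "u \<in> carrier ?F"
    then have uR: "u i \<in> carrier R" if "i \<in> I" for i using that by (auto simp: carrier_free)
    let ?A = "{i \<in> I. u i \<noteq> \<zero>\<^bsub>R\<^esub>}"
    have fA: "finite ?A" using u by (simp add: carrier_free)
    show "linear_combination N R I b u \<in> carrier N"
      unfolding linear_combination_def using u b uR by (auto intro!: N.finsum_closed N.ract_closed)
    show "linear_combination N R I b (a \<odot>\<^bsub>?F\<^esub> u) = a \<odot>\<^bsub>N\<^esub> linear_combination N R I b u"
      if a: "a \<in> carrier R" for a
    proof -
      have "linear_combination N R I b (a \<odot>\<^bsub>?F\<^esub> u) = (\<Oplus>\<^bsub>N\<^esub>i\<in>?A. (u i \<otimes>\<^bsub>R\<^esub> a) \<odot>\<^bsub>N\<^esub> b i)"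
        using u a b uR fA
        by (subst eq[where A = ?A])
          (auto simp: F.ract_closed[unfolded smult_free] smult_free intro!: N.finsum_cong' N.ract_closed)
      also have "\<dots> = (\<Oplus>\<^bsub>N\<^esub>i\<in>?A. a \<odot>\<^bsub>N\<^esub> (u i \<odot>\<^bsub>N\<^esub> b i))"
        using a b uR by (intro N.finsum_cong') (auto simp: N.ract_assoc N.ract_closed)
      also have "\<dots> = a \<odot>\<^bsub>N\<^esub> linear_combination N R I b u"
        using a b uR fA u
        by (subst N.finsum_smult_distr[symmetric]) (auto simp: linear_combination_def N.ract_closed)
      finally show ?thesis .
    qed
    fix v assume v: "v \<in> carrier ?F"
    then have vR: "v i \<in> carrier R" if "i \<in> I" for i using that by (auto simp: carrier_free)
    let ?A = "{i \<in> I. u i \<noteq> \<zero>\<^bsub>R\<^esub>} \<union> {i \<in> I. v i \<noteq> \<zero>\<^bsub>R\<^esub>}"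
    have fA: "finite ?A" using u v by (simp add: carrier_free)
    have "linear_combination N R I b (u \<oplus>\<^bsub>?F\<^esub> v) = (\<Oplus>\<^bsub>N\<^esub>i\<in>?A. (u i \<oplus>\<^bsub>R\<^esub> v i) \<odot>\<^bsub>N\<^esub> b i)"
      using u v b uR vR fA
      by (subst eq[where A = ?A])
        (auto simp: add_free intro!: N.finsum_cong' N.ract_closed F.a_closed[unfolded add_free])
    also have "\<dots> = (\<Oplus>\<^bsub>N\<^esub>i\<in>?A. (u i \<odot>\<^bsub>N\<^esub> b i) \<oplus>\<^bsub>N\<^esub> (v i \<odot>\<^bsub>N\<^esub> b i))"
      using b uR vR by (intro N.finsum_cong') (auto simp: N.ract_add_ring N.ract_closed)
    also have "\<dots> = (\<Oplus>\<^bsub>N\<^esub>i\<in>?A. u i \<odot>\<^bsub>N\<^esub> b i) \<oplus>\<^bsub>N\<^esub> (\<Oplus>\<^bsub>N\<^esub>i\<in>?A. v i \<odot>\<^bsub>N\<^esub> b i)"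
      using b uR vR fA by (intro N.finsum_addf) (auto simp: N.ract_closed)
    also have "\<dots> = linear_combination N R I b u \<oplus>\<^bsub>N\<^esub> linear_combination N R I b v"
      using u v fA eq[of u ?A] eq[of v ?A] by auto
    finally show "linear_combination N R I b (u \<oplus>\<^bsub>?F\<^esub> v)
      = linear_combination N R I b u \<oplus>\<^bsub>N\<^esub> linear_combination N R I b v" .
  qed (simp add: linear_combination_def)
  show "linear_combination N R I b (free_basis R I i) = b i" if "i \<in> I"
    using that b[OF that] N.R.free_basis_closed[of I i]
    by (subst eq[where A = "{i}"]) (auto simp: free_basis_def N.ract_one split: if_splits)
qed

text \<open>Projectivity of free modules: preimages are chosen for the images of the basis vectors,
  and the resulting map is compared with \<open>g\<close> on the basis only.\<close>

lemma free_module_lift: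
  assumes "right_module R N" "right_module R N'" "e \<in> mod_hom R N N'" "e ` carrier N = carrier N'"
    and "g \<in> mod_hom R (free_module R I) N'"
  obtains h where "h \<in> mod_hom R (free_module R I) N" "\<And>u. u \<in> carrier (free_module R I) \<Longrightarrow> e (h u) = g u"
proof -
  interpret e: module_hom R N N' e using assms by (simp add: module_homI)
  let ?F = "free_module R I"
  note F = e.M.R.right_module_free[of I]
  have "\<exists>x\<in>carrier N. e x = g (free_basis R I i)" for i
    using assms(4) mod_hom_closed[OF assms(5) e.M.R.free_basis_closed] by (metis imageE)
  then obtain b where b: "\<And>i. b i \<in> carrier N" "\<And>i. e (b i) = g (free_basis R I i)" by metis
  obtain h where h: "h \<in> mod_hom R ?F N" "\<And>i. i \<in> I \<Longrightarrow> h (free_basis R I i) = b i"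
    using linear_combination_hom[of R N I b] assms(1) b by blast
  have "compose (carrier ?F) e h = g"
    by (rule e.M.R.free_hom_eqI[OF assms(2) mod_hom_comp[OF F h(1) assms(3)] assms(5)])
      (simp add: compose_eq[OF e.M.R.free_basis_closed] h b)
  then have "e (h u) = g u" if "u \<in> carrier ?F" for u
    using that by (metis compose_eq)
  then show thesis using that h(1) by blast
qed

section \<open>Ext\<close>

lemma free_cover_map_eq: "free_cover_map R X = linear_combination X R (carrier X) (\<lambda>x. x)"
  by (simp add: free_cover_map_def linear_combination_def)

lemma free_cover_map:
  assumes "right_module R X"
  shows "free_cover_map R X \<in> mod_hom R (free_module R (carrier X)) X"
    and "free_cover_map R X ` carrier (free_module R (carrier X)) = carrier X"
proof -
  interpret X: right_module R X by fact
  note l = linear_combination_hom[OF assms, of "carrier X" "\<lambda>x. x", folded free_cover_map_eq]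
  show h: "free_cover_map R X \<in> mod_hom R (free_module R (carrier X)) X" by (rule l)
  have "x \<in> free_cover_map R X ` carrier (free_module R (carrier X))" if "x \<in> carrier X" for x
    using l(2)[of x] that X.R.free_basis_closed by (metis image_eqI)
  then show "free_cover_map R X ` carrier (free_module R (carrier X)) = carrier X"
    using mod_hom_closed[OF h] by blast
qed

lemma comm_group_Hom:
  assumes "right_module R M" "right_module R N"
  shows "comm_group (Hom_group R M N)"
proof -
  interpret M: right_module R M by fact
  interpret N: right_module R N by fact
  show ?thesis
  proof (rule comm_groupI)
    fix f assume f: "f \<in> carrier (Hom_group R M N)"
    then have f': "f \<in> mod_hom R M N" by (simp add: Hom_group_def)
    have "(\<lambda>x\<in>carrier M. \<zero>\<^bsub>N\<^esub> \<ominus>\<^bsub>N\<^esub> f x) \<in> mod_hom R M N"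
      using mod_hom_diff[OF assms mod_hom_zero[OF assms] f'] by (simp cong: restrict_cong)
    then show "\<exists>g\<in>carrier (Hom_group R M N). g \<otimes>\<^bsub>Hom_group R M N\<^esub> f = \<one>\<^bsub>Hom_group R M N\<^esub>"
      using f' by (intro bexI[of _ "\<lambda>x\<in>carrier M. \<zero>\<^bsub>N\<^esub> \<ominus>\<^bsub>N\<^esub> f x"])
        (auto simp: Hom_group_def N.minus_eq N.l_neg mod_hom_closed cong: restrict_cong)
    show "\<one>\<^bsub>Hom_group R M N\<^esub> \<otimes>\<^bsub>Hom_group R M N\<^esub> f = f"
      using f' by (auto simp: Hom_group_def mod_hom_closed mod_hom_extensional extensional_restrict
        cong: restrict_cong)
  qed (auto simp: Hom_group_def mod_hom_sum mod_hom_zero assms mod_hom_closed N.a_ac cong: restrict_cong)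
qed

text \<open>Every homomorphism on the syzygy extends to the free cover. This form removes quotient
  groups from all later arguments.\<close>

definition Ext1_vanishes :: "('r, 'k) ring_scheme \<Rightarrow> ('r, 'm) module \<Rightarrow> ('r, 'n) module \<Rightarrow> bool" where
  "Ext1_vanishes R X Y \<longleftrightarrow>
     (\<forall>g\<in>mod_hom R (free_cover_kernel R X) Y.
        \<exists>h\<in>mod_hom R (free_module R (carrier X)) Y. \<forall>u\<in>carrier (free_cover_kernel R X). h u = g u)"

lemma free_cover_kernel_sub:
  assumes "right_module R X"
  shows "carrier (free_cover_kernel R X)
      = {u \<in> carrier (free_module R (carrier X)). free_cover_map R X u = \<zero>\<^bsub>X\<^esub>}"
    and "module_closed R (free_module R (carrier X)) (carrier (free_cover_kernel R X))"
    and "free_cover_kernel R X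
      = (free_module R (carrier X))\<lparr>carrier := carrier (free_cover_kernel R X)\<rparr>"
    and "right_module R (free_cover_kernel R X)"
proof -
  interpret X: right_module R X by fact
  interpret c: module_hom R "free_module R (carrier X)" X "free_cover_map R X"
    using assms by (intro module_homI free_cover_map X.R.right_module_free)
  show 1: "carrier (free_cover_kernel R X)
      = {u \<in> carrier (free_module R (carrier X)). free_cover_map R X u = \<zero>\<^bsub>X\<^esub>}"
    by (simp add: free_cover_kernel_def a_kernel_def')
  show 2: "module_closed R (free_module R (carrier X)) (carrier (free_cover_kernel R X))"
    unfolding 1 by (rule c.kernel_closed)
  show 3: "free_cover_kernel R X
      = (free_module R (carrier X))\<lparr>carrier := carrier (free_cover_kernel R X)\<rparr>"
    by (simp add: free_cover_kernel_def)
  show "right_module R (free_cover_kernel R X)"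
    by (subst 3) (rule right_module_sub[OF c.M.right_module_axioms 2])
qed

lemma trivial_Ext1_iff:
  assumes X: "right_module R X" and Y: "right_module R Y"
  shows "trivial_group (Ext1 R X Y) \<longleftrightarrow> Ext1_vanishes R X Y"
proof -
  interpret X: right_module R X by fact
  let ?K = "free_cover_kernel R X" and ?F = "free_module R (carrier X)"
  note K = free_cover_kernel_sub[OF X]
  note F = X.R.right_module_free[of "carrier X"]
  let ?r = "\<lambda>g. restrict g (carrier ?K)"
  interpret H: comm_group "Hom_group R ?K Y" by (rule comm_group_Hom[OF K(4) Y])
  interpret HF: comm_group "Hom_group R ?F Y" by (rule comm_group_Hom[OF F Y])
  have KF: "\<And>u. u \<in> carrier ?K \<Longrightarrow> u \<in> carrier ?F" using K(1) by auto
  have r: "?r g \<in> mod_hom R ?K Y" if "g \<in> mod_hom R ?F Y" for g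
    using mod_hom_restrict_sub[OF that K(2)] K(3) by simp
  have "?r \<in> hom (Hom_group R ?F Y) (Hom_group R ?K Y)"
    using r KF by (auto simp: hom_def Hom_group_def cong: restrict_cong)
  then interpret gh: group_hom "Hom_group R ?F Y" "Hom_group R ?K Y" ?r by unfold_locales
  have im: "?r ` mod_hom R ?F Y = ?r ` carrier (Hom_group R ?F Y)" by (simp add: Hom_group_def)
  have sub: "subgroup (?r ` mod_hom R ?F Y) (Hom_group R ?K Y)"
    unfolding im by (rule gh.img_is_subgroup)
  then interpret nrm: normal "?r ` mod_hom R ?F Y" "Hom_group R ?K Y"
    by (rule H.subgroup_imp_normal)
  \<comment> \<open>A factor group is trivial when every coset equals the subgroup; here this says
    that restriction from the free cover to the syzygy is onto.\<close>
  have "trivial_group (Ext1 R X Y) \<longleftrightarrow>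
      (\<lambda>g. ?r ` mod_hom R ?F Y #>\<^bsub>Hom_group R ?K Y\<^esub> g) ` mod_hom R ?K Y \<subseteq> {?r ` mod_hom R ?F Y}"
    unfolding Ext1_def group.trivial_group_subset[OF nrm.factorgroup_is_group]
    by (simp add: carrier_FactGroup) (simp add: Hom_group_def)
  also have "\<dots> \<longleftrightarrow> mod_hom R ?K Y \<subseteq> ?r ` mod_hom R ?F Y"
  proof -
    have "(?r ` mod_hom R ?F Y #>\<^bsub>Hom_group R ?K Y\<^esub> g = ?r ` mod_hom R ?F Y) \<longleftrightarrow> g \<in> ?r ` mod_hom R ?F Y"
      if "g \<in> mod_hom R ?K Y" for g
      using that sub H.coset_join1[OF _ _ sub, of g] H.coset_join2[OF _ sub, of g] subgroup.subset[OF sub]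
      by (auto simp: Hom_group_def)
    then show ?thesis
      by (simp only: image_subset_iff singleton_iff subset_eq[of "mod_hom R ?K Y"] cong: ball_cong)
  qed
  also have "\<dots> \<longleftrightarrow> Ext1_vanishes R X Y"
  proof
    assume sub: "mod_hom R ?K Y \<subseteq> ?r ` mod_hom R ?F Y"
    show "Ext1_vanishes R X Y"
      unfolding Ext1_vanishes_def
    proof
      fix g assume "g \<in> mod_hom R ?K Y"
      then obtain h where "h \<in> mod_hom R ?F Y" "g = ?r h" using sub by blast
      then show "\<exists>h\<in>mod_hom R ?F Y. \<forall>u\<in>carrier ?K. h u = g u"
        by (intro bexI[of _ h]) simp_all
    qed
  next
    assume E: "Ext1_vanishes R X Y"
    show "mod_hom R ?K Y \<subseteq> ?r ` mod_hom R ?F Y"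
    proof
      fix g assume g: "g \<in> mod_hom R ?K Y"
      then obtain h where h: "h \<in> mod_hom R ?F Y" "\<forall>u\<in>carrier ?K. h u = g u"
        using E unfolding Ext1_vanishes_def by blast
      have "g = ?r h" using h g by (intro mod_hom_eqI[OF g r[OF h(1)]]) simp
      then show "g \<in> ?r ` mod_hom R ?F Y" using h by blast
    qed
  qed
  finally show ?thesis .
qed

text \<open>Vanishing does not depend on the presentation: the free cover may be replaced by any
  epimorphism \<open>p\<close>. The cover lifts to \<open>s\<close> into \<open>P\<close>, the
  composite of \<open>s\<close> with \<open>g\<close> extends from the syzygy to a map
  \<open>t\<close> on the free module, and the extension of \<open>g\<close> is assembled from
  \<open>t\<close> and \<open>g\<close>.\<close>

lemma Ext1_vanishes_extend:
  assumes X: "right_module R X" and Y: "right_module R Y" and P: "right_module R P"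
    and E: "Ext1_vanishes R X Y"
    and p: "p \<in> mod_hom R P X" "p ` carrier P = carrier X"
    and L: "L = {x \<in> carrier P. p x = \<zero>\<^bsub>X\<^esub>}"
    and g: "g \<in> mod_hom R (P\<lparr>carrier := L\<rparr>) Y"
  obtains h where "h \<in> mod_hom R P Y" "\<And>x. x \<in> L \<Longrightarrow> h x = g x"
proof -
  interpret X: right_module R X by fact
  interpret Y: right_module R Y by fact
  interpret p: module_hom R P X p using assms by (simp add: module_homI)
  let ?K = "free_cover_kernel R X" and ?F = "free_module R (carrier X)" and ?c = "free_cover_map R X"
  note K = free_cover_kernel_sub[OF X]
  interpret F: right_module R ?F by (rule X.R.right_module_free)
  interpret c: module_hom R ?F X ?c
    using X by (intro module_homI free_cover_map F.right_module_axioms)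
  have Lc: "module_closed R P L" unfolding L by (rule p.kernel_closed)
  have g': "g x \<in> carrier Y" "g (x \<oplus>\<^bsub>P\<^esub> y) = g x \<oplus>\<^bsub>Y\<^esub> g y" if "x \<in> L" "y \<in> L" for x y
    using mod_hom_closed[OF g] mod_hom_add[OF g] that by auto
  have gs: "g (a \<odot>\<^bsub>P\<^esub> x) = a \<odot>\<^bsub>Y\<^esub> g x" if "x \<in> L" "a \<in> carrier R" for x a
    using mod_hom_smult[OF g] that by auto
  obtain s where s: "s \<in> mod_hom R ?F P" "\<And>u. u \<in> carrier ?F \<Longrightarrow> p (s u) = ?c u"
    by (rule free_module_lift[OF P X p free_cover_map(1)[OF X]]) blast
  interpret s: module_hom R ?F P s using s P by (intro module_homI F.right_module_axioms)
  have "compose (carrier ?K) g (restrict s (carrier ?K)) \<in> mod_hom R ?K Y"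
  proof (rule mod_hom_comp[OF K(4) mod_hom_corestrict g])
    show "restrict s (carrier ?K) \<in> mod_hom R ?K P"
      using mod_hom_restrict_sub[OF s(1) K(2)] K(3) by simp
    show "restrict s (carrier ?K) x \<in> L" if "x \<in> carrier ?K" for x
      using that s unfolding L K(1) by auto
  qed
  then obtain t where t: "t \<in> mod_hom R ?F Y" "\<And>u. u \<in> carrier ?K \<Longrightarrow> t u = g (s u)"
    using E by (fastforce simp: Ext1_vanishes_def compose_def)
  interpret t: module_hom R ?F Y t using t Y by (intro module_homI F.right_module_axioms)
  \<comment> \<open>The element \<open>x\<close> differs from \<open>s u\<close> by an element of
    \<open>L\<close>, where \<open>g\<close> is available. Another choice of \<open>u\<close>
    differs by an element of the syzygy, on which \<open>t\<close> agrees with \<open>g\<close>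
    after \<open>s\<close>, so the value stays the same.\<close>
  let ?P = "\<lambda>x y. \<exists>u\<in>carrier ?F. x \<in> carrier P \<and> p x = ?c u \<and> y = t u \<oplus>\<^bsub>Y\<^esub> g (x \<ominus>\<^bsub>P\<^esub> s u)"
  have inL: "x \<ominus>\<^bsub>P\<^esub> s u \<in> L" if "x \<in> carrier P" "u \<in> carrier ?F" "p x = ?c u" for x u
    using that s(2) unfolding L by simp
  have "\<exists>h\<in>mod_hom R P Y. \<forall>x y. ?P x y \<longrightarrow> h x = y"
  proof (rule mod_hom_of_graph[OF P Y])
    show "\<exists>y. ?P x y" if "x \<in> carrier P" for x
      using that p.closed[OF that] free_cover_map(2)[OF X] by (metis imageE)
    show "x \<in> carrier P \<and> y \<in> carrier Y" if "?P x y" for x y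
      using that g'(1)[OF inL inL] by auto
    show "?P (x \<oplus>\<^bsub>P\<^esub> x') (y \<oplus>\<^bsub>Y\<^esub> y')" if xy: "?P x y" "?P x' y'" for x y x' y'
    proof -
      from xy obtain u v where u: "u \<in> carrier ?F" "x \<in> carrier P" "p x = ?c u" "y = t u \<oplus>\<^bsub>Y\<^esub> g (x \<ominus>\<^bsub>P\<^esub> s u)"
        and v: "v \<in> carrier ?F" "x' \<in> carrier P" "p x' = ?c v" "y' = t v \<oplus>\<^bsub>Y\<^esub> g (x' \<ominus>\<^bsub>P\<^esub> s v)"
        by blast
      have "(x \<oplus>\<^bsub>P\<^esub> x') \<ominus>\<^bsub>P\<^esub> s (u \<oplus>\<^bsub>?F\<^esub> v) = (x \<ominus>\<^bsub>P\<^esub> s u) \<oplus>\<^bsub>P\<^esub> (x' \<ominus>\<^bsub>P\<^esub> s v)"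
        using u v by (simp add: p.M.minus_eq p.M.minus_add p.M.a_ac)
      then show ?thesis
        using u v inL[OF u(2,1,3)] inL[OF v(2,1,3)]
        by (intro bexI[of _ "u \<oplus>\<^bsub>?F\<^esub> v"]) (simp_all add: g' Y.a_ac)
    qed
    show "?P (a \<odot>\<^bsub>P\<^esub> x) (a \<odot>\<^bsub>Y\<^esub> y)" if a: "a \<in> carrier R" and xy: "?P x y" for a x y
    proof -
      from xy obtain u where u: "u \<in> carrier ?F" "x \<in> carrier P" "p x = ?c u" "y = t u \<oplus>\<^bsub>Y\<^esub> g (x \<ominus>\<^bsub>P\<^esub> s u)"
        by blast
      have "a \<odot>\<^bsub>P\<^esub> x \<ominus>\<^bsub>P\<^esub> s (a \<odot>\<^bsub>?F\<^esub> u) = a \<odot>\<^bsub>P\<^esub> (x \<ominus>\<^bsub>P\<^esub> s u)"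
        using u a by (simp add: p.M.smult_r_diff)
      then show ?thesis
        using u a inL[OF u(2,1,3)]
        by (intro bexI[of _ "a \<odot>\<^bsub>?F\<^esub> u"])
          (simp_all add: g' gs Y.ract_add_module F.ract_closed p.M.ract_closed)
    qed
    show "y = \<zero>\<^bsub>Y\<^esub>" if "?P \<zero>\<^bsub>P\<^esub> y" for y
    proof -
      from that obtain u where u: "u \<in> carrier ?F" "?c u = \<zero>\<^bsub>X\<^esub>" "y = t u \<oplus>\<^bsub>Y\<^esub> g (\<zero>\<^bsub>P\<^esub> \<ominus>\<^bsub>P\<^esub> s u)"
        by auto
      have uK: "u \<in> carrier ?K" using u by (simp add: K(1))
      have su: "s u \<in> L" using u s(2) by (simp add: L)
      have su': "\<zero>\<^bsub>P\<^esub> \<ominus>\<^bsub>P\<^esub> s u \<in> L" using u by (intro inL) auto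
      have "y = g (s u \<oplus>\<^bsub>P\<^esub> (\<zero>\<^bsub>P\<^esub> \<ominus>\<^bsub>P\<^esub> s u))"
        using u t(2)[OF uK] su su' g' by simp
      \<comment> \<open>Zero is written as a multiple of \<open>s u\<close> because \<open>g\<close>
        is known to respect the action on \<open>L\<close>, which gives the value zero at
        once.\<close>
      also have "s u \<oplus>\<^bsub>P\<^esub> (\<zero>\<^bsub>P\<^esub> \<ominus>\<^bsub>P\<^esub> s u) = \<zero>\<^bsub>R\<^esub> \<odot>\<^bsub>P\<^esub> s u"
        using u by (simp add: p.M.smult_l_null p.M.add_diff_cancel)
      also have "g \<dots> = \<zero>\<^bsub>Y\<^esub>" using su gs g' by (simp add: Y.smult_l_null)
      finally show ?thesis .
    qed
  qed
  then obtain h where h: "h \<in> mod_hom R P Y" "\<And>x y. ?P x y \<Longrightarrow> h x = y" by metis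
  have "h x = g x" if "x \<in> L" for x
  proof (rule h(2))
    show "?P x (g x)"
      using that g' by (intro bexI[of _ "\<zero>\<^bsub>?F\<^esub>"]) (auto simp: L)
  qed
  then show thesis using that h by metis
qed

text \<open>Exactness of the Hom-Ext sequence at Hom(X, N'). The composite of \<open>g\<close> with
  the free cover lifts to \<open>N\<close> by projectivity; on the syzygy the lift takes values in
  \<open>Y\<close>, and subtracting an extension of that part to the whole free module leaves a map
  that descends to \<open>X\<close>.\<close>

lemma Ext1_vanishes_lift:
  assumes X: "right_module R X" and Y: "right_module R Y" and N: "right_module R N" and N': "right_module R N'"
    and E: "Ext1_vanishes R X Y"
    and f: "f \<in> mod_hom R Y N" "inj_on f (carrier Y)"
    and e: "e \<in> mod_hom R N N'" "e ` carrier N = carrier N'"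
    and ker: "f ` carrier Y = {x \<in> carrier N. e x = \<zero>\<^bsub>N'\<^esub>}"
    and g: "g \<in> mod_hom R X N'"
  obtains h where "h \<in> mod_hom R X N" "\<And>x. x \<in> carrier X \<Longrightarrow> e (h x) = g x"
proof -
  interpret X: right_module R X by fact
  interpret Y: right_module R Y by fact
  interpret e: module_hom R N N' e using assms by (simp add: module_homI)
  interpret f: module_hom R Y N f using assms by (simp add: module_homI)
  interpret g: module_hom R X N' g using assms by (simp add: module_homI)
  let ?K = "free_cover_kernel R X" and ?F = "free_module R (carrier X)" and ?c = "free_cover_map R X"
  note K = free_cover_kernel_sub[OF X]
  interpret F: right_module R ?F by (rule X.R.right_module_free)
  interpret c: module_hom R ?F X ?c
    using X by (intro module_homI free_cover_map F.right_module_axioms)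
  have gc: "compose (carrier ?F) g ?c \<in> mod_hom R ?F N'"
    by (rule mod_hom_comp[OF F.right_module_axioms c.hom g.hom])
  obtain s where s: "s \<in> mod_hom R ?F N" "\<And>u. u \<in> carrier ?F \<Longrightarrow> e (s u) = g (?c u)"
    by (rule free_module_lift[OF N N' e gc]) (auto simp: compose_def)
  interpret s: module_hom R ?F N s using s N by (intro module_homI F.right_module_axioms)
  have "\<exists>k\<in>mod_hom R ?K Y. \<forall>u\<in>carrier ?K. f (k u) = restrict s (carrier ?K) u"
  proof (rule mod_hom_lift_inj[OF K(4) Y N f])
    show "restrict s (carrier ?K) \<in> mod_hom R ?K N"
      using mod_hom_restrict_sub[OF s(1) K(2)] K(3) by simp
    show "restrict s (carrier ?K) x \<in> f ` carrier Y" if "x \<in> carrier ?K" for x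
      using that s unfolding ker K(1) by auto
  qed
  then obtain k where k: "k \<in> mod_hom R ?K Y" "\<And>u. u \<in> carrier ?K \<Longrightarrow> f (k u) = s u" by auto
  then obtain t where t: "t \<in> mod_hom R ?F Y" "\<And>u. u \<in> carrier ?K \<Longrightarrow> t u = k u"
    using E unfolding Ext1_vanishes_def by metis
  interpret t: module_hom R ?F Y t using t Y by (intro module_homI F.right_module_axioms)
  define d where "d = (\<lambda>u\<in>carrier ?F. s u \<ominus>\<^bsub>N\<^esub> compose (carrier ?F) f t u)"
  have d_eq: "d u = s u \<ominus>\<^bsub>N\<^esub> f (t u)" if "u \<in> carrier ?F" for u
    using that by (simp add: d_def compose_def)
  have d: "d \<in> mod_hom R ?F N"
    unfolding d_def by (intro mod_hom_diff mod_hom_comp[of _ _ _ Y] F.right_module_axioms N s t f)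
  have "\<exists>h\<in>mod_hom R X N. \<forall>u\<in>carrier ?F. h (?c u) = d u"
    by (rule mod_hom_descend[OF F.right_module_axioms X N c.hom d free_cover_map(2)[OF X]])
      (simp add: d_eq t K(1) k)
  then obtain h where h: "h \<in> mod_hom R X N" "\<And>u. u \<in> carrier ?F \<Longrightarrow> h (?c u) = d u" by metis
  have "e (h x) = g x" if "x \<in> carrier X" for x
  proof -
    have "x \<in> ?c ` carrier ?F" unfolding free_cover_map(2)[OF X] by (rule that)
    then obtain u where u: "u \<in> carrier ?F" "x = ?c u" by (rule imageE)
    have "f (t u) \<in> f ` carrier Y" using u by simp
    then have "e (f (t u)) = \<zero>\<^bsub>N'\<^esub>" unfolding ker by simp
    then show ?thesis using u h(2)[OF u(1)] s(2)[OF u(1)] by (simp add: d_eq)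
  qed
  then show thesis using that h by metis
qed

text \<open>Bridges the types of \<open>Y\<close> and \<open>Y'\<close>: the class
  \<open>\<B>\<close> contains a copy of a direct sum, while the Mittag-Leffler argument uses the
  direct sum itself.\<close>

lemma Ext1_vanishes_iso:
  assumes "right_module R X" "right_module R Y" "right_module R Y'" "Ext1_vanishes R X Y"
    and i: "i \<in> mod_hom R Y Y'" "bij_betw i (carrier Y) (carrier Y')"
  shows "Ext1_vanishes R X Y'"
  unfolding Ext1_vanishes_def
proof
  interpret X: right_module R X by fact
  let ?K = "free_cover_kernel R X" and ?F = "free_module R (carrier X)"
  fix g assume g: "g \<in> mod_hom R ?K Y'"
  obtain j where j: "j \<in> mod_hom R Y' Y" "\<And>y. y \<in> carrier Y' \<Longrightarrow> i (j y) = y"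
    using mod_iso_inverse[OF assms(2,3) i] by metis
  note K = free_cover_kernel_sub[OF assms(1)]
  have "compose (carrier ?K) j g \<in> mod_hom R ?K Y" by (rule mod_hom_comp[OF K(4) g j(1)])
  then obtain h where h: "h \<in> mod_hom R ?F Y" "\<And>u. u \<in> carrier ?K \<Longrightarrow> h u = compose (carrier ?K) j g u"
    using assms(4) unfolding Ext1_vanishes_def by metis
  show "\<exists>h\<in>mod_hom R ?F Y'. \<forall>u\<in>carrier ?K. h u = g u"
  proof (intro bexI ballI)
    show "compose (carrier ?F) i h \<in> mod_hom R ?F Y'"
      by (rule mod_hom_comp[OF X.R.right_module_free h(1) i(1)])
    show "compose (carrier ?F) i h u = g u" if "u \<in> carrier ?K" for u
      using that h(2)[OF that] K(1) j(2) mod_hom_closed[OF g that] by (simp add: compose_def)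
  qed
qed

text \<open>A section \<open>s\<close> makes the syzygy a direct summand of the free module:
  subtracting from \<open>u\<close> the section of its image is a retraction onto the syzygy, and
  \<open>g\<close> extends along it.\<close>

lemma Ext1_vanishes_of_section:
  assumes X: "right_module R X" and Y: "right_module R Y"
    and s: "s \<in> mod_hom R X (free_module R (carrier X))"
      "\<And>x. x \<in> carrier X \<Longrightarrow> free_cover_map R X (s x) = x"
  shows "Ext1_vanishes R X Y"
  unfolding Ext1_vanishes_def
proof
  interpret X: right_module R X by fact
  let ?K = "free_cover_kernel R X" and ?F = "free_module R (carrier X)" and ?c = "free_cover_map R X"
  note K = free_cover_kernel_sub[OF X]
  interpret F: right_module R ?F by (rule X.R.right_module_free)
  interpret c: module_hom R ?F X ?c
    using X by (intro module_homI free_cover_map F.right_module_axioms)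
  interpret s: module_hom R X ?F s using s X by (intro module_homI F.right_module_axioms)
  fix g assume g: "g \<in> mod_hom R ?K Y"
  define d where "d = (\<lambda>u\<in>carrier ?F. (\<lambda>u\<in>carrier ?F. u) u \<ominus>\<^bsub>?F\<^esub> compose (carrier ?F) s ?c u)"
  have d_eq: "d u = u \<ominus>\<^bsub>?F\<^esub> s (?c u)" if "u \<in> carrier ?F" for u
    using that by (simp add: d_def compose_def)
  have d: "d \<in> mod_hom R ?F ?F"
    unfolding d_def
    by (rule mod_hom_diff[OF F.right_module_axioms F.right_module_axioms
          mod_hom_id[OF F.right_module_axioms] mod_hom_comp[OF F.right_module_axioms c.hom s(1)]])
  have "d \<in> mod_hom R ?F ?K"
    by (subst K(3), rule mod_hom_corestrict[OF d]) (simp add: K(1) d_eq s)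
  then have "compose (carrier ?F) g d \<in> mod_hom R ?F Y"
    by (rule mod_hom_comp[OF F.right_module_axioms _ g])
  moreover have "compose (carrier ?F) g d u = g u" if "u \<in> carrier ?K" for u
    using that by (simp add: K(1) d_eq compose_def)
  ultimately show "\<exists>h\<in>mod_hom R ?F Y. \<forall>u\<in>carrier ?K. h u = g u" by (intro bexI[of _ "compose (carrier ?F) g d"]) simp_all
qed

section \<open>Sequences of modules\<close>

locale module_sequence =
  fixes R :: "('r, 'k) ring_scheme" and C :: "nat \<Rightarrow> ('r, 'm) module" and f :: "nat \<Rightarrow> 'm \<Rightarrow> 'm"
  assumes C: "\<And>n. right_module R (C n)" and f: "\<And>n. f n \<in> mod_hom R (C n) (C (Suc n))"
begin

lemma C_add_closed [simp]: "\<lbrakk>x \<in> carrier (C n); y \<in> carrier (C n)\<rbrakk> \<Longrightarrow> x \<oplus>\<^bsub>C n\<^esub> y \<in> carrier (C n)"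
  and C_zero_closed [simp]: "\<zero>\<^bsub>C n\<^esub> \<in> carrier (C n)"
  and C_l_zero [simp]: "x \<in> carrier (C n) \<Longrightarrow> \<zero>\<^bsub>C n\<^esub> \<oplus>\<^bsub>C n\<^esub> x = x"
  and C_r_zero [simp]: "x \<in> carrier (C n) \<Longrightarrow> x \<oplus>\<^bsub>C n\<^esub> \<zero>\<^bsub>C n\<^esub> = x"
  and C_smult_closed [simp]: "\<lbrakk>a \<in> carrier R; x \<in> carrier (C n)\<rbrakk> \<Longrightarrow> a \<odot>\<^bsub>C n\<^esub> x \<in> carrier (C n)"
  and C_smult_zero [simp]: "a \<in> carrier R \<Longrightarrow> a \<odot>\<^bsub>C n\<^esub> \<zero>\<^bsub>C n\<^esub> = \<zero>\<^bsub>C n\<^esub>"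
proof -
  interpret right_module R "C n" by (rule C)
  show "\<lbrakk>x \<in> carrier (C n); y \<in> carrier (C n)\<rbrakk> \<Longrightarrow> x \<oplus>\<^bsub>C n\<^esub> y \<in> carrier (C n)"
    "\<zero>\<^bsub>C n\<^esub> \<in> carrier (C n)" "x \<in> carrier (C n) \<Longrightarrow> \<zero>\<^bsub>C n\<^esub> \<oplus>\<^bsub>C n\<^esub> x = x"
    "x \<in> carrier (C n) \<Longrightarrow> x \<oplus>\<^bsub>C n\<^esub> \<zero>\<^bsub>C n\<^esub> = x"
    "\<lbrakk>a \<in> carrier R; x \<in> carrier (C n)\<rbrakk> \<Longrightarrow> a \<odot>\<^bsub>C n\<^esub> x \<in> carrier (C n)"
    "a \<in> carrier R \<Longrightarrow> a \<odot>\<^bsub>C n\<^esub> \<zero>\<^bsub>C n\<^esub> = \<zero>\<^bsub>C n\<^esub>"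
    by (simp_all add: ract_closed smult_r_null)
qed

lemma f_closed [simp]: "x \<in> carrier (C n) \<Longrightarrow> f n x \<in> carrier (C (Suc n))"
  and f_add [simp]: "\<lbrakk>x \<in> carrier (C n); y \<in> carrier (C n)\<rbrakk> \<Longrightarrow> f n (x \<oplus>\<^bsub>C n\<^esub> y) = f n x \<oplus>\<^bsub>C (Suc n)\<^esub> f n y"
  and f_smult [simp]: "\<lbrakk>a \<in> carrier R; x \<in> carrier (C n)\<rbrakk> \<Longrightarrow> f n (a \<odot>\<^bsub>C n\<^esub> x) = a \<odot>\<^bsub>C (Suc n)\<^esub> f n x"
  and f_zero [simp]: "f n \<zero>\<^bsub>C n\<^esub> = \<zero>\<^bsub>C (Suc n)\<^esub>"
proof -
  interpret module_hom R "C n" "C (Suc n)" "f n" by (intro module_homI C f)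
  show "x \<in> carrier (C n) \<Longrightarrow> f n x \<in> carrier (C (Suc n))"
    "\<lbrakk>x \<in> carrier (C n); y \<in> carrier (C n)\<rbrakk> \<Longrightarrow> f n (x \<oplus>\<^bsub>C n\<^esub> y) = f n x \<oplus>\<^bsub>C (Suc n)\<^esub> f n y"
    "\<lbrakk>a \<in> carrier R; x \<in> carrier (C n)\<rbrakk> \<Longrightarrow> f n (a \<odot>\<^bsub>C n\<^esub> x) = a \<odot>\<^bsub>C (Suc n)\<^esub> f n x"
    "f n \<zero>\<^bsub>C n\<^esub> = \<zero>\<^bsub>C (Suc n)\<^esub>" by simp_all
qed

lemma ring: "ring R"
  using C[of 0] by (simp add: right_module_def)

lemma seq_map_hom: "seq_map C f n k \<in> mod_hom R (C n) (C (n + k))"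
proof (induction k)
  case 0
  show ?case using mod_hom_id[OF C[of n]] by (simp del: restrict_apply)
next
  case (Suc k)
  then show ?case using mod_hom_comp[OF C Suc f] by simp
qed

lemma seq_map_0: "x \<in> carrier (C n) \<Longrightarrow> seq_map C f n 0 x = x"
  and seq_map_Suc: "x \<in> carrier (C n) \<Longrightarrow> seq_map C f n (Suc k) x = f (n + k) (seq_map C f n k x)"
  by (simp_all add: compose_def)

lemma seq_map_closed [simp]: "x \<in> carrier (C n) \<Longrightarrow> seq_map C f n k x \<in> carrier (C (n + k))"
  by (rule mod_hom_closed[OF seq_map_hom])

lemma seq_map_zero [simp]: "seq_map C f n k \<zero>\<^bsub>C n\<^esub> = \<zero>\<^bsub>C (n + k)\<^esub>"
  by (induction k) (simp_all add: compose_def)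

lemma seq_map_add:
  assumes "x \<in> carrier (C n)"
  shows "seq_map C f n (k + l) x = seq_map C f (n + k) l (seq_map C f n k x)"
proof (induction l)
  case 0
  show ?case using seq_map_0[of "seq_map C f n k x" "n + k"] seq_map_closed[OF assms, of k] by simp
next
  case (Suc l)
  then show ?case
    using seq_map_Suc[OF assms, of "k + l"] seq_map_Suc[of "seq_map C f n k x" "n + k" l] assms
    by (simp add: add.assoc)
qed

lemma seq_map_Suc_left:
  assumes "x \<in> carrier (C n)"
  shows "seq_map C f n (Suc k) x = seq_map C f (Suc n) k (f n x)"
  using seq_map_add[OF assms, of 1 k] seq_map_Suc[OF assms, of 0] seq_map_0[OF assms] by simp

section \<open>Families compatible, or zero, from some index on\<close>

definition germs :: "(nat \<Rightarrow> 'm) set" where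
  "germs = {x. (\<forall>n. x n \<in> carrier (C n)) \<and> (\<exists>N. \<forall>n\<ge>N. x (Suc n) = f n (x n))}"

definition null_germs :: "(nat \<Rightarrow> 'm) set" where
  "null_germs = {x. (\<forall>n. x n \<in> carrier (C n)) \<and> (\<exists>N. \<forall>n\<ge>N. x n = \<zero>\<^bsub>C n\<^esub>)}"

definition germ_module :: "('r, nat \<Rightarrow> 'm) module" where
  "germ_module = (product_module UNIV C)\<lparr>carrier := germs\<rparr>"

lemma germ_module_simps [simp]:
  "carrier germ_module = germs"
  "\<zero>\<^bsub>germ_module\<^esub> = (\<lambda>n. \<zero>\<^bsub>C n\<^esub>)"
  "x \<oplus>\<^bsub>germ_module\<^esub> y = (\<lambda>n. x n \<oplus>\<^bsub>C n\<^esub> y n)"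
  "a \<odot>\<^bsub>germ_module\<^esub> x = (\<lambda>n. a \<odot>\<^bsub>C n\<^esub> x n)"
  by (simp_all add: germ_module_def product_module_def restrict_def)

lemma germsI: "\<lbrakk>\<And>n. x n \<in> carrier (C n); \<And>n. n \<ge> N \<Longrightarrow> x (Suc n) = f n (x n)\<rbrakk> \<Longrightarrow> x \<in> germs"
  unfolding germs_def by auto

lemma null_germsI: "\<lbrakk>\<And>n. x n \<in> carrier (C n); \<And>n. n \<ge> N \<Longrightarrow> x n = \<zero>\<^bsub>C n\<^esub>\<rbrakk> \<Longrightarrow> x \<in> null_germs"
  unfolding null_germs_def by auto

lemma germs_carrier: "x \<in> germs \<Longrightarrow> x n \<in> carrier (C n)"
  and null_germs_carrier: "x \<in> null_germs \<Longrightarrow> x n \<in> carrier (C n)"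
  by (simp_all add: germs_def null_germs_def)

lemma germsE:
  assumes "x \<in> germs"
  obtains N where "\<And>n. n \<ge> N \<Longrightarrow> x (Suc n) = f n (x n)"
  using assms by (auto simp: germs_def)

lemma null_germsE:
  assumes "x \<in> null_germs"
  obtains N where "\<And>n. n \<ge> N \<Longrightarrow> x n = \<zero>\<^bsub>C n\<^esub>"
  using assms by (auto simp: null_germs_def)

lemma right_module_product_UNIV: "right_module R (product_module UNIV C)"
  by (rule right_module_product[OF ring C])

lemma germs_closed: "module_closed R (product_module UNIV C) germs"
proof (rule module_closedI)
  show "germs \<subseteq> carrier (product_module UNIV C)"
    by (auto simp: product_module_def germs_carrier)
  show "\<zero>\<^bsub>product_module UNIV C\<^esub> \<in> germs"
    by (rule germsI[of _ 0]) (simp_all add: product_module_def)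
next
  fix x y assume xy: "x \<in> germs" "y \<in> germs"
  obtain N N' where "\<And>n. n \<ge> N \<Longrightarrow> x (Suc n) = f n (x n)" "\<And>n. n \<ge> N' \<Longrightarrow> y (Suc n) = f n (y n)"
    using germsE[OF xy(1)] germsE[OF xy(2)] by metis
  then show "x \<oplus>\<^bsub>product_module UNIV C\<^esub> y \<in> germs"
    using xy by (intro germsI[of _ "max N N'"]) (simp_all add: product_module_def germs_carrier)
next
  fix a x assume xy: "a \<in> carrier R" "x \<in> germs"
  obtain N where "\<And>n. n \<ge> N \<Longrightarrow> x (Suc n) = f n (x n)"
    using germsE[OF xy(2)] by metis
  then show "a \<odot>\<^bsub>product_module UNIV C\<^esub> x \<in> germs"
    using xy by (intro germsI[of _ N]) (simp_all add: product_module_def germs_carrier)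
qed

lemma right_module_germs: "right_module R germ_module"
  unfolding germ_module_def by (rule right_module_sub[OF right_module_product_UNIV germs_closed])

lemma null_germs_subset: "null_germs \<subseteq> germs"
proof
  fix x assume x: "x \<in> null_germs"
  then obtain N where "\<And>n. n \<ge> N \<Longrightarrow> x n = \<zero>\<^bsub>C n\<^esub>" using null_germsE by metis
  then show "x \<in> germs" using x by (intro germsI[of _ N]) (simp_all add: null_germs_carrier)
qed

lemma null_germs_closed: "module_closed R germ_module null_germs"
proof (rule module_closedI)
  show "null_germs \<subseteq> carrier germ_module" by (simp add: null_germs_subset)
  show "\<zero>\<^bsub>germ_module\<^esub> \<in> null_germs"
    by (rule null_germsI[of _ 0]) simp_all
next
  fix x y assume xy: "x \<in> null_germs" "y \<in> null_germs"
  obtain N N' where "\<And>n. n \<ge> N \<Longrightarrow> x n = \<zero>\<^bsub>C n\<^esub>" "\<And>n. n \<ge> N' \<Longrightarrow> y n = \<zero>\<^bsub>C n\<^esub>"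
    using null_germsE[OF xy(1)] null_germsE[OF xy(2)] by metis
  then show "x \<oplus>\<^bsub>germ_module\<^esub> y \<in> null_germs"
    using xy by (intro null_germsI[of _ "max N N'"]) (simp_all add: null_germs_carrier)
next
  fix a x assume xy: "a \<in> carrier R" "x \<in> null_germs"
  obtain N where "\<And>n. n \<ge> N \<Longrightarrow> x n = \<zero>\<^bsub>C n\<^esub>"
    using null_germsE[OF xy(2)] by metis
  then show "a \<odot>\<^bsub>germ_module\<^esub> x \<in> null_germs"
    using xy by (intro null_germsI[of _ N]) (simp_all add: null_germs_carrier)
qed

lemma carrier_direct_sum_UNIV: "carrier (direct_sum UNIV C) = null_germs"
proof -
  have "finite {i. x i \<noteq> \<zero>\<^bsub>C i\<^esub>} \<longleftrightarrow> (\<exists>N. \<forall>n\<ge>N. x n = \<zero>\<^bsub>C n\<^esub>)" for x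
    unfolding finite_nat_set_iff_bounded
    by (metis (mono_tags, lifting) linorder_not_less mem_Collect_eq)
  then show ?thesis by (auto simp: direct_sum_def null_germs_def PiE_UNIV_domain)
qed

lemma direct_sum_UNIV_eq: "direct_sum UNIV C = germ_module\<lparr>carrier := null_germs\<rparr>"
proof -
  have "direct_sum UNIV C = (product_module UNIV C)\<lparr>carrier := carrier (direct_sum UNIV C)\<rparr>"
    by (simp add: direct_sum_def product_module_def)
  then show ?thesis by (simp add: germ_module_def carrier_direct_sum_UNIV)
qed

text \<open>Sending \<open>x\<close> to the differences \<open>x (n + 1) - f n (x n)\<close> is invertible by recursion on \<open>n\<close>.\<close>

lemma germs_iso_direct_sum: "mod_iso R germ_module (direct_sum UNIV C)"
proof -
  define d where "d x n = (case n of 0 \<Rightarrow> x 0 | Suc k \<Rightarrow> x (Suc k) \<ominus>\<^bsub>C (Suc k)\<^esub> f k (x k))" for x n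
  have dcl: "d x n \<in> carrier (C n)" if "\<And>n. x n \<in> carrier (C n)" for x n
  proof (cases n)
    case (Suc k)
    interpret right_module R "C (Suc k)" by (rule C)
    show ?thesis using Suc that by (simp add: d_def)
  qed (simp add: d_def that)
  define s where "s u = rec_nat (u 0) (\<lambda>k y. f k y \<oplus>\<^bsub>C (Suc k)\<^esub> u (Suc k))" for u
  have s0: "s u 0 = u 0" and sS: "s u (Suc k) = f k (s u k) \<oplus>\<^bsub>C (Suc k)\<^esub> u (Suc k)" for u k
    by (simp_all add: s_def)
  have scl: "s u n \<in> carrier (C n)" if "\<And>n. u n \<in> carrier (C n)" for u n
    by (induction n) (simp_all add: s0 sS that)
  have sd: "s (d x) n = x n" if "\<And>n. x n \<in> carrier (C n)" for x n
  proof (induction n)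
    case (Suc k)
    interpret right_module R "C (Suc k)" by (rule C)
    show ?case using that Suc by (simp add: sS d_def add_diff_cancel)
  qed (simp add: s0 d_def)
  have ds: "d (s u) n = u n" if "\<And>n. u n \<in> carrier (C n)" for u n
  proof (cases n)
    case (Suc k)
    interpret right_module R "C (Suc k)" by (rule C)
    have "u (Suc k) \<oplus>\<^bsub>C (Suc k)\<^esub> f k (s u k) \<ominus>\<^bsub>C (Suc k)\<^esub> f k (s u k) = u (Suc k)"
      using that scl by (simp add: minus_eq a_assoc r_neg)
    then show ?thesis using Suc that scl by (simp add: d_def sS a_comm)
  qed (simp add: d_def s0)
  \<comment> \<open>On all families \<open>d\<close> and \<open>s\<close> are mutually inverse, so
    only the eventual conditions have to match: compatibility from \<open>N\<close> on becomes
    vanishing of the differences from \<open>Suc N\<close> on. The index moves by one because the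
    difference between \<open>x (Suc n)\<close> and \<open>f n (x n)\<close> is stored at
    \<open>Suc n\<close>.\<close>
  have dg: "d x \<in> null_germs" if x: "x \<in> germs" for x
  proof -
    obtain N where "\<And>n. n \<ge> N \<Longrightarrow> x (Suc n) = f n (x n)" using germsE[OF x] by metis
    moreover have "z \<ominus>\<^bsub>C n\<^esub> z = \<zero>\<^bsub>C n\<^esub>" if "z \<in> carrier (C n)" for z n
      by (rule right_module.diff_self[OF C that])
    ultimately show ?thesis
      using x dcl[of x] by (intro null_germsI[of _ "Suc N"]) (auto simp: d_def germs_carrier split: nat.split)
  qed
  have sg: "s u \<in> germs" if u: "u \<in> null_germs" for u
  proof -
    obtain N where "\<And>n. n \<ge> N \<Longrightarrow> u n = \<zero>\<^bsub>C n\<^esub>" using null_germsE[OF u] by metis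
    then show ?thesis
      using u scl[of u] by (intro germsI[of _ N]) (simp_all add: sS null_germs_carrier)
  qed
  have ds_simps: "\<zero>\<^bsub>direct_sum UNIV C\<^esub> = (\<lambda>n. \<zero>\<^bsub>C n\<^esub>)"
    "x \<oplus>\<^bsub>direct_sum UNIV C\<^esub> y = (\<lambda>n. x n \<oplus>\<^bsub>C n\<^esub> y n)"
    "a \<odot>\<^bsub>direct_sum UNIV C\<^esub> x = (\<lambda>n. a \<odot>\<^bsub>C n\<^esub> x n)" for x y a
    by (simp_all add: direct_sum_UNIV_eq)
  have d_add: "d (\<lambda>n. x n \<oplus>\<^bsub>C n\<^esub> y n) = (\<lambda>n. d x n \<oplus>\<^bsub>C n\<^esub> d y n)" if xy: "x \<in> germs" "y \<in> germs" for x y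
  proof
    fix n
    show "d (\<lambda>n. x n \<oplus>\<^bsub>C n\<^esub> y n) n = d x n \<oplus>\<^bsub>C n\<^esub> d y n"
    proof (cases n)
      case (Suc k)
      interpret right_module R "C (Suc k)" by (rule C)
      show ?thesis using Suc xy by (simp add: d_def germs_carrier minus_eq minus_add a_ac)
    qed (simp add: d_def)
  qed
  have d_smult: "d (\<lambda>n. a \<odot>\<^bsub>C n\<^esub> x n) = (\<lambda>n. a \<odot>\<^bsub>C n\<^esub> d x n)" if xy: "a \<in> carrier R" "x \<in> germs" for a x
  proof
    fix n
    show "d (\<lambda>n. a \<odot>\<^bsub>C n\<^esub> x n) n = a \<odot>\<^bsub>C n\<^esub> d x n"
    proof (cases n)
      case (Suc k)
      interpret right_module R "C (Suc k)" by (rule C)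
      show ?thesis using Suc xy by (simp add: d_def germs_carrier smult_r_diff)
    qed (simp add: d_def)
  qed
  have "restrict d (carrier germ_module) \<in> mod_hom R germ_module (direct_sum UNIV C)"
    by (rule mod_hom_restrictI[OF right_module_germs])
      (simp_all add: carrier_direct_sum_UNIV ds_simps dg d_add d_smult)
  moreover have "bij_betw (restrict d germs) germs null_germs"
  proof (rule bij_betwI[of _ _ _ s])
    show "s (restrict d germs x) = x" if "x \<in> germs" for x
      using that sd[of x] germs_carrier by auto
    show "restrict d germs (s u) = u" if "u \<in> null_germs" for u
      using that ds[of u] sg null_germs_carrier by auto
  qed (use dg sg in auto)
  ultimately show ?thesis
    unfolding mod_iso_def by (intro bexI[of _ "restrict d germs"]) (simp_all add: carrier_direct_sum_UNIV)
qed

text \<open>Modulo \<open>null_germs\<close> the entries below \<open>n\<close> are immaterial; zero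
  makes the map a homomorphism and gives the exact formula \<open>germ_of_shift\<close>.\<close>

definition germ_of :: "nat \<Rightarrow> 'm \<Rightarrow> nat \<Rightarrow> 'm" where
  "germ_of n = (\<lambda>a\<in>carrier (C n). \<lambda>i. if i < n then \<zero>\<^bsub>C i\<^esub> else seq_map C f n (i - n) a)"

lemma germ_of_eq:
  "a \<in> carrier (C n) \<Longrightarrow> germ_of n a = (\<lambda>i. if i < n then \<zero>\<^bsub>C i\<^esub> else seq_map C f n (i - n) a)"
  by (simp add: germ_of_def)

lemma germ_of_hom: "germ_of n \<in> mod_hom R (C n) germ_module"
  unfolding germ_of_def
proof (rule mod_hom_restrictI[OF C])
  fix a assume a: "a \<in> carrier (C n)"
  have "seq_map C f n (i - n) a \<in> carrier (C i)" if "\<not> i < n" for i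
    using seq_map_closed[OF a, of "i - n"] that by simp
  moreover have "seq_map C f n (Suc i - n) a = f i (seq_map C f n (i - n) a)" if "i \<ge> n" for i
    using seq_map_Suc[OF a, of "i - n"] that by (simp add: Suc_diff_le)
  ultimately show "(\<lambda>i. if i < n then \<zero>\<^bsub>C i\<^esub> else seq_map C f n (i - n) a) \<in> carrier germ_module"
    by (simp, intro germsI[of _ n]) auto
  fix b assume b: "b \<in> carrier (C n)"
  show "(\<lambda>i. if i < n then \<zero>\<^bsub>C i\<^esub> else seq_map C f n (i - n) (a \<oplus>\<^bsub>C n\<^esub> b)) =
    (\<lambda>i. if i < n then \<zero>\<^bsub>C i\<^esub> else seq_map C f n (i - n) a) \<oplus>\<^bsub>germ_module\<^esub>
    (\<lambda>i. if i < n then \<zero>\<^bsub>C i\<^esub> else seq_map C f n (i - n) b)"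
    using mod_hom_add[OF seq_map_hom[of n] a b] by (auto simp: fun_eq_iff)
next
  fix a r assume a: "a \<in> carrier (C n)" "r \<in> carrier R"
  show "(\<lambda>i. if i < n then \<zero>\<^bsub>C i\<^esub> else seq_map C f n (i - n) (r \<odot>\<^bsub>C n\<^esub> a)) =
    r \<odot>\<^bsub>germ_module\<^esub> (\<lambda>i. if i < n then \<zero>\<^bsub>C i\<^esub> else seq_map C f n (i - n) a)"
    using mod_hom_smult[OF seq_map_hom[of n] a(2,1)] a by (auto simp: fun_eq_iff)
qed

text \<open>The two families differ at index \<open>n\<close> alone. That entry forms a null family,
  so \<open>a\<close> and its image at the next stage agree in the limit; keeping it explicit is
  what later produces the term \<open>y n a\<close> of the telescoping equation.\<close>

lemma germ_of_shift:
  assumes a: "a \<in> carrier (C n)"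
  shows "germ_of n a = (\<lambda>i. germ_of (Suc n) (f n a) i \<oplus>\<^bsub>C i\<^esub> (if i = n then a else \<zero>\<^bsub>C i\<^esub>))"
proof
  fix i
  have "seq_map C f n (i - n) a = seq_map C f (Suc n) (i - Suc n) (f n a)" if "i > n"
    using seq_map_Suc_left[OF a, of "i - Suc n"] that by (simp add: Suc_diff_Suc)
  moreover have "seq_map C f (Suc n) (i - Suc n) (f n a) \<in> carrier (C i)" if "i > n"
    using seq_map_closed[of "f n a" "Suc n" "i - Suc n"] that a by simp
  ultimately show "germ_of n a i = germ_of (Suc n) (f n a) i \<oplus>\<^bsub>C i\<^esub> (if i = n then a else \<zero>\<^bsub>C i\<^esub>)"
    using a seq_map_0[OF a] by (auto simp: germ_of_eq)
qed

end

text \<open>A colimit described by its elements: each comes from some stage, and an element that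
  dies in \<open>M\<close> dies at a finite stage. The description involves no universe, and
  \<open>M\<close> may have another type than the \<open>C n\<close>, so it applies to quotients of
  families as well as to small modules.\<close>

locale sequence_colimit = module_sequence R C f + M: right_module R M
  for R :: "('r, 'k) ring_scheme" and C :: "nat \<Rightarrow> ('r, 'm) module" and f :: "nat \<Rightarrow> 'm \<Rightarrow> 'm"
    and M :: "('r, 'n) module" +
  fixes c :: "nat \<Rightarrow> 'm \<Rightarrow> 'n"
  assumes c: "\<And>n. c n \<in> mod_hom R (C n) M"
    and c_f: "\<And>n x. x \<in> carrier (C n) \<Longrightarrow> c (Suc n) (f n x) = c n x"
    and c_onto: "\<And>y. y \<in> carrier M \<Longrightarrow> \<exists>n. \<exists>x\<in>carrier (C n). y = c n x"
    and c_ker: "\<And>n x. \<lbrakk>x \<in> carrier (C n); c n x = \<zero>\<^bsub>M\<^esub>\<rbrakk> \<Longrightarrow> \<exists>k. seq_map C f n k x = \<zero>\<^bsub>C (n + k)\<^esub>"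
begin

lemma c_closed [simp]: "x \<in> carrier (C n) \<Longrightarrow> c n x \<in> carrier M"
  and c_add [simp]: "\<lbrakk>x \<in> carrier (C n); y \<in> carrier (C n)\<rbrakk> \<Longrightarrow> c n (x \<oplus>\<^bsub>C n\<^esub> y) = c n x \<oplus>\<^bsub>M\<^esub> c n y"
  and c_smult [simp]: "\<lbrakk>a \<in> carrier R; x \<in> carrier (C n)\<rbrakk> \<Longrightarrow> c n (a \<odot>\<^bsub>C n\<^esub> x) = a \<odot>\<^bsub>M\<^esub> c n x"
  and c_zero [simp]: "c n \<zero>\<^bsub>C n\<^esub> = \<zero>\<^bsub>M\<^esub>"
proof -
  interpret module_hom R "C n" M "c n" by (intro module_homI C c M.right_module_axioms)
  show "x \<in> carrier (C n) \<Longrightarrow> c n x \<in> carrier M"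
    "\<lbrakk>x \<in> carrier (C n); y \<in> carrier (C n)\<rbrakk> \<Longrightarrow> c n (x \<oplus>\<^bsub>C n\<^esub> y) = c n x \<oplus>\<^bsub>M\<^esub> c n y"
    "\<lbrakk>a \<in> carrier R; x \<in> carrier (C n)\<rbrakk> \<Longrightarrow> c n (a \<odot>\<^bsub>C n\<^esub> x) = a \<odot>\<^bsub>M\<^esub> c n x"
    "c n \<zero>\<^bsub>C n\<^esub> = \<zero>\<^bsub>M\<^esub>" by simp_all
qed

lemma c_seq_map: "x \<in> carrier (C n) \<Longrightarrow> c (n + k) (seq_map C f n k x) = c n x"
proof (induction k)
  case 0
  then show ?case using seq_map_0[OF 0] by simp
next
  case (Suc k)
  then show ?case using seq_map_Suc[OF Suc.prems, of k] c_f[OF seq_map_closed[OF Suc.prems, of k]] by simp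
qed

text \<open>For large \<open>n\<close> the elements \<open>c n (x n)\<close> coincide, and their
  common value is the image of \<open>x\<close>. The kernel consists of the null families because an
  eventually compatible family is determined, from some index on, by one entry, and an entry that is
  zero in \<open>M\<close> dies at a finite stage.\<close>

lemma germ_limit:
  obtains g where "g \<in> mod_hom R germ_module M" "g ` germs = carrier M"
    "\<And>x. x \<in> germs \<Longrightarrow> g x = \<zero>\<^bsub>M\<^esub> \<longleftrightarrow> x \<in> null_germs"
proof -
  let ?P = "\<lambda>x y. x \<in> germs \<and> (\<exists>N. \<forall>n\<ge>N. y = c n (x n))"
  have stable: "c n (x n) = c N (x N)" if "x \<in> germs" "\<And>n. n \<ge> N \<Longrightarrow> x (Suc n) = f n (x n)" "n \<ge> N" for x N n
    using that(3)
  proof (induction n rule: dec_induct)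
    case (step n)
    then show ?case using that(1,2) c_f[OF germs_carrier, of x n] by simp
  qed simp
  have "\<exists>g\<in>mod_hom R germ_module M. \<forall>x y. ?P x y \<longrightarrow> g x = y"
  proof (rule mod_hom_of_graph[OF right_module_germs M.right_module_axioms])
    fix x assume "x \<in> carrier germ_module"
    then have x: "x \<in> germs" by simp
    obtain N where "\<And>n. n \<ge> N \<Longrightarrow> x (Suc n) = f n (x n)" using germsE[OF x] by metis
    then show "\<exists>y. ?P x y" using stable[OF x] x by metis
  next
    fix x y assume "?P x y"
    then show "x \<in> carrier germ_module \<and> y \<in> carrier M" using c_closed[OF germs_carrier] by auto
  next
    fix x y x' y' assume *: "?P x y" "?P x' y'"
    then obtain N N' where N: "\<And>n. n \<ge> N \<Longrightarrow> y = c n (x n)" "\<And>n. n \<ge> N' \<Longrightarrow> y' = c n (x' n)" by metis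
    have "x \<oplus>\<^bsub>germ_module\<^esub> x' \<in> germs"
      using * abelian_monoid.a_closed[OF abelian_group.axioms(1)[OF right_module.axioms(2)[OF right_module_germs]], of x x'] by simp
    moreover have "y \<oplus>\<^bsub>M\<^esub> y' = c n ((x \<oplus>\<^bsub>germ_module\<^esub> x') n)" if "n \<ge> max N N'" for n
      using N[of n] that * by (simp add: germs_carrier)
    ultimately show "?P (x \<oplus>\<^bsub>germ_module\<^esub> x') (y \<oplus>\<^bsub>M\<^esub> y')" by metis
  next
    fix a x y assume *: "a \<in> carrier R" "?P x y"
    then obtain N where N: "\<And>n. n \<ge> N \<Longrightarrow> y = c n (x n)" by metis
    have "a \<odot>\<^bsub>germ_module\<^esub> x \<in> germs"
      using * right_module.ract_closed[OF right_module_germs, of a x] by simp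
    moreover have "a \<odot>\<^bsub>M\<^esub> y = c n ((a \<odot>\<^bsub>germ_module\<^esub> x) n)" if "n \<ge> N" for n
      using N[of n] that * by (simp add: germs_carrier)
    ultimately show "?P (a \<odot>\<^bsub>germ_module\<^esub> x) (a \<odot>\<^bsub>M\<^esub> y)" by metis
  qed auto
  then obtain g where g: "g \<in> mod_hom R germ_module M" "\<And>x y. ?P x y \<Longrightarrow> g x = y" by metis
  have gN: "g x = c N (x N)" if "x \<in> germs" "\<And>n. n \<ge> N \<Longrightarrow> x (Suc n) = f n (x n)" for x N
    using that stable[OF that] by (intro g(2)) metis
  have g_of: "g (germ_of n a) = c n a" if a: "a \<in> carrier (C n)" for n a
  proof -
    have "germ_of n a \<in> germs" using mod_hom_closed[OF germ_of_hom a] by simp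
    moreover have "germ_of n a (Suc i) = f i (germ_of n a i)" if "i \<ge> n" for i
      using seq_map_Suc[OF a, of "i - n"] that a by (simp add: germ_of_eq Suc_diff_le)
    ultimately have "g (germ_of n a) = c n (germ_of n a n)" by (rule gN)
    then show ?thesis using a seq_map_0[OF a] by (simp add: germ_of_eq)
  qed
  have onto: "g ` germs = carrier M"
  proof
    show "g ` germs \<subseteq> carrier M" using mod_hom_closed[OF g(1)] by auto
    show "carrier M \<subseteq> g ` germs"
    proof
      fix y assume "y \<in> carrier M"
      then obtain n x where x: "x \<in> carrier (C n)" "y = c n x" using c_onto by metis
      then have "y = g (germ_of n x)" using g_of by simp
      then show "y \<in> g ` germs" using mod_hom_closed[OF germ_of_hom x(1)] by simp
    qed
  qed
  have "g x = \<zero>\<^bsub>M\<^esub> \<longleftrightarrow> x \<in> null_germs" if x: "x \<in> germs" for x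
  proof
    obtain N where N: "\<And>n. n \<ge> N \<Longrightarrow> x (Suc n) = f n (x n)" using germsE[OF x] by metis
    assume "g x = \<zero>\<^bsub>M\<^esub>"
    then have "c N (x N) = \<zero>\<^bsub>M\<^esub>" using gN[OF x N] by simp
    then obtain k where k: "seq_map C f N k (x N) = \<zero>\<^bsub>C (N + k)\<^esub>"
      using c_ker germs_carrier[OF x] by metis
    have sx: "seq_map C f N j (x N) = x (N + j)" for j
    proof (induction j)
      case 0
      show ?case using seq_map_0[OF germs_carrier[OF x]] by simp
    next
      case (Suc j)
      then show ?case using seq_map_Suc[OF germs_carrier[OF x, of N], of j] N[of "N + j"] by simp
    qed
    have "x n = \<zero>\<^bsub>C n\<^esub>" if "n \<ge> N + k" for n
      using that
    proof (induction n rule: dec_induct)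
      case base
      then show ?case using k sx by simp
    next
      case (step n)
      then show ?case using N[of n] by simp
    qed
    then show "x \<in> null_germs" using germs_carrier[OF x] by (intro null_germsI[of _ "N + k"])
  next
    assume "x \<in> null_germs"
    then obtain N where "\<And>n. n \<ge> N \<Longrightarrow> x n = \<zero>\<^bsub>C n\<^esub>" using null_germsE by metis
    then have "?P x \<zero>\<^bsub>M\<^esub>" using x by (metis c_zero)
    then show "g x = \<zero>\<^bsub>M\<^esub>" by (rule g(2))
  qed
  with g(1) onto show thesis using that by metis
qed

text \<open>This is the vanishing of the first derived limit of Hom(C n, Y). The maps
  \<open>y n\<close> add up to one map on the null families, which are the direct sum of the
  \<open>C n\<close>; since the germs modulo the null families are \<open>M\<close>, that map
  extends to all germs. Composing the extension with \<open>germ_of n\<close> gives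
  \<open>x n\<close>, and \<open>germ_of_shift\<close> gives the equation.\<close>

lemma Ext1_vanishes_telescope:
  assumes Y: "right_module R Y" and E: "Ext1_vanishes R M Y"
    and y: "\<And>n. y n \<in> mod_hom R (C n) Y"
  obtains x where "\<And>n. x n \<in> mod_hom R (C n) Y"
    "\<And>n a. a \<in> carrier (C n) \<Longrightarrow> x n a = x (Suc n) (f n a) \<oplus>\<^bsub>Y\<^esub> y n a"
proof -
  interpret Y: right_module R Y by fact
  obtain g where g: "g \<in> mod_hom R germ_module M" "g ` germs = carrier M"
    "\<And>x. x \<in> germs \<Longrightarrow> g x = \<zero>\<^bsub>M\<^esub> \<longleftrightarrow> x \<in> null_germs"
    using germ_limit by metis
  have yc: "y n a \<in> carrier Y" if "a \<in> carrier (C n)" for n a by (rule mod_hom_closed[OF y that])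
  have y0: "y n \<zero>\<^bsub>C n\<^esub> = \<zero>\<^bsub>Y\<^esub>" for n
  proof -
    interpret module_hom R "C n" Y "y n" by (intro module_homI C Y y)
    show ?thesis by simp
  qed
  \<comment> \<open>Partial sums of the values \<open>y k (z k)\<close>. For a null family they are
    eventually constant, and the final value is the sum of the \<open>y k\<close> on the direct
    sum.\<close>
  define s where "s z = rec_nat \<zero>\<^bsub>Y\<^esub> (\<lambda>k w. w \<oplus>\<^bsub>Y\<^esub> y k (z k))" for z
  have s0: "s z 0 = \<zero>\<^bsub>Y\<^esub>" and sS: "s z (Suc k) = s z k \<oplus>\<^bsub>Y\<^esub> y k (z k)" for z k
    by (simp_all add: s_def)
  have scl: "s z n \<in> carrier Y" if "\<And>n. z n \<in> carrier (C n)" for z n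
    by (induction n) (simp_all add: s0 sS that yc)
  have s_add: "s (\<lambda>n. z n \<oplus>\<^bsub>C n\<^esub> z' n) n = s z n \<oplus>\<^bsub>Y\<^esub> s z' n"
    if "\<And>n. z n \<in> carrier (C n)" "\<And>n. z' n \<in> carrier (C n)" for z z' n
    by (induction n) (simp_all add: s0 sS that yc scl mod_hom_add[OF y] Y.a_ac)
  have s_smult: "s (\<lambda>n. a \<odot>\<^bsub>C n\<^esub> z n) n = a \<odot>\<^bsub>Y\<^esub> s z n"
    if "\<And>n. z n \<in> carrier (C n)" "a \<in> carrier R" for z a n
    by (induction n) (simp_all add: s0 sS that yc scl mod_hom_smult[OF y] Y.ract_add_module Y.smult_r_null)
  have s_stable: "s z n = s z N" if "\<And>n. n \<ge> N \<Longrightarrow> z n = \<zero>\<^bsub>C n\<^esub>" "\<And>n. z n \<in> carrier (C n)" "n \<ge> N" for z n N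
    using that(3)
  proof (induction n rule: dec_induct)
    case (step n)
    then show ?case using that(1,2) scl[of z] by (simp add: sS y0)
  qed simp
  let ?Z = "germ_module\<lparr>carrier := null_germs\<rparr>"
  have Z: "right_module R ?Z" by (rule right_module_sub[OF right_module_germs null_germs_closed])
  let ?P = "\<lambda>z w. z \<in> null_germs \<and> (\<exists>N. \<forall>n\<ge>N. w = s z n)"
  have "\<exists>h\<in>mod_hom R ?Z Y. \<forall>z w. ?P z w \<longrightarrow> h z = w"
  proof (rule mod_hom_of_graph[OF Z Y])
    fix z assume "z \<in> carrier ?Z"
    then have z: "z \<in> null_germs" by simp
    obtain N where "\<And>n. n \<ge> N \<Longrightarrow> z n = \<zero>\<^bsub>C n\<^esub>" using null_germsE[OF z] by metis
    then show "\<exists>w. ?P z w" using s_stable[of N z] null_germs_carrier[OF z] z by metis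
  next
    fix z w assume "?P z w"
    then show "z \<in> carrier ?Z \<and> w \<in> carrier Y" using scl[of z] by (auto simp: null_germs_carrier)
  next
    fix z w z' w' assume *: "?P z w" "?P z' w'"
    then obtain N N' where N: "\<And>n. n \<ge> N \<Longrightarrow> w = s z n" "\<And>n. n \<ge> N' \<Longrightarrow> w' = s z' n" by metis
    have "z \<oplus>\<^bsub>?Z\<^esub> z' \<in> null_germs"
      using * abelian_monoid.a_closed[OF abelian_group.axioms(1)[OF right_module.axioms(2)[OF Z]], of z z'] by simp
    moreover have "w \<oplus>\<^bsub>Y\<^esub> w' = s (z \<oplus>\<^bsub>?Z\<^esub> z') n" if "n \<ge> max N N'" for n
      using N[of n] that * by (simp add: s_add null_germs_carrier)
    ultimately show "?P (z \<oplus>\<^bsub>?Z\<^esub> z') (w \<oplus>\<^bsub>Y\<^esub> w')" by metis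
  next
    fix a z w assume *: "a \<in> carrier R" "?P z w"
    then obtain N where N: "\<And>n. n \<ge> N \<Longrightarrow> w = s z n" by metis
    have "a \<odot>\<^bsub>?Z\<^esub> z \<in> null_germs"
      using * right_module.ract_closed[OF Z, of a z] by simp
    moreover have "a \<odot>\<^bsub>Y\<^esub> w = s (a \<odot>\<^bsub>?Z\<^esub> z) n" if "n \<ge> N" for n
      using N[of n] that * by (simp add: s_smult null_germs_carrier)
    ultimately show "?P (a \<odot>\<^bsub>?Z\<^esub> z) (a \<odot>\<^bsub>Y\<^esub> w)" by metis
  next
    fix w assume "?P \<zero>\<^bsub>?Z\<^esub> w"
    moreover have "s (\<lambda>n. \<zero>\<^bsub>C n\<^esub>) n = \<zero>\<^bsub>Y\<^esub>" for n by (induction n) (simp_all add: s0 sS y0)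
    ultimately show "w = \<zero>\<^bsub>Y\<^esub>" by auto
  qed
  then obtain h where h: "h \<in> mod_hom R ?Z Y" "\<And>z w. ?P z w \<Longrightarrow> h z = w" by metis
  have L: "null_germs = {x \<in> carrier germ_module. g x = \<zero>\<^bsub>M\<^esub>}"
    using g(3) null_germs_subset by auto
  have "g ` carrier germ_module = carrier M" using g(2) by simp
  then obtain t where t: "t \<in> mod_hom R germ_module Y" "\<And>z. z \<in> null_germs \<Longrightarrow> t z = h z"
    using Ext1_vanishes_extend[OF M.right_module_axioms Y right_module_germs E g(1) _ L h(1)] by metis
  have hz: "h (\<lambda>i. if i = n then a else \<zero>\<^bsub>C i\<^esub>) = y n a" (is "h ?z = _")
    and zn: "(\<lambda>i. if i = n then a else \<zero>\<^bsub>C i\<^esub>) \<in> null_germs" if a: "a \<in> carrier (C n)" for n a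
  proof -
    show z: "?z \<in> null_germs" using a by (intro null_germsI[of _ "Suc n"]) auto
    have "s ?z i = (if i \<le> n then \<zero>\<^bsub>Y\<^esub> else y n a)" for i
      by (induction i) (auto simp: s0 sS y0 yc a not_less_eq_eq le_antisym)
    then have "y n a = s ?z i" if "i \<ge> Suc n" for i using that by simp
    then show "h ?z = y n a" using z by (intro h(2)) metis
  qed
  show thesis
  proof
    show "compose (carrier (C n)) t (germ_of n) \<in> mod_hom R (C n) Y" for n
      by (rule mod_hom_comp[OF C germ_of_hom t(1)])
    fix n a assume a: "a \<in> carrier (C n)"
    let ?z = "\<lambda>i. if i = n then a else \<zero>\<^bsub>C i\<^esub>"
    have g1: "germ_of (Suc n) (f n a) \<in> carrier germ_module"
      using mod_hom_closed[OF germ_of_hom f_closed[OF a]] .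
    have g2: "?z \<in> carrier germ_module" using zn[OF a] null_germs_subset by auto
    have "germ_of n a = germ_of (Suc n) (f n a) \<oplus>\<^bsub>germ_module\<^esub> ?z"
      using germ_of_shift[OF a] by simp
    then have "t (germ_of n a) = t (germ_of (Suc n) (f n a)) \<oplus>\<^bsub>Y\<^esub> t ?z"
      using mod_hom_add[OF t(1) g1 g2] by simp
    then show "compose (carrier (C n)) t (germ_of n) a
        = compose (carrier (C (Suc n))) t (germ_of (Suc n)) (f n a) \<oplus>\<^bsub>Y\<^esub> y n a"
      using a hz[OF a] t(2)[OF zn[OF a]] by (simp add: compose_def)
  qed
qed

text \<open>Unlike in the definition of a direct limit, \<open>N\<close> need be neither small nor
  of a prescribed type. A value over zero is zero because the element representing it dies at a
  later stage, and \<open>d\<close> is unchanged along the sequence.\<close>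

lemma universal:
  assumes N: "right_module R N" and d: "\<And>n. d n \<in> mod_hom R (C n) N"
    and d_f: "\<And>n x. x \<in> carrier (C n) \<Longrightarrow> d (Suc n) (f n x) = d n x"
  obtains h where "h \<in> mod_hom R M N" "\<And>n x. x \<in> carrier (C n) \<Longrightarrow> h (c n x) = d n x"
proof -
  interpret N: right_module R N by fact
  have d_map: "d (n + k) (seq_map C f n k x) = d n x" if "x \<in> carrier (C n)" for n k x
  proof (induction k)
    case 0
    then show ?case using seq_map_0[OF that] by simp
  next
    case (Suc k)
    then show ?case using seq_map_Suc[OF that, of k] d_f[OF seq_map_closed[OF that, of k]] by simp
  qed
  have d0: "d n \<zero>\<^bsub>C n\<^esub> = \<zero>\<^bsub>N\<^esub>" for n
  proof -
    interpret module_hom R "C n" N "d n" by (intro module_homI C N d)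
    show ?thesis by simp
  qed
  let ?P = "\<lambda>y z. \<exists>n. \<exists>x\<in>carrier (C n). y = c n x \<and> z = d n x"
  have "\<exists>h\<in>mod_hom R M N. \<forall>y z. ?P y z \<longrightarrow> h y = z"
  proof (rule mod_hom_of_graph[OF M.right_module_axioms N])
    show "\<exists>z. ?P y z" if "y \<in> carrier M" for y using c_onto[OF that] by metis
    show "y \<in> carrier M \<and> z \<in> carrier N" if "?P y z" for y z
      using that mod_hom_closed[OF d] by auto
    fix y z y' z' assume "?P y z" "?P y' z'"
    then obtain n x n' x' where x: "x \<in> carrier (C n)" "y = c n x" "z = d n x"
      and x': "x' \<in> carrier (C n')" "y' = c n' x'" "z' = d n' x'" by metis
    \<comment> \<open>Both representatives are moved to the common stage \<open>n + n'\<close>,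
      where they can be added.\<close>
    let ?u = "seq_map C f n n' x" and ?v = "seq_map C f n' n x'"
    have u: "?u \<in> carrier (C (n + n'))" "?v \<in> carrier (C (n + n'))"
      using seq_map_closed[OF x(1), of n'] seq_map_closed[OF x'(1), of n] by (simp_all add: add.commute)
    have "y = c (n + n') ?u" "z = d (n + n') ?u" "y' = c (n + n') ?v" "z' = d (n + n') ?v"
      using x x' c_seq_map[OF x(1), of n'] c_seq_map[OF x'(1), of n] d_map[OF x(1), of n'] d_map[OF x'(1), of n]
      by (simp_all add: add.commute)
    then show "?P (y \<oplus>\<^bsub>M\<^esub> y') (z \<oplus>\<^bsub>N\<^esub> z')"
      using u mod_hom_add[OF d u]
      by (intro exI[of _ "n + n'"] bexI[of _ "?u \<oplus>\<^bsub>C (n + n')\<^esub> ?v"]) simp_all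
  next
    fix a y z assume a: "a \<in> carrier R" and "?P y z"
    then obtain n x where x: "x \<in> carrier (C n)" "y = c n x" "z = d n x" by metis
    then show "?P (a \<odot>\<^bsub>M\<^esub> y) (a \<odot>\<^bsub>N\<^esub> z)"
      using a mod_hom_smult[OF d a x(1)] by (intro exI[of _ n] bexI[of _ "a \<odot>\<^bsub>C n\<^esub> x"]) simp_all
  next
    fix z assume "?P \<zero>\<^bsub>M\<^esub> z"
    then obtain n x where x: "x \<in> carrier (C n)" "c n x = \<zero>\<^bsub>M\<^esub>" "z = d n x" by metis
    then obtain k where "seq_map C f n k x = \<zero>\<^bsub>C (n + k)\<^esub>" using c_ker by metis
    then show "z = \<zero>\<^bsub>N\<^esub>" using d_map[OF x(1), of k] d0 x by simp
  qed
  then obtain h where "h \<in> mod_hom R M N" "\<And>y z. ?P y z \<Longrightarrow> h y = z" by metis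
  then show thesis using that by metis
qed

end

text \<open>The carrier lies over \<open>nat \<Rightarrow> 'm\<close>, being a quotient of germs by
  representatives. The quotient map \<open>q\<close> is part of the conclusion because closure of
  \<open>\<B>\<close> under limits needs the presentation as a cokernel, not only the elementwise
  description.\<close>

lemma (in module_sequence) colimit_exists:
  obtains E :: "('r, nat \<Rightarrow> 'm) module" and q where
    "q \<in> mod_hom R germ_module E" "q ` germs = carrier E"
    "\<And>x. x \<in> germs \<Longrightarrow> q x = \<zero>\<^bsub>E\<^esub> \<longleftrightarrow> x \<in> null_germs"
    "sequence_colimit R C f E (\<lambda>n. compose (carrier (C n)) q (germ_of n))"
proof -
  obtain E q where E: "right_module R E" and "carrier E \<subseteq> carrier germ_module" and q: "q \<in> mod_hom R germ_module E"
    "q ` carrier germ_module = carrier E"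
    "\<And>x. x \<in> carrier germ_module \<Longrightarrow> q x = \<zero>\<^bsub>E\<^esub> \<longleftrightarrow> x \<in> null_germs"
    by (rule quotient_module_exists[OF right_module_germs null_germs_closed]) blast
  interpret E: right_module R E by fact
  interpret q: module_hom R germ_module E q by (intro module_homI right_module_germs E q(1))
  have gc: "germ_of n a \<in> carrier germ_module" if "a \<in> carrier (C n)" for n a
    by (rule mod_hom_closed[OF germ_of_hom that])
  \<comment> \<open>Germs that agree from some index on have a null difference. Subtraction in
    \<open>germ_module\<close> is seen to be componentwise by writing negatives as the action of
    \<open>-1\<close>.\<close>
  have eqI: "q x = q y" if "x \<in> germs" "y \<in> germs" "\<And>n. n \<ge> N \<Longrightarrow> x n = y n" for x y N
  proof -
    have "x \<ominus>\<^bsub>germ_module\<^esub> y \<in> germs" using that q.M.minus_closed[of x y] by simp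
    have e: "(x \<ominus>\<^bsub>germ_module\<^esub> y) n = x n \<ominus>\<^bsub>C n\<^esub> y n" for n
    proof -
      interpret Cn: right_module R "C n" by (rule C)
      have "\<ominus>\<^bsub>germ_module\<^esub> y = (\<ominus>\<^bsub>R\<^esub> \<one>\<^bsub>R\<^esub>) \<odot>\<^bsub>germ_module\<^esub> y"
        using that q.M.smult_minus_one[of y] by simp
      then have "(\<ominus>\<^bsub>germ_module\<^esub> y) n = \<ominus>\<^bsub>C n\<^esub> y n"
        using that Cn.smult_minus_one[of "y n"] by (simp add: germs_carrier)
      then show ?thesis by (simp add: q.M.minus_eq Cn.minus_eq)
    qed
    have "x \<ominus>\<^bsub>germ_module\<^esub> y \<in> null_germs"
    proof (rule null_germsI[of _ N])
      show "(x \<ominus>\<^bsub>germ_module\<^esub> y) n \<in> carrier (C n)" for n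
        using \<open>x \<ominus>\<^bsub>germ_module\<^esub> y \<in> germs\<close> by (rule germs_carrier)
      show "(x \<ominus>\<^bsub>germ_module\<^esub> y) n = \<zero>\<^bsub>C n\<^esub>" if "n \<ge> N" for n
        unfolding e using \<open>\<And>n. n \<ge> N \<Longrightarrow> x n = y n\<close>[OF that] \<open>y \<in> germs\<close>
        by (simp add: right_module.diff_self[OF C] germs_carrier)
    qed
    then have "q (x \<ominus>\<^bsub>germ_module\<^esub> y) = \<zero>\<^bsub>E\<^esub>"
      using q(3) \<open>x \<ominus>\<^bsub>germ_module\<^esub> y \<in> germs\<close> by simp
    then show ?thesis using that q.diff[of x y] E.diff_eq_zero_iff[of "q x" "q y"] by simp
  qed
  have "sequence_colimit R C f E (\<lambda>n. compose (carrier (C n)) q (germ_of n))"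
  proof unfold_locales
    show "compose (carrier (C n)) q (germ_of n) \<in> mod_hom R (C n) E" for n
      by (rule mod_hom_comp[OF C germ_of_hom q(1)])
    show "compose (carrier (C (Suc n))) q (germ_of (Suc n)) (f n x) = compose (carrier (C n)) q (germ_of n) x"
      if x: "x \<in> carrier (C n)" for n x
    proof -
      have "q (germ_of (Suc n) (f n x)) = q (germ_of n x)"
      proof (rule eqI[of _ _ "Suc n"])
        show "germ_of (Suc n) (f n x) \<in> germs" "germ_of n x \<in> germs"
          using gc[OF f_closed[OF x]] gc[OF x] by simp_all
        then show "germ_of (Suc n) (f n x) i = germ_of n x i" if "i \<ge> Suc n" for i
          using that germ_of_shift[OF x] by (simp add: germs_carrier)
      qed
      then show ?thesis using x by (simp add: compose_def)
    qed
    show "\<exists>n. \<exists>x\<in>carrier (C n). y = compose (carrier (C n)) q (germ_of n) x" if "y \<in> carrier E" for y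
    proof -
      have "y \<in> q ` carrier germ_module" using that q(2) by simp
      then obtain x where x: "x \<in> germs" "y = q x" by auto
      then obtain N where N: "\<And>n. n \<ge> N \<Longrightarrow> x (Suc n) = f n (x n)" using germsE by metis
      have xN: "x N \<in> carrier (C N)" by (rule germs_carrier[OF x(1)])
      have sx: "seq_map C f N j (x N) = x (N + j)" for j
      proof (induction j)
        case 0
        show ?case using seq_map_0[OF xN] by simp
      next
        case (Suc j)
        then show ?case using seq_map_Suc[OF xN, of j] N[of "N + j"] by simp
      qed
      have "q x = q (germ_of N (x N))"
      proof (rule eqI[of _ _ N])
        show "x n = germ_of N (x N) n" if "n \<ge> N" for n
          using that xN sx[of "n - N"] by (simp add: germ_of_eq)
      qed (use x gc[OF xN] in auto)
      then show ?thesis using x xN by (intro exI[of _ N] bexI[of _ "x N"]) (simp_all add: compose_def)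
    qed
    show "\<exists>k. seq_map C f n k x = \<zero>\<^bsub>C (n + k)\<^esub>"
      if x: "x \<in> carrier (C n)" "compose (carrier (C n)) q (germ_of n) x = \<zero>\<^bsub>E\<^esub>" for n x
    proof -
      have "germ_of n x \<in> null_germs" using x gc[OF x(1)] q(3) by (simp add: compose_def)
      then obtain N where N: "\<And>i. i \<ge> N \<Longrightarrow> germ_of n x i = \<zero>\<^bsub>C i\<^esub>" using null_germsE by metis
      show ?thesis using N[of "n + N"] x by (intro exI[of _ N]) (simp add: germ_of_eq)
    qed
  qed
  then show thesis
    by (rule that[rotated 3]) (use q in simp_all)
qed

section \<open>Mittag-Leffler sequences\<close>

locale inverse_sequence =
  fixes H :: "nat \<Rightarrow> 'g monoid" and h :: "nat \<Rightarrow> 'g \<Rightarrow> 'g"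
  assumes H: "\<And>n. comm_group (H n)" and h: "\<And>n. h n \<in> hom (H (Suc n)) (H n)"
begin

lemma inv_map_hom: "inv_map h n k \<in> hom (H (n + k)) (H n)"
proof (induction k)
  case (Suc k)
  then show ?case using hom_compose[OF h[of "n + k"] Suc] by (simp add: comp_def)
qed (simp add: hom_def)

lemma inv_map_add: "inv_map h n (k + l) = inv_map h n k \<circ> inv_map h (n + k) l"
  by (induction l) (simp_all add: comp_assoc add.assoc)

lemma inv_map_Suc_left: "inv_map h n (Suc k) = h n \<circ> inv_map h (Suc n) k"
  using inv_map_add[of n 1 k] by simp

lemma inv_map_image_antimono:
  assumes "k \<le> l"
  shows "inv_map h n l ` carrier (H (n + l)) \<subseteq> inv_map h n k ` carrier (H (n + k))"
proof -
  obtain j where l: "l = k + j" using assms by (metis le_Suc_ex)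
  have "inv_map h (n + k) j ` carrier (H (n + k + j)) \<subseteq> carrier (H (n + k))"
    using hom_carrier[OF inv_map_hom] .
  then show ?thesis by (auto simp: l inv_map_add add.assoc)
qed

text \<open>The formal solution is the infinite sum of the images of \<open>y n\<close>,
  \<open>y (n + 1)\<close> and so on in \<open>H n\<close>. Truncating it far enough leaves errors
  in the stable images, and there the equation is solvable step by step because the maps between
  stable images are onto.\<close>

lemma Mittag_Leffler_telescope:
  assumes ml: "Mittag_Leffler H h" and y: "\<And>n. y n \<in> carrier (H n)"
  shows "\<exists>x. \<forall>n. x n \<in> carrier (H n) \<and> x n = h n (x (Suc n)) \<otimes>\<^bsub>H n\<^esub> y n"
proof -
  have "\<forall>n. \<exists>k0. \<forall>k\<ge>k0. inv_map h n k ` carrier (H (n + k)) = inv_map h n k0 ` carrier (H (n + k0))"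
    using ml by (simp add: Mittag_Leffler_def)
  then obtain k0 where k0: "\<And>n k. k \<ge> k0 n \<Longrightarrow>
      inv_map h n k ` carrier (H (n + k)) = inv_map h n (k0 n) ` carrier (H (n + k0 n))"
    by metis
  define S where "S n = inv_map h n (k0 n) ` carrier (H (n + k0 n))" for n
  note group = comm_group.axioms(2)[OF H]
  have Ssub: "subgroup (S n) (H n)" for n
  proof -
    interpret group_hom "H (n + k0 n)" "H n" "inv_map h n (k0 n)"
      by (simp add: group_hom_def group_hom_axioms_def group inv_map_hom)
    show ?thesis unfolding S_def by (rule img_is_subgroup)
  qed
  have S_im: "inv_map h n k z \<in> S n" if "k \<ge> k0 n" "z \<in> carrier (H (n + k))" for n k z
    using k0[OF that(1)] that(2) unfolding S_def by blast
  \<comment> \<open>A stable element of \<open>H n\<close> comes from arbitrarily far away. The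
    distance \<open>k0 n + k0 (Suc n)\<close> makes the intermediate element at \<open>Suc n\<close>
    stable too.\<close>
  have S_onto: "\<exists>t\<in>S (Suc n). h n t = s" if s: "s \<in> S n" for n s
  proof -
    let ?k = "k0 n + k0 (Suc n)"
    have "s \<in> inv_map h n (Suc ?k) ` carrier (H (n + Suc ?k))"
      using s k0[of n "Suc ?k"] by (simp add: S_def)
    then obtain z where z: "z \<in> carrier (H (Suc n + ?k))" "s = inv_map h n (Suc ?k) z" by auto
    then have "s = h n (inv_map h (Suc n) ?k z)" using inv_map_Suc_left[of n ?k, THEN fun_cong, of z] by simp
    moreover have "inv_map h (Suc n) ?k z \<in> S (Suc n)" using z by (intro S_im) auto
    ultimately show ?thesis by auto
  qed
  \<comment> \<open>\<open>T n K\<close> is the formal solution cut off after \<open>K\<close>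
    terms. By \<open>shift\<close>, applying \<open>h n\<close> and adding \<open>y n\<close> turns
    a truncation at \<open>Suc n\<close> into the one at \<open>n\<close> with one more
    term.\<close>
  define T where "T n K = rec_nat \<one>\<^bsub>H n\<^esub> (\<lambda>i w. w \<otimes>\<^bsub>H n\<^esub> inv_map h n i (y (n + i))) K" for n K
  have T0: "T n 0 = \<one>\<^bsub>H n\<^esub>" and TS: "T n (Suc K) = T n K \<otimes>\<^bsub>H n\<^esub> inv_map h n K (y (n + K))" for n K
    by (simp_all add: T_def)
  have yi: "inv_map h n i (y (n + i)) \<in> carrier (H n)" for n i
    using hom_in_carrier[OF inv_map_hom y] .
  have Tcl: "T n K \<in> carrier (H n)" for n K
  proof -
    interpret comm_group "H n" by (rule H)
    show ?thesis by (induction K) (simp_all add: T0 TS yi)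
  qed
  have hcl: "h n z \<in> carrier (H n)" if "z \<in> carrier (H (Suc n))" for n z
    using hom_in_carrier[OF h that] .
  have h1: "h n \<one>\<^bsub>H (Suc n)\<^esub> = \<one>\<^bsub>H n\<^esub>" for n
    using hom_one[OF h] group by blast
  have shift: "h n (T (Suc n) K) \<otimes>\<^bsub>H n\<^esub> y n = T n (Suc K)" for n K
  proof -
    interpret comm_group "H n" by (rule H)
    have y0: "y n \<in> carrier (H n)" by (rule y)
    show ?thesis
    proof (induction K)
      case 0
      show ?case using y0 by (simp add: T0 TS h1)
    next
      case (Suc K)
      let ?z = "inv_map h (Suc n) K (y (Suc n + K))"
      have z: "h n ?z = inv_map h n (Suc K) (y (n + Suc K))"
        using inv_map_Suc_left[of n K, THEN fun_cong] by simp
      have "h n (T (Suc n) (Suc K)) \<otimes>\<^bsub>H n\<^esub> y n = (h n (T (Suc n) K) \<otimes>\<^bsub>H n\<^esub> y n) \<otimes>\<^bsub>H n\<^esub> h n ?z"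
        using hom_mult[OF h Tcl yi, of n K K] Tcl hcl yi[of "Suc n" K] y0 by (simp add: TS m_ac)
      then show ?case unfolding Suc z TS[of n "Suc K"] .
    qed
  qed
  have T_le: "\<exists>s\<in>S n. T n (K + j) = s \<otimes>\<^bsub>H n\<^esub> T n K" if "K \<ge> k0 n" for n K j
  proof (induction j)
    case 0
    interpret comm_group "H n" by (rule H)
    show ?case using Tcl subgroup.one_closed[OF Ssub] by (intro bexI[of _ "\<one>\<^bsub>H n\<^esub>"]) auto
  next
    case (Suc j)
    interpret comm_group "H n" by (rule H)
    obtain s where s: "s \<in> S n" "T n (K + j) = s \<otimes>\<^bsub>H n\<^esub> T n K" using Suc by metis
    have sc: "s \<in> carrier (H n)" using subgroup.mem_carrier[OF Ssub s(1)] .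
    let ?z = "inv_map h n (K + j) (y (n + (K + j)))"
    have "?z \<in> S n" using that y by (intro S_im) auto
    then show ?case
      using s sc Tcl yi subgroup.m_closed[OF Ssub s(1)]
      by (intro bexI[of _ "s \<otimes>\<^bsub>H n\<^esub> ?z"]) (simp_all add: TS m_ac)
  qed
  \<comment> \<open>With \<open>k0 n\<close> terms, the terms omitted at \<open>n\<close> are
    stable. The summand \<open>k0 (n - 1)\<close> ensures that the truncation at
    \<open>Suc n\<close>, carried down to \<open>n\<close>, also has at least \<open>k0 n\<close>
    terms; the two truncations at \<open>n\<close> then differ by a stable element.\<close>
  define K where "K n = k0 n + k0 (n - 1)" for n
  define u where "u n = T n (K n)" for n
  have "\<exists>w\<in>S n. h n (u (Suc n)) \<otimes>\<^bsub>H n\<^esub> y n = w \<otimes>\<^bsub>H n\<^esub> u n" for n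
  proof -
    interpret comm_group "H n" by (rule H)
    have e: "h n (u (Suc n)) \<otimes>\<^bsub>H n\<^esub> y n = T n (Suc (K (Suc n)))" unfolding u_def by (rule shift)
    obtain s where s: "s \<in> S n" "T n (Suc (K (Suc n))) = s \<otimes>\<^bsub>H n\<^esub> T n (k0 n)"
      using T_le[of n "k0 n" "Suc (K (Suc n)) - k0 n"] by (auto simp: K_def add.commute)
    obtain s' where s': "s' \<in> S n" "u n = s' \<otimes>\<^bsub>H n\<^esub> T n (k0 n)"
      using T_le[of n "k0 n" "k0 (n - 1)"] by (auto simp: u_def K_def)
    have c: "s \<in> carrier (H n)" "s' \<in> carrier (H n)"
      using subgroup.mem_carrier[OF Ssub] s s' by auto
    have "s \<otimes>\<^bsub>H n\<^esub> inv\<^bsub>H n\<^esub> s' \<in> S n"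
      using subgroup.m_closed[OF Ssub s(1) subgroup.m_inv_closed[OF Ssub s'(1)]] .
    moreover have "T n (Suc (K (Suc n))) = (s \<otimes>\<^bsub>H n\<^esub> inv\<^bsub>H n\<^esub> s') \<otimes>\<^bsub>H n\<^esub> u n"
      using c Tcl unfolding s s' by (simp add: m_assoc inv_solve_left)
    ultimately show ?thesis using e by metis
  qed
  then obtain w where w: "\<And>n. w n \<in> S n" "\<And>n. h n (u (Suc n)) \<otimes>\<^bsub>H n\<^esub> y n = w n \<otimes>\<^bsub>H n\<^esub> u n" by metis
  \<comment> \<open>Inside the stable images the equation is solved by recursion:
    \<open>v (Suc n)\<close> is a stable preimage of the quotient of \<open>v n\<close> by
    \<open>w n\<close>.\<close>
  have "\<exists>v. \<forall>n. v n \<in> S n \<and> v n = h n (v (Suc n)) \<otimes>\<^bsub>H n\<^esub> w n"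
  proof -
    have "\<exists>t. t \<in> S (Suc n) \<and> s = h n t \<otimes>\<^bsub>H n\<^esub> w n" if s: "s \<in> S n" for n s
    proof -
      interpret comm_group "H n" by (rule H)
      have "s \<otimes>\<^bsub>H n\<^esub> inv\<^bsub>H n\<^esub> w n \<in> S n"
        using subgroup.m_closed[OF Ssub s subgroup.m_inv_closed[OF Ssub w(1)]] .
      then obtain t where t: "t \<in> S (Suc n)" "h n t = s \<otimes>\<^bsub>H n\<^esub> inv\<^bsub>H n\<^esub> w n" using S_onto by metis
      have "s \<in> carrier (H n)" "w n \<in> carrier (H n)"
        using subgroup.mem_carrier[OF Ssub] s w by auto
      then have "s = h n t \<otimes>\<^bsub>H n\<^esub> w n" using t by (simp add: m_assoc)
      then show ?thesis using t by metis
    qed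
    moreover have "\<exists>s. s \<in> S 0" using subgroup.one_closed[OF Ssub] by metis
    ultimately show ?thesis
      using dependent_nat_choice[of "\<lambda>n s. s \<in> S n" "\<lambda>n s t. s = h n t \<otimes>\<^bsub>H n\<^esub> w n"] by metis
  qed
  then obtain v where v: "\<And>n. v n \<in> S n" "\<And>n. v n = h n (v (Suc n)) \<otimes>\<^bsub>H n\<^esub> w n" by metis
  have vc: "v n \<in> carrier (H n)" "w n \<in> carrier (H n)" "u n \<in> carrier (H n)" for n
    using subgroup.mem_carrier[OF Ssub v(1)] subgroup.mem_carrier[OF Ssub w(1)] by (auto simp: u_def Tcl)
  show ?thesis
  proof (intro exI allI conjI)
    fix n
    interpret comm_group "H n" by (rule H)
    show "u n \<otimes>\<^bsub>H n\<^esub> v n \<in> carrier (H n)" using vc by simp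
    have "h n (u (Suc n) \<otimes>\<^bsub>H (Suc n)\<^esub> v (Suc n)) \<otimes>\<^bsub>H n\<^esub> y n
        = (h n (u (Suc n)) \<otimes>\<^bsub>H n\<^esub> y n) \<otimes>\<^bsub>H n\<^esub> h n (v (Suc n))"
      using hom_mult[OF h vc(3) vc(1)] hcl vc y by (simp add: m_ac)
    also have "\<dots> = u n \<otimes>\<^bsub>H n\<^esub> (h n (v (Suc n)) \<otimes>\<^bsub>H n\<^esub> w n)"
      unfolding w(2) using hcl vc by (simp add: m_ac)
    also have "\<dots> = u n \<otimes>\<^bsub>H n\<^esub> v n" using v(2)[of n] by simp
    finally show "u n \<otimes>\<^bsub>H n\<^esub> v n = h n (u (Suc n) \<otimes>\<^bsub>H (Suc n)\<^esub> v (Suc n)) \<otimes>\<^bsub>H n\<^esub> y n" by simp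
  qed
qed

end

section \<open>Finiteness conditions and sequences\<close>

text \<open>Generation is phrased through closed sets so that it applies directly to kernels: a
  homomorphism that is zero on \<open>G\<close> is zero.\<close>

definition finitely_generated :: "('r, 'k) ring_scheme \<Rightarrow> ('r, 'm) module \<Rightarrow> bool" where
  "finitely_generated R X \<longleftrightarrow>
     (\<exists>G. finite G \<and> G \<subseteq> carrier X \<and> (\<forall>S. module_closed R X S \<and> G \<subseteq> S \<longrightarrow> S = carrier X))"

lemma finitely_presentedE:
  assumes "finitely_presented R X"
  obtains I J :: "nat set" and p q where "finite I" "finite J"
    "q \<in> mod_hom R (free_module R J) (free_module R I)" "p \<in> mod_hom R (free_module R I) X"
    "q ` carrier (free_module R J) = {u \<in> carrier (free_module R I). p u = \<zero>\<^bsub>X\<^esub>}"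
    "p ` carrier (free_module R I) = carrier X"
  using assms unfolding finitely_presented_def presented_by_def a_kernel_def'
  by (elim exE bexE conjE) (rule that)

lemma finitely_presented_imp_generated:
  assumes "finitely_presented R X"
  shows "finitely_generated R X"
proof -
  have X: "right_module R X" using assms by (simp add: finitely_presented_def)
  interpret X: right_module R X by (rule X)
  obtain I :: "nat set" and p where I: "finite I" and p: "p \<in> mod_hom R (free_module R I) X"
    "p ` carrier (free_module R I) = carrier X"
    using finitely_presentedE[OF assms] by metis
  interpret p: module_hom R "free_module R I" X p by (intro module_homI X.R.right_module_free X p)
  have "S = carrier X" if S: "module_closed R X S" "p ` free_basis R I ` I \<subseteq> S" for S
  proof -
    have eq: "{u \<in> carrier (free_module R I). p u \<in> S} = carrier (free_module R I)"
      using S(2) X.R.free_basis_closed[of I]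
      by (intro X.R.free_span p.vimage_closed[OF S(1)]) auto
    have "p u \<in> S" if "u \<in> carrier (free_module R I)" for u
    proof -
      have "u \<in> {u \<in> carrier (free_module R I). p u \<in> S}" unfolding eq by (rule that)
      then show ?thesis by simp
    qed
    then have "carrier X \<subseteq> S" unfolding p(2)[symmetric] by auto
    then show ?thesis using S(1) by (auto simp: module_closed_def)
  qed
  then show ?thesis
    unfolding finitely_generated_def using I mod_hom_closed[OF p(1) X.R.free_basis_closed]
    by (intro exI[of _ "p ` free_basis R I ` I"]) auto
qed

context module_sequence
begin

lemma seq_map_zero_mono:
  assumes "x \<in> carrier (C n)" "seq_map C f n k x = \<zero>\<^bsub>C (n + k)\<^esub>" "k \<le> l"
  shows "seq_map C f n l x = \<zero>\<^bsub>C (n + l)\<^esub>"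
proof -
  obtain j where "l = k + j" using assms(3) by (metis le_Suc_ex)
  then show ?thesis using assms seq_map_add[OF assms(1), of k j] by (simp add: add.assoc)
qed

end

section \<open>Homomorphisms from finite modules into a sequential colimit\<close>

context sequence_colimit
begin

lemma c_onto_finite:
  assumes "finite I" "\<And>i. i \<in> I \<Longrightarrow> g i \<in> carrier M"
  shows "\<exists>n a. \<forall>i\<in>I. a i \<in> carrier (C n) \<and> c n (a i) = g i"
proof -
  obtain n b where nb: "\<And>i. i \<in> I \<Longrightarrow> b i \<in> carrier (C (n i)) \<and> c (n i) (b i) = g i"
    using c_onto[OF assms(2)] by metis
  obtain N where N: "\<And>i. i \<in> I \<Longrightarrow> n i \<le> N"
    using finite_nat_set_iff_bounded_le[of "n ` I"] assms(1) by auto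
  let ?a = "\<lambda>i. seq_map C f (n i) (N - n i) (b i)"
  have "?a i \<in> carrier (C N) \<and> c N (?a i) = g i" if i: "i \<in> I" for i
    using seq_map_closed[of "b i" "n i" "N - n i"] c_seq_map[of "b i" "n i" "N - n i"] nb[OF i] N[OF i]
    by simp
  then show ?thesis by (intro exI[of _ N] exI[of _ ?a]) simp
qed

lemma vanish_finite:
  assumes "finite J" "\<And>j. j \<in> J \<Longrightarrow> a j \<in> carrier (C n)" "\<And>j. j \<in> J \<Longrightarrow> c n (a j) = \<zero>\<^bsub>M\<^esub>"
  shows "\<exists>k. \<forall>j\<in>J. seq_map C f n k (a j) = \<zero>\<^bsub>C (n + k)\<^esub>"
proof -
  obtain k where k: "\<And>j. j \<in> J \<Longrightarrow> seq_map C f n (k j) (a j) = \<zero>\<^bsub>C (n + k j)\<^esub>"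
    using c_ker[OF assms(2,3)] by metis
  obtain N where N: "\<And>j. j \<in> J \<Longrightarrow> k j \<le> N"
    using finite_nat_set_iff_bounded_le[of "k ` J"] assms(1) by auto
  have "seq_map C f n N (a j) = \<zero>\<^bsub>C (n + N)\<^esub>" if j: "j \<in> J" for j
    using seq_map_zero_mono[OF assms(2)[OF j] k[OF j] N[OF j]] .
  then show ?thesis by metis
qed

text \<open>Injectivity of the comparison map from the colimit of Hom(X, C n) to Hom(X, M). Finitely
  many generators die at one common stage, and the kernel of the map to that stage is
  closed.\<close>

lemma finitely_generated_vanish:
  assumes X: "right_module R X" "finitely_generated R X" and g: "g \<in> mod_hom R X (C n)"
    and 0: "\<And>x. x \<in> carrier X \<Longrightarrow> c n (g x) = \<zero>\<^bsub>M\<^esub>"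
  shows "\<exists>k. \<forall>x\<in>carrier X. seq_map C f n k (g x) = \<zero>\<^bsub>C (n + k)\<^esub>"
proof -
  obtain G where G: "finite G" "G \<subseteq> carrier X" "\<And>S. module_closed R X S \<Longrightarrow> G \<subseteq> S \<Longrightarrow> S = carrier X"
    using X(2) unfolding finitely_generated_def by metis
  obtain k where k: "\<And>x. x \<in> G \<Longrightarrow> seq_map C f n k (g x) = \<zero>\<^bsub>C (n + k)\<^esub>"
    using vanish_finite[of G g n] G(1,2) mod_hom_closed[OF g] 0 by (metis subsetD)
  have h: "compose (carrier X) (seq_map C f n k) g \<in> mod_hom R X (C (n + k))"
    by (rule mod_hom_comp[OF X(1) g seq_map_hom])
  interpret h: module_hom R X "C (n + k)" "compose (carrier X) (seq_map C f n k) g"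
    by (intro module_homI X C h)
  have eq: "{x \<in> carrier X. compose (carrier X) (seq_map C f n k) g x = \<zero>\<^bsub>C (n + k)\<^esub>} = carrier X"
    using G(2) k by (intro G(3) h.kernel_closed) (auto simp: compose_def)
  have "seq_map C f n k (g x) = \<zero>\<^bsub>C (n + k)\<^esub>" if x: "x \<in> carrier X" for x
  proof -
    have "x \<in> {x \<in> carrier X. compose (carrier X) (seq_map C f n k) g x = \<zero>\<^bsub>C (n + k)\<^esub>}"
      unfolding eq by (rule x)
    then show ?thesis using x by (simp add: compose_eq)
  qed
  then show ?thesis by metis
qed

text \<open>Surjectivity of the same comparison map. Finitely many generators are lifted to one
  stage \<open>n\<close>; the finitely many relations hold in \<open>M\<close>, hence hold after
  \<open>k\<close> further steps, and there the map on the free module descends to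
  \<open>X\<close>.\<close>

lemma finitely_presented_factor:
  assumes X: "finitely_presented R X" and g: "g \<in> mod_hom R X M"
  shows "\<exists>n. \<exists>h\<in>mod_hom R X (C n). \<forall>x\<in>carrier X. c n (h x) = g x"
proof -
  have Xm: "right_module R X" using X by (simp add: finitely_presented_def)
  obtain I J :: "nat set" and p q where fin: "finite I" "finite J"
    and q: "q \<in> mod_hom R (free_module R J) (free_module R I)" and p: "p \<in> mod_hom R (free_module R I) X"
    and ker: "q ` carrier (free_module R J) = {u \<in> carrier (free_module R I). p u = \<zero>\<^bsub>X\<^esub>}"
    and onto: "p ` carrier (free_module R I) = carrier X"
    by (rule finitely_presentedE[OF X])
  let ?I = "free_module R I" and ?J = "free_module R J"
  note FI = M.R.right_module_free[of I] and FJ = M.R.right_module_free[of J]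
  have bas: "free_basis R I i \<in> carrier ?I" "free_basis R J i \<in> carrier ?J" for i
    by (rule M.R.free_basis_closed)+
  obtain n a where a: "\<And>i. i \<in> I \<Longrightarrow> a i \<in> carrier (C n)"
    "\<And>i. i \<in> I \<Longrightarrow> c n (a i) = g (p (free_basis R I i))"
    using c_onto_finite[OF fin(1), of "\<lambda>i. g (p (free_basis R I i))"]
      mod_hom_closed[OF g mod_hom_closed[OF p bas(1)]] by metis
  obtain h where h: "h \<in> mod_hom R ?I (C n)" "\<And>i. i \<in> I \<Longrightarrow> h (free_basis R I i) = a i"
    using linear_combination_hom[OF C, of I a n] a(1) by metis
  have "compose (carrier ?I) (c n) h = compose (carrier ?I) g p"
    by (rule M.R.free_hom_eqI[OF M.right_module_axioms mod_hom_comp[OF FI h(1) c] mod_hom_comp[OF FI p g]])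
      (simp add: compose_eq[OF bas(1)] h a)
  then have ch: "c n (h u) = g (p u)" if "u \<in> carrier ?I" for u
    using that by (metis compose_eq)
  interpret g: module_hom R X M g by (intro module_homI Xm M.right_module_axioms g)
  have qz: "c n (h (q (free_basis R J j))) = \<zero>\<^bsub>M\<^esub>" for j
  proof -
    have "q (free_basis R J j) \<in> q ` carrier ?J" by (rule imageI) (rule bas)
    then have "q (free_basis R J j) \<in> carrier ?I" "p (q (free_basis R J j)) = \<zero>\<^bsub>X\<^esub>"
      unfolding ker by simp_all
    then show ?thesis using ch by simp
  qed
  obtain k where k: "\<And>j. j \<in> J \<Longrightarrow> seq_map C f n k (h (q (free_basis R J j))) = \<zero>\<^bsub>C (n + k)\<^esub>"
    using vanish_finite[OF fin(2), of "\<lambda>j. h (q (free_basis R J j))" n] qz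
      mod_hom_closed[OF h(1) mod_hom_closed[OF q bas(2)]] by metis
  define h' where "h' = compose (carrier ?I) (seq_map C f n k) h"
  have h': "h' \<in> mod_hom R ?I (C (n + k))" unfolding h'_def by (rule mod_hom_comp[OF FI h(1) seq_map_hom])
  have h'_eq: "h' u = seq_map C f n k (h u)" if "u \<in> carrier ?I" for u
    using that by (simp add: h'_def compose_eq)
  have "compose (carrier ?J) h' q = (\<lambda>v\<in>carrier ?J. \<zero>\<^bsub>C (n + k)\<^esub>)"
    by (rule M.R.free_hom_eqI[OF C mod_hom_comp[OF FJ q h'] mod_hom_zero[OF FJ C]])
      (simp add: compose_eq[OF bas(2)] bas h'_eq mod_hom_closed[OF q bas(2)] k)
  then have h'q: "h' (q v) = \<zero>\<^bsub>C (n + k)\<^esub>" if "v \<in> carrier ?J" for v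
    using that by (metis compose_eq restrict_apply')
  have "h' u = \<zero>\<^bsub>C (n + k)\<^esub>" if "u \<in> carrier ?I" "p u = \<zero>\<^bsub>X\<^esub>" for u
  proof -
    have "u \<in> q ` carrier ?J" unfolding ker using that by simp
    then show ?thesis using h'q by auto
  qed
  then obtain t where t: "t \<in> mod_hom R X (C (n + k))" "\<And>u. u \<in> carrier ?I \<Longrightarrow> t (p u) = h' u"
    using mod_hom_descend[OF FI Xm C p h' onto] by metis
  have "c (n + k) (t x) = g x" if "x \<in> carrier X" for x
  proof -
    have "x \<in> p ` carrier ?I" unfolding onto by (rule that)
    then obtain u where u: "u \<in> carrier ?I" "x = p u" by (metis imageE)
    then show ?thesis
      using t(2)[OF u(1)] h'_eq[OF u(1)] c_seq_map[OF mod_hom_closed[OF h(1) u(1)]] ch[OF u(1)] by simp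
  qed
  then show ?thesis using t(1) by metis
qed

section \<open>The inverse system of homomorphism groups\<close>

lemma inverse_sequence_Hom:
  assumes B: "right_module R B"
  shows "inverse_sequence (\<lambda>n. Hom_group R (C n) B) (\<lambda>n g. compose (carrier (C n)) g (f n))"
proof (rule inverse_sequence.intro)
  show "comm_group (Hom_group R (C n) B)" for n by (rule comm_group_Hom[OF C B])
  show "(\<lambda>g. compose (carrier (C n)) g (f n)) \<in> hom (Hom_group R (C (Suc n)) B) (Hom_group R (C n) B)" for n
    using mod_hom_comp[OF C f] by (auto simp: hom_def Hom_group_def) (auto simp: compose_def intro!: restrict_ext)
qed

lemma inv_map_Hom:
  assumes "g \<in> mod_hom R (C (n + k)) B"
  shows "inv_map (\<lambda>n g. compose (carrier (C n)) g (f n)) n k g = compose (carrier (C n)) g (seq_map C f n k)"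
  using assms
proof (induction k arbitrary: g)
  case 0
  show ?case using mod_hom_extensional[OF 0] by (auto simp: compose_def extensional_def fun_eq_iff)
next
  case (Suc k)
  have "compose (carrier (C (n + k))) g (f (n + k)) \<in> mod_hom R (C (n + k)) B"
    using mod_hom_comp[OF C f, of g "n + k"] Suc.prems by simp
  from Suc.IH[OF this] show ?case
    by (auto simp: compose_def seq_map_closed seq_map_Suc intro!: restrict_ext)
qed

text \<open>The classical argument of Bazzoni and Herbera: a non-stabilising chain of images at \<open>n\<close> would
  produce a map into a countable direct sum of copies of \<open>B\<close> with infinitely many nonzero components
  on the finitely generated module \<open>C n\<close>.\<close>

lemma Mittag_Leffler_Hom:
  fixes B :: "('r, 'b) module"
  assumes B: "right_module R B" and E: "Ext1_vanishes R M (direct_sum UNIV (\<lambda>_::nat. B))"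
    and fg: "\<And>n. finitely_generated R (C n)"
  shows "Mittag_Leffler (\<lambda>n. Hom_group R (C n) B) (\<lambda>n g. compose (carrier (C n)) g (f n))"
proof -
  let ?H = "\<lambda>n. Hom_group R (C n) B" and ?h = "\<lambda>n (g :: 'm \<Rightarrow> 'b). compose (carrier (C n)) g (f n)"
  interpret H: inverse_sequence ?H ?h by (rule inverse_sequence_Hom[OF B])
  interpret B: right_module R B by (rule B)
  define iv where "iv = inv_map ?h"
  define im where "im n k = iv n k ` carrier (?H (n + k))" for n k
  have stab: "\<exists>k0. \<forall>k\<ge>k0. im n k = im n k0" for n
  proof (rule ccontr)
    assume neg: "\<not> ?thesis"
    \<comment> \<open>If the chain never stabilises, then for every \<open>j\<close> some map
      \<open>a\<close> gives an element of the image at \<open>j\<close> that is missing from a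
      later image, the one at \<open>k\<close>.\<close>
    have "\<exists>a k. a \<in> mod_hom R (C (n + j)) B \<and> k > j \<and> iv n j a \<notin> im n k" for j
    proof -
      obtain k where k: "k \<ge> j" "im n k \<noteq> im n j" using neg by metis
      then have "im n k \<subset> im n j" using H.inv_map_image_antimono[OF k(1), of n] by (simp add: im_def iv_def psubset_eq)
      then obtain z where z: "z \<in> im n j" "z \<notin> im n k" by (meson psubset_imp_ex_mem DiffE)
      from z(1) obtain a where "a \<in> carrier (?H (n + j))" "z = iv n j a"
        unfolding im_def by (elim imageE) (rule that)
      then have "a \<in> carrier (?H (n + j))" "iv n j a \<notin> im n k" using z by simp_all
      moreover have "k \<noteq> j" using k(2) by auto
      ultimately show ?thesis using k(1) by (intro exI[of _ a] exI[of _ k]) (auto simp: Hom_group_def)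
    qed
    then obtain a k where a: "\<And>j. a j \<in> mod_hom R (C (n + j)) B" and k: "\<And>j. k j > j"
      and nin: "\<And>j. iv n j (a j) \<notin> im n (k j)" by metis
    let ?Y = "direct_sum UNIV (\<lambda>_::nat. B)"
    have Y: "right_module R ?Y" by (rule right_module_direct_sum) (simp_all add: B ring)
    have Yc: "carrier ?Y = {x. (\<forall>i. x i \<in> carrier B) \<and> finite {i. x i \<noteq> \<zero>\<^bsub>B\<^esub>}}"
      and Ya: "\<And>x y. x \<oplus>\<^bsub>?Y\<^esub> y = (\<lambda>i. x i \<oplus>\<^bsub>B\<^esub> y i)"
      and Ys: "\<And>a x. a \<odot>\<^bsub>?Y\<^esub> x = (\<lambda>i. a \<odot>\<^bsub>B\<^esub> x i)"
      and Y0: "\<zero>\<^bsub>?Y\<^esub> = (\<lambda>i. \<zero>\<^bsub>B\<^esub>)"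
      by (auto simp: direct_sum_def PiE_UNIV_domain)
    \<comment> \<open>The chosen maps are placed in different coordinates: \<open>a j\<close> sits
      at stage \<open>n + j\<close> and coordinate \<open>j\<close>. Each \<open>y i\<close> has at
      most one nonzero coordinate, \<open>i - n\<close>, so it takes values in the direct
      sum.\<close>
    define y where "y i = (\<lambda>x\<in>carrier (C i). \<lambda>j. if i = n + j then a j x else \<zero>\<^bsub>B\<^esub>)" for i
    have y: "y i \<in> mod_hom R (C i) ?Y" for i
      unfolding y_def
    proof (rule mod_hom_restrictI[OF C])
      fix x assume x: "x \<in> carrier (C i)"
      have "{j. (if i = n + j then a j x else \<zero>\<^bsub>B\<^esub>) \<noteq> \<zero>\<^bsub>B\<^esub>} \<subseteq> {i - n}" by auto
      then have "finite {j. (if i = n + j then a j x else \<zero>\<^bsub>B\<^esub>) \<noteq> \<zero>\<^bsub>B\<^esub>}" by (rule finite_subset) simp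
      then show "(\<lambda>j. if i = n + j then a j x else \<zero>\<^bsub>B\<^esub>) \<in> carrier ?Y"
        using x mod_hom_closed[OF a] by (auto simp: Yc)
    next
      fix x x' assume x: "x \<in> carrier (C i)" "x' \<in> carrier (C i)"
      show "(\<lambda>j. if i = n + j then a j (x \<oplus>\<^bsub>C i\<^esub> x') else \<zero>\<^bsub>B\<^esub>) =
          (\<lambda>j. if i = n + j then a j x else \<zero>\<^bsub>B\<^esub>) \<oplus>\<^bsub>?Y\<^esub> (\<lambda>j. if i = n + j then a j x' else \<zero>\<^bsub>B\<^esub>)"
        using x mod_hom_add[OF a] by (auto simp: Ya fun_eq_iff)
    next
      fix r x assume x: "x \<in> carrier (C i)" "r \<in> carrier R"
      show "(\<lambda>j. if i = n + j then a j (r \<odot>\<^bsub>C i\<^esub> x) else \<zero>\<^bsub>B\<^esub>) =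
          r \<odot>\<^bsub>?Y\<^esub> (\<lambda>j. if i = n + j then a j x else \<zero>\<^bsub>B\<^esub>)"
        using x mod_hom_smult[OF a] by (auto simp: Ys B.smult_r_null fun_eq_iff)
    qed
    obtain x where x: "\<And>n. x n \<in> mod_hom R (C n) ?Y"
      "\<And>n b. b \<in> carrier (C n) \<Longrightarrow> x n b = x (Suc n) (f n b) \<oplus>\<^bsub>?Y\<^esub> y n b"
      using Ext1_vanishes_telescope[OF Y E y] by metis
    have xB: "x m b j \<in> carrier B" if "b \<in> carrier (C m)" for m b j
      using mod_hom_closed[OF x(1) that] by (simp add: Yc)
    \<comment> \<open>The equation for \<open>x\<close> is iterated \<open>l\<close> times. In
      coordinate \<open>j\<close> only step \<open>j\<close> contributes, since
      \<open>y (n + i)\<close> is concentrated in coordinate \<open>i\<close>.\<close>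
    have tel: "x n b j = x (n + l) (seq_map C f n l b) j
        \<oplus>\<^bsub>B\<^esub> (if j < l then a j (seq_map C f n j b) else \<zero>\<^bsub>B\<^esub>)" if b: "b \<in> carrier (C n)" for b j l
    proof (induction l)
      case 0
      then show ?case using b seq_map_0[OF b] xB[OF b] by simp
    next
      case (Suc l)
      let ?s = "seq_map C f n l b"
      have s: "?s \<in> carrier (C (n + l))" by (rule seq_map_closed[OF b])
      have "x (n + l) ?s j = x (n + Suc l) (seq_map C f n (Suc l) b) j \<oplus>\<^bsub>B\<^esub> y (n + l) ?s j"
        using x(2)[OF s] seq_map_Suc[OF b, of l] by (simp add: Ya)
      moreover have "y (n + l) ?s j = (if j = l then a j ?s else \<zero>\<^bsub>B\<^esub>)"
        using s by (simp add: y_def)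
      moreover have "x (n + Suc l) (seq_map C f n (Suc l) b) j \<in> carrier B"
        by (rule xB[OF seq_map_closed[OF b]])
      moreover have "a j (seq_map C f n j b) \<in> carrier B"
        by (rule mod_hom_closed[OF a seq_map_closed[OF b]])
      ultimately show ?case using Suc by (cases "j < l"; cases "j = l") auto
    qed
    \<comment> \<open>Finite generation meets finite support: the images of finitely many generators
      involve finitely many coordinates, so some coordinate \<open>j\<close> remains in which
      \<open>x n\<close> vanishes.\<close>
    have "\<exists>j. \<forall>b\<in>carrier (C n). x n b j = \<zero>\<^bsub>B\<^esub>"
    proof -
      obtain G where G: "finite G" "G \<subseteq> carrier (C n)"
        "\<And>S. module_closed R (C n) S \<Longrightarrow> G \<subseteq> S \<Longrightarrow> S = carrier (C n)"
        using fg[of n] unfolding finitely_generated_def by metis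
      have "finite (\<Union>b\<in>G. {i. x n b i \<noteq> \<zero>\<^bsub>B\<^esub>})"
        using G(1,2) mod_hom_closed[OF x(1)[of n]] by (auto simp: Yc)
      then obtain j where j: "j \<notin> (\<Union>b\<in>G. {i. x n b i \<noteq> \<zero>\<^bsub>B\<^esub>})"
        using ex_new_if_finite infinite_UNIV_nat by metis
      have "{b \<in> carrier (C n). x n b j = \<zero>\<^bsub>B\<^esub>} = carrier (C n)"
      proof (rule G(3)[OF module_closedI])
        interpret xn: module_hom R "C n" ?Y "x n" by (intro module_homI C Y x)
        show "\<zero>\<^bsub>C n\<^esub> \<in> {b \<in> carrier (C n). x n b j = \<zero>\<^bsub>B\<^esub>}" using xn.zero by (simp add: Y0)
        show "G \<subseteq> {b \<in> carrier (C n). x n b j = \<zero>\<^bsub>B\<^esub>}" using j G(2) by auto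
        show "b \<oplus>\<^bsub>C n\<^esub> b' \<in> {b \<in> carrier (C n). x n b j = \<zero>\<^bsub>B\<^esub>}"
          if "b \<in> {b \<in> carrier (C n). x n b j = \<zero>\<^bsub>B\<^esub>}" "b' \<in> {b \<in> carrier (C n). x n b j = \<zero>\<^bsub>B\<^esub>}" for b b'
          using that xn.add[of b b'] by (simp add: Ya)
        show "r \<odot>\<^bsub>C n\<^esub> b \<in> {b \<in> carrier (C n). x n b j = \<zero>\<^bsub>B\<^esub>}"
          if "r \<in> carrier R" "b \<in> {b \<in> carrier (C n). x n b j = \<zero>\<^bsub>B\<^esub>}" for r b
          using that xn.smult[of r b] by (simp add: Ys B.smult_r_null)
      qed auto
      then show ?thesis by auto
    qed
    then obtain j where j: "\<And>b. b \<in> carrier (C n) \<Longrightarrow> x n b j = \<zero>\<^bsub>B\<^esub>" by metis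
    \<comment> \<open>Since \<open>x n\<close> vanishes in coordinate \<open>j\<close>, the
      telescoped equation says that \<open>a j\<close> pulled back to \<open>C n\<close> is minus
      coordinate \<open>j\<close> of \<open>x (n + k j)\<close> pulled back to \<open>C n\<close>.
      It therefore lies in the image excluded by the choice of \<open>k j\<close>.\<close>
    define z where "z = (\<lambda>b\<in>carrier (C (n + k j)). \<ominus>\<^bsub>B\<^esub> x (n + k j) b j)"
    have z: "z \<in> mod_hom R (C (n + k j)) B"
      unfolding z_def
    proof (rule mod_hom_restrictI[OF C])
      interpret xn: module_hom R "C (n + k j)" ?Y "x (n + k j)" by (intro module_homI C Y x)
      show "\<ominus>\<^bsub>B\<^esub> x (n + k j) b j \<in> carrier B" if "b \<in> carrier (C (n + k j))" for b
        using xB[OF that] by simp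
      show "\<ominus>\<^bsub>B\<^esub> x (n + k j) (b \<oplus>\<^bsub>C (n + k j)\<^esub> b') j = \<ominus>\<^bsub>B\<^esub> x (n + k j) b j \<oplus>\<^bsub>B\<^esub> \<ominus>\<^bsub>B\<^esub> x (n + k j) b' j"
        if "b \<in> carrier (C (n + k j))" "b' \<in> carrier (C (n + k j))" for b b'
        using that xn.add[of b b'] xB by (simp add: Ya B.minus_add)
      show "\<ominus>\<^bsub>B\<^esub> x (n + k j) (r \<odot>\<^bsub>C (n + k j)\<^esub> b) j = r \<odot>\<^bsub>B\<^esub> (\<ominus>\<^bsub>B\<^esub> x (n + k j) b j)"
        if "r \<in> carrier R" "b \<in> carrier (C (n + k j))" for r b
        using that xn.smult[of r b] xB[OF that(2), of j] B.smult_r_diff[of r "\<zero>\<^bsub>B\<^esub>" "x (n + k j) b j"]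
        by (simp add: Ys B.smult_r_null B.minus_eq B.ract_closed)
    qed
    have "iv n j (a j) = iv n (k j) z"
      unfolding iv_def inv_map_Hom[OF a] inv_map_Hom[OF z]
    proof (rule extensionalityI[of _ "carrier (C n)"])
      fix b assume b: "b \<in> carrier (C n)"
      have s: "seq_map C f n (k j) b \<in> carrier (C (n + k j))" by (rule seq_map_closed[OF b])
      have as: "a j (seq_map C f n j b) \<in> carrier B" by (rule mod_hom_closed[OF a seq_map_closed[OF b]])
      have "\<zero>\<^bsub>B\<^esub> = x (n + k j) (seq_map C f n (k j) b) j \<oplus>\<^bsub>B\<^esub> a j (seq_map C f n j b)"
        using tel[OF b, of j "k j"] j[OF b] k[of j] by simp
      then have "a j (seq_map C f n j b) = \<ominus>\<^bsub>B\<^esub> x (n + k j) (seq_map C f n (k j) b) j"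
        using xB[OF s, of j] as by (metis B.a_comm B.minus_equality)
      then show "compose (carrier (C n)) (a j) (seq_map C f n j) b
          = compose (carrier (C n)) z (seq_map C f n (k j)) b"
        using b s by (simp add: compose_eq z_def)
    qed simp_all
    moreover have "iv n (k j) z \<in> im n (k j)"
      unfolding im_def by (rule imageI) (simp add: Hom_group_def z)
    ultimately show False using nin[of j] by simp
  qed
  show ?thesis unfolding Mittag_Leffler_def using H.H H.h stab[unfolded im_def iv_def] by (intro conjI allI)
qed

end

section \<open>Sequence limits\<close>

lemma (in module_sequence) cocone_seq_iff:
  "cocone R UNIV {(i, j). i \<le> j} C (\<lambda>i j. seq_map C f i (j - i)) N d \<longleftrightarrow>
     (\<forall>n. d n \<in> mod_hom R (C n) N) \<and> (\<forall>n. \<forall>x\<in>carrier (C n). d (Suc n) (f n x) = d n x)" (is "?l \<longleftrightarrow> ?r")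
proof
  assume l: ?l
  have "d (Suc n) (f n x) = d n x" if x: "x \<in> carrier (C n)" for n x
  proof -
    have "compose (carrier (C i)) (d j) (seq_map C f i (j - i)) = d i" if "i \<le> j" for i j
      using l that unfolding cocone_def by auto
    from this[of n "Suc n"] have "compose (carrier (C n)) (d (Suc n)) (seq_map C f n (Suc 0)) x = d n x"
      by (simp del: seq_map.simps)
    then show ?thesis using x seq_map_Suc[OF x, of 0] seq_map_0[OF x] by (simp add: compose_eq del: seq_map.simps)
  qed
  then show ?r using l unfolding cocone_def by auto
next
  assume r: ?r
  have "d (n + k) (seq_map C f n k x) = d n x" if x: "x \<in> carrier (C n)" for n k x
  proof (induction k)
    case 0
    show ?case using seq_map_0[OF x] by simp
  next
    case (Suc k)
    then show ?case using r seq_map_Suc[OF x, of k] seq_map_closed[OF x, of k] by simp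
  qed
  then have "compose (carrier (C i)) (d j) (seq_map C f i (j - i)) = d i" if "i \<le> j" for i j
    using r that by (intro mod_hom_eqI[OF mod_hom_comp[OF C seq_map_hom], of _ "i" "j - i" N])
      (auto simp: compose_eq, metis le_add_diff_inverse)
  then show ?l unfolding cocone_def using r by auto
qed

text \<open>Reduces the direct limit over the ordered naturals to consecutive maps and pointwise
  equations. Extensionality of homomorphisms allows equality of composites to be tested on elements;
  when the conditions on \<open>f\<close>, \<open>C\<close> and \<open>L\<close> fail, both sides
  are false.\<close>

lemma is_sequence_limit_iff:
  "is_sequence_limit R \<U> C f L \<longleftrightarrow>
     (\<forall>n. f n \<in> mod_hom R (C n) (C (Suc n))) \<and> (\<forall>n. C n \<in> Rmod R \<U>) \<and> L \<in> Rmod R \<U> \<and>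
     (\<exists>c. (\<forall>n. c n \<in> mod_hom R (C n) L) \<and> (\<forall>n. \<forall>x\<in>carrier (C n). c (Suc n) (f n x) = c n x) \<and>
        (\<forall>N\<in>Rmod R \<U>. \<forall>d. (\<forall>n. d n \<in> mod_hom R (C n) N) \<and>
           (\<forall>n. \<forall>x\<in>carrier (C n). d (Suc n) (f n x) = d n x) \<longrightarrow>
           (\<exists>!h. h \<in> mod_hom R L N \<and> (\<forall>n. \<forall>x\<in>carrier (C n). h (c n x) = d n x))))"
proof (cases "(\<forall>n. f n \<in> mod_hom R (C n) (C (Suc n))) \<and> (\<forall>n. C n \<in> Rmod R \<U>) \<and> L \<in> Rmod R \<U>")
  case True
  interpret module_sequence R C f
    by (rule module_sequence.intro) (use True in \<open>auto simp: Rmod_def\<close>)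
  let ?r = "{(i, j). i \<le> j} :: nat rel" and ?\<phi> = "\<lambda>i j. seq_map C f i (j - i)"
  have "seq_map C f i (j - i) \<in> mod_hom R (C i) (C j)" if "i \<le> j" for i j
    using seq_map_hom[of i "j - i"] that by simp
  moreover have "compose (carrier (C i)) (?\<phi> j k) (?\<phi> i j) = ?\<phi> i k" if "i \<le> j" "j \<le> k" for i j k
  proof (rule extensionalityI[of _ "carrier (C i)"])
    show "?\<phi> i k \<in> extensional (carrier (C i))" by (rule mod_hom_extensional[OF seq_map_hom])
    show "compose (carrier (C i)) (?\<phi> j k) (?\<phi> i j) x = ?\<phi> i k x" if "x \<in> carrier (C i)" for x
      using seq_map_add[OF that, of "j - i" "k - j"] that \<open>i \<le> j\<close> \<open>j \<le> k\<close> by (simp add: compose_eq)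
  qed simp
  moreover have "partial_order_on UNIV ?r"
    by (auto simp: partial_order_on_def preorder_on_def refl_on_def trans_def antisym_def)
  moreover have "\<exists>k. i \<le> k \<and> j \<le> k" for i j :: nat by (metis max.cobounded1 max.cobounded2)
  ultimately have ds: "direct_system R UNIV ?r C ?\<phi>"
    unfolding direct_system_def by auto
  have eq: "compose (carrier (C i)) h (c i) = d i \<longleftrightarrow> (\<forall>x\<in>carrier (C i). h (c i x) = d i x)"
    if "d i \<in> mod_hom R (C i) N" for h c d i N
  proof
    show "\<forall>x\<in>carrier (C i). h (c i x) = d i x" if "compose (carrier (C i)) h (c i) = d i"
      using that by (metis compose_eq)
    show "compose (carrier (C i)) h (c i) = d i" if "\<forall>x\<in>carrier (C i). h (c i x) = d i x"
      using that mod_hom_extensional[OF \<open>d i \<in> mod_hom R (C i) N\<close>]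
      by (intro extensionalityI[of _ "carrier (C i)"]) (auto simp: compose_eq)
  qed
  have "(\<exists>!h. h \<in> mod_hom R L N \<and> (\<forall>i\<in>UNIV. compose (carrier (C i)) h (c i) = d i)) \<longleftrightarrow>
      (\<exists>!h. h \<in> mod_hom R L N \<and> (\<forall>n. \<forall>x\<in>carrier (C n). h (c n x) = d n x))"
    if "\<forall>n. d n \<in> mod_hom R (C n) N" for c d N
  proof -
    have "(\<forall>i\<in>UNIV. compose (carrier (C i)) h (c i) = d i) \<longleftrightarrow>
        (\<forall>n. \<forall>x\<in>carrier (C n). h (c n x) = d n x)" for h
      using eq[of d _ N h c] that by simp
    then show ?thesis by simp
  qed
  note U = this
  have "(\<forall>N\<in>Rmod R \<U>. \<forall>d. cocone R UNIV ?r C ?\<phi> N d \<longrightarrow>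
           (\<exists>!h. h \<in> mod_hom R L N \<and> (\<forall>i\<in>UNIV. compose (carrier (C i)) h (c i) = d i))) \<longleftrightarrow>
      (\<forall>N\<in>Rmod R \<U>. \<forall>d. (\<forall>n. d n \<in> mod_hom R (C n) N) \<and>
           (\<forall>n. \<forall>x\<in>carrier (C n). d (Suc n) (f n x) = d n x) \<longrightarrow>
           (\<exists>!h. h \<in> mod_hom R L N \<and> (\<forall>n. \<forall>x\<in>carrier (C n). h (c n x) = d n x)))" for c
    unfolding cocone_seq_iff by (intro ball_cong refl iff_allI imp_cong; rule U; elim conjE)
  then show ?thesis
    unfolding is_sequence_limit_def is_direct_limit_def
    using True ds by (simp add: cocone_seq_iff conj_assoc)
qed (auto simp: is_sequence_limit_def is_direct_limit_def)

text \<open>Uniqueness of the mediating map holds because every element of the limit comes from a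
  stage.\<close>

lemma sequence_colimit_imp_limit:
  assumes "\<And>n. C n \<in> Rmod R \<U>" "M' \<in> Rmod R \<U>" "sequence_colimit R C f M' c'"
  shows "is_sequence_limit R \<U> C f M'"
proof -
  interpret M': sequence_colimit R C f M' c' by fact
  show ?thesis
    unfolding is_sequence_limit_iff
  proof (intro conjI allI exI[of _ c'] ballI impI)
    fix N d
    assume N: "N \<in> Rmod R \<U>" and d: "(\<forall>n. d n \<in> mod_hom R (C n) N) \<and>
      (\<forall>n. \<forall>x\<in>carrier (C n). d (Suc n) (f n x) = d n x)"
    have N': "right_module R N" using N by (simp add: Rmod_def)
    obtain h where h: "h \<in> mod_hom R M' N" "\<And>n x. x \<in> carrier (C n) \<Longrightarrow> h (c' n x) = d n x"
      using M'.universal[OF N', of d] d by metis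
    show "\<exists>!h. h \<in> mod_hom R M' N \<and> (\<forall>n. \<forall>x\<in>carrier (C n). h (c' n x) = d n x)"
    proof (rule ex1I[of _ h])
      fix h' assume h': "h' \<in> mod_hom R M' N \<and> (\<forall>n. \<forall>x\<in>carrier (C n). h' (c' n x) = d n x)"
      show "h' = h"
      proof (rule mod_hom_eqI)
        show "h' y = h y" if "y \<in> carrier M'" for y using M'.c_onto[OF that] h h' by metis
      qed (use h h' in auto)
    qed (use h in auto)
  qed (use assms M'.c M'.c_f M'.f in auto)
qed

section \<open>Small sets\<close>

text \<open>Members of \<open>\<U>\<close> are subsets of one type. A set of any type counts as
  small when it embeds into a member, which is what copying a module into the universe
  requires.\<close>

definition small_set :: "'m set set \<Rightarrow> 'x set \<Rightarrow> bool" where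
  "small_set \<U> X \<longleftrightarrow> (\<exists>S\<in>\<U>. X \<lesssim> S)"

text \<open>A finitely supported family is recovered from its graph over the support, which is a
  finite set of index-value pairs.\<close>

lemma direct_sum_lepoll_Fpow:
  "carrier (direct_sum I Y) \<lesssim> Fpow (Sigma I (\<lambda>i. carrier (Y i)))"
proof -
  define g where "g u = (\<lambda>i. (i, u i)) ` {i \<in> I. u i \<noteq> \<zero>\<^bsub>Y i\<^esub>}" for u
  have "inj_on g (carrier (direct_sum I Y))"
  proof (rule inj_onI)
    fix u v assume uv: "u \<in> carrier (direct_sum I Y)" "v \<in> carrier (direct_sum I Y)" "g u = g v"
    have *: "(i, x) \<in> g w \<longleftrightarrow> i \<in> I \<and> x = w i \<and> w i \<noteq> \<zero>\<^bsub>Y i\<^esub>" for i x w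
      by (auto simp: g_def)
    show "u = v"
    proof (rule extensionalityI[of _ I])
      show "u \<in> extensional I" "v \<in> extensional I"
        using uv by (simp_all add: direct_sum_def PiE_iff)
      show "u i = v i" if "i \<in> I" for i
        using *[of i "u i" u] *[of i "v i" v] *[of i "u i" v] *[of i "v i" u] that uv(3) by metis
    qed
  qed
  moreover have "g u \<in> Fpow (Sigma I (\<lambda>i. carrier (Y i)))" if "u \<in> carrier (direct_sum I Y)" for u
    using that by (auto simp: g_def Fpow_def direct_sum_def PiE_iff)
  ultimately show ?thesis unfolding lepoll_def by (intro exI[of _ g]) auto
qed

section \<open>Closure properties of small sets\<close>

locale module_category =
  fixes R :: "('r, 'k) ring_scheme" and \<U> :: "'m set set"
  assumes ring: "ring R" and univ: "module_universe R \<U>"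
begin

lemma U_lepoll: "\<lbrakk>S \<in> \<U>; T \<lesssim> S\<rbrakk> \<Longrightarrow> T \<in> \<U>"
  using univ unfolding module_universe_def by blast

lemma U_UN: "(\<And>n. S n \<in> \<U>) \<Longrightarrow> (\<Union>n::nat. S n) \<in> \<U>"
  using univ unfolding module_universe_def by simp

lemma U_subset: "\<lbrakk>S \<in> \<U>; T \<subseteq> S\<rbrakk> \<Longrightarrow> T \<in> \<U>"
  using U_lepoll subset_imp_lepoll by blast

lemma U_Un:
  assumes "S \<in> \<U>" "T \<in> \<U>"
  shows "S \<union> T \<in> \<U>"
proof -
  have "(\<Union>n::nat. if n = 0 then S else T) \<in> \<U>" using assms by (intro U_UN) simp
  moreover have "(\<Union>n::nat. if n = 0 then S else T) = S \<union> T" by (auto split: if_splits)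
  ultimately show ?thesis by simp
qed

lemma small_U: "S \<in> \<U> \<Longrightarrow> small_set \<U> S"
  unfolding small_set_def by blast

lemma small_lepoll: "\<lbrakk>small_set \<U> X; Y \<lesssim> X\<rbrakk> \<Longrightarrow> small_set \<U> Y"
  unfolding small_set_def using lepoll_trans by blast

lemma small_subset: "\<lbrakk>small_set \<U> X; Y \<subseteq> X\<rbrakk> \<Longrightarrow> small_set \<U> Y"
  using small_lepoll subset_imp_lepoll by blast

lemma small_image: "small_set \<U> X \<Longrightarrow> small_set \<U> (f ` X)"
  using small_lepoll image_lepoll by blast

lemma small_R: "small_set \<U> (carrier R)"
  using univ unfolding module_universe_def small_set_def by blast

lemma small_infinite:
  assumes "small_set \<U> X"
  obtains S where "S \<in> \<U>" "infinite S" "X \<lesssim> S"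
proof -
  obtain S where S: "S \<in> \<U>" "X \<lesssim> S" using assms unfolding small_set_def by blast
  obtain T where T: "T \<in> \<U>" "infinite T" using univ unfolding module_universe_def by blast
  have "X \<lesssim> S \<union> T" using S(2) lepoll_trans subset_imp_lepoll by blast
  then show thesis using that U_Un[OF S(1) T(1)] T(2) by blast
qed

lemma small_countable: "small_set \<U> (X :: nat set)"
proof -
  obtain T where T: "T \<in> \<U>" "infinite T" using univ unfolding module_universe_def by blast
  then have "(UNIV :: nat set) \<lesssim> T" using infinite_le_lepoll by blast
  then have "X \<lesssim> T" using lepoll_trans subset_imp_lepoll subset_UNIV by blast
  then show ?thesis using T unfolding small_set_def by blast
qed

text \<open>Products are not among the closure conditions of the universe. Both factors embed into
  one infinite member, and an infinite set is equipotent with its square.\<close>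

lemma small_Times:
  assumes "small_set \<U> X" "small_set \<U> Y"
  shows "small_set \<U> (X \<times> Y)"
proof -
  obtain S where S: "S \<in> \<U>" "infinite S" "X \<lesssim> S" by (rule small_infinite[OF assms(1)])
  obtain T where T: "T \<in> \<U>" "infinite T" "Y \<lesssim> T" by (rule small_infinite[OF assms(2)])
  have inf: "infinite (S \<union> T)" using S by simp
  have "X \<lesssim> S \<union> T" "Y \<lesssim> S \<union> T" using S(3) T(3) lepoll_trans subset_imp_lepoll by blast+
  then have "X \<times> Y \<lesssim> (S \<union> T) \<times> (S \<union> T)" by (rule times_lepoll_mono)
  also have "\<dots> \<approx> S \<union> T"
    using card_of_Times_same_infinite[OF inf] by (simp add: eqpoll_iff_card_of_ordIso)
  finally show ?thesis using U_Un[OF S(1) T(1)] unfolding small_set_def by blast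
qed

lemma small_Fpow:
  assumes "small_set \<U> X"
  shows "small_set \<U> (Fpow X)"
proof -
  obtain S where S: "S \<in> \<U>" "infinite S" "X \<lesssim> S" by (rule small_infinite[OF assms])
  obtain g where g: "inj_on g X" "g ` X \<subseteq> S" using S(3) unfolding lepoll_def by blast
  have "inj_on (image g) (Fpow X)" by (rule inj_on_image_Fpow[OF g(1)])
  moreover have "image g ` Fpow X \<subseteq> Fpow S" by (rule image_Fpow_mono[OF g(2)])
  ultimately have "Fpow X \<lesssim> Fpow S" unfolding lepoll_def by blast
  also have "\<dots> \<approx> S" by (rule eqpoll_Fpow[OF S(2)])
  finally show ?thesis using S unfolding small_set_def by blast
qed

lemma small_free: "small_set \<U> I \<Longrightarrow> small_set \<U> (carrier (free_module R I))"
  unfolding free_module_def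
  by (rule small_lepoll[OF small_Fpow direct_sum_lepoll_Fpow])
    (simp add: regular_module_def small_Times small_R)

lemma small_direct_sum:
  assumes "\<And>n. carrier (Y n) \<in> \<U>"
  shows "small_set \<U> (carrier (direct_sum (UNIV :: nat set) Y))"
proof (rule small_lepoll[OF small_Fpow direct_sum_lepoll_Fpow])
  have "small_set \<U> ((UNIV :: nat set) \<times> (\<Union>n. carrier (Y n)))"
    using assms by (intro small_Times small_countable small_U U_UN)
  then show "small_set \<U> (Sigma (UNIV :: nat set) (\<lambda>i. carrier (Y i)))"
    by (rule small_subset) auto
qed

text \<open>The passage into the category: the size of the carrier is the only obstacle.\<close>

lemma small_module_copy:
  assumes "right_module R N" "small_set \<U> (carrier N)"
  obtains N' h where "N' \<in> Rmod R \<U>" "h \<in> mod_hom R N N'" "bij_betw h (carrier N) (carrier N')"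
proof -
  obtain S where S: "S \<in> \<U>" "carrier N \<lesssim> S" using assms(2) unfolding small_set_def by blast
  obtain N' h where "right_module R N'" "carrier N' \<subseteq> S" "h \<in> mod_hom R N N'"
    "bij_betw h (carrier N) (carrier N')"
    by (rule module_transfer[OF assms(1) S(2)])
  then show thesis using that U_subset[OF S(1)] unfolding Rmod_def by blast
qed

section \<open>Countably presented modules as sequential colimits\<close>

lemma linear_combination_image:
  assumes N: "right_module R N" and b: "\<And>i. i \<in> I \<Longrightarrow> b i \<in> carrier N"
  shows "i \<in> I \<Longrightarrow> b i \<in> linear_combination N R I b ` carrier (free_module R I)"
    and "\<lbrakk>module_closed R N S; \<And>i. i \<in> I \<Longrightarrow> b i \<in> S\<rbrakk>
      \<Longrightarrow> linear_combination N R I b ` carrier (free_module R I) \<subseteq> S"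
    and "module_closed R N (linear_combination N R I b ` carrier (free_module R I))"
proof -
  interpret R: ring R by (rule ring)
  note l = linear_combination_hom[OF N, of I b, OF b]
  interpret l: module_hom R "free_module R I" N "linear_combination N R I b"
    by (intro module_homI R.right_module_free N l(1))
  show "b i \<in> linear_combination N R I b ` carrier (free_module R I)" if "i \<in> I"
    using l(2)[OF _ that] R.free_basis_closed by (metis image_eqI)
  show "module_closed R N (linear_combination N R I b ` carrier (free_module R I))"
    by (rule l.image_closed)
  assume S: "module_closed R N S" "\<And>i. i \<in> I \<Longrightarrow> b i \<in> S"
  have eq: "{u \<in> carrier (free_module R I). linear_combination N R I b u \<in> S} = carrier (free_module R I)"
    using S(2) l(2) by (intro R.free_span l.vimage_closed[OF S(1)]) (simp add: R.free_basis_closed)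
  have "linear_combination N R I b u \<in> S" if "u \<in> carrier (free_module R I)" for u
  proof -
    have "u \<in> {u \<in> carrier (free_module R I). linear_combination N R I b u \<in> S}"
      unfolding eq by (rule that)
    then show ?thesis by simp
  qed
  then show "linear_combination N R I b ` carrier (free_module R I) \<subseteq> S" by auto
qed

text \<open>Part of a basis is still independent: the inclusion \<open>?j\<close> of the smaller
  free module has restriction of families to \<open>I'\<close> as left inverse, and the map in
  question is \<open>e\<close> after \<open>?j\<close>.\<close>

lemma inj_linear_combination_basis:
  assumes N: "right_module R N" and e: "e \<in> mod_hom R (free_module R I) N" "inj_on e (carrier (free_module R I))"
    and I': "I' \<subseteq> I"
  shows "inj_on (linear_combination N R I' (\<lambda>i. e (free_basis R I i))) (carrier (free_module R I'))"
proof (rule inj_onI)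
  interpret R: ring R by (rule ring)
  let ?l = "linear_combination N R I' (\<lambda>i. e (free_basis R I i))"
  let ?j = "linear_combination (free_module R I) R I' (free_basis R I)"
  let ?r = "\<lambda>u\<in>carrier (free_module R I). restrict u I'"
  have eb: "e (free_basis R I i) \<in> carrier N" for i
    by (rule mod_hom_closed[OF e(1) R.free_basis_closed])
  note l = linear_combination_hom[OF N, of I' "\<lambda>i. e (free_basis R I i)", OF eb]
  note j = linear_combination_hom[OF R.right_module_free, of I' "free_basis R I" I, OF R.free_basis_closed]
  have r: "?r \<in> mod_hom R (free_module R I) (free_module R I')"
  proof (rule mod_hom_restrictI[OF R.right_module_free])
    fix u assume u: "u \<in> carrier (free_module R I)"
    then have fin: "finite {i \<in> I. u i \<noteq> \<zero>\<^bsub>R\<^esub>}" and uR: "\<And>i. i \<in> I \<Longrightarrow> u i \<in> carrier R"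
      by (simp_all add: carrier_free PiE_iff)
    have "finite {i \<in> I'. u i \<noteq> \<zero>\<^bsub>R\<^esub>}" by (rule finite_subset[OF _ fin]) (use I' in blast)
    moreover have "{i \<in> I'. restrict u I' i \<noteq> \<zero>\<^bsub>R\<^esub>} = {i \<in> I'. u i \<noteq> \<zero>\<^bsub>R\<^esub>}" by auto
    ultimately show "restrict u I' \<in> carrier (free_module R I')"
      using uR subsetD[OF I'] by (simp add: carrier_free)
  qed (simp_all add: add_free smult_free subsetD[OF I'] cong: restrict_cong)
  have rj: "?r (?j u) = u" if "u \<in> carrier (free_module R I')" for u
  proof -
    have eq: "compose (carrier (free_module R I')) ?r ?j = (\<lambda>u\<in>carrier (free_module R I'). u)"
    proof (rule R.free_hom_eqI[OF R.right_module_free mod_hom_comp[OF R.right_module_free j(1) r]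
          mod_hom_id[OF R.right_module_free]])
      fix i assume i: "i \<in> I'"
      have "restrict (free_basis R I i) I' = free_basis R I' i"
        using I' by (simp add: free_basis_def Int_absorb1)
      then show "compose (carrier (free_module R I')) ?r ?j (free_basis R I' i)
          = (\<lambda>u\<in>carrier (free_module R I'). u) (free_basis R I' i)"
        using j(2)[OF i] R.free_basis_closed[of I' i] R.free_basis_closed[of I i]
        by (simp add: compose_eq)
    qed
    show ?thesis using fun_cong[OF eq, of u] that by (simp add: compose_eq)
  qed
  have lj: "?l u = e (?j u)" if "u \<in> carrier (free_module R I')" for u
  proof -
    have eq: "?l = compose (carrier (free_module R I')) e ?j"
      by (rule R.free_hom_eqI[OF N l(1) mod_hom_comp[OF R.right_module_free j(1) e(1)]])
        (simp add: compose_eq R.free_basis_closed l(2) j(2))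
    show ?thesis using fun_cong[OF eq, of u] that by (simp add: compose_eq)
  qed
  fix u v assume uv: "u \<in> carrier (free_module R I')" "v \<in> carrier (free_module R I')" "?l u = ?l v"
  then have "?j u = ?j v"
    using inj_onD[OF e(2), of "?j u" "?j v"] lj[OF uv(1)] lj[OF uv(2)] mod_hom_closed[OF j(1)] uv by simp
  then show "u = v" using rj[OF uv(1)] rj[OF uv(2)] by simp
qed

lemma module_closed_UN:
  assumes "\<And>n. module_closed R N (D n)" "\<And>m n. m \<le> n \<Longrightarrow> D m \<subseteq> D n"
  shows "module_closed R N (\<Union>n::nat. D n)"
proof (rule module_closedI)
  show "(\<Union>n. D n) \<subseteq> carrier N" "\<zero>\<^bsub>N\<^esub> \<in> (\<Union>n. D n)"
    using assms(1) unfolding module_closed_def by blast+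
  fix x y assume "x \<in> (\<Union>n. D n)" "y \<in> (\<Union>n. D n)"
  then obtain m n where "x \<in> D m" "y \<in> D n" by blast
  then have "x \<in> D (max m n)" "y \<in> D (max m n)"
    using assms(2)[of m "max m n"] assms(2)[of n "max m n"] by auto
  then show "x \<oplus>\<^bsub>N\<^esub> y \<in> (\<Union>n. D n)" using assms(1) unfolding module_closed_def by blast
next
  fix a x assume "a \<in> carrier R" "x \<in> (\<Union>n. D n)"
  then show "a \<odot>\<^bsub>N\<^esub> x \<in> (\<Union>n. D n)" using assms(1) unfolding module_closed_def by blast
qed

text \<open>The presentation is truncated: \<open>C n\<close> has finitely many of the generators,
  subject to the relations with index below \<open>n\<close>, and enough generators at each stage to
  write these relations down. All submodules are taken inside one small copy \<open>N\<close> of the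
  free module, so every quotient, formed by representatives, is again small.\<close>

lemma countably_presented_colimit:
  assumes "countably_presented R M"
  obtains C :: "nat \<Rightarrow> ('r, 'm) module" and f c where "\<And>n. C n \<in> Rmod R \<U>"
    "\<And>n. finitely_presented R (C n)" "sequence_colimit R C f M c"
proof -
  interpret R: ring R by (rule ring)
  have M: "right_module R M" using assms by (simp add: countably_presented_def)
  obtain I J :: "nat set" and p q where q0: "q \<in> mod_hom R (free_module R J) (free_module R I)"
    and p0: "p \<in> mod_hom R (free_module R I) M"
    and ker0: "q ` carrier (free_module R J) = {u \<in> carrier (free_module R I). p u = \<zero>\<^bsub>M\<^esub>}"
    and onto0: "p ` carrier (free_module R I) = carrier M"
    using assms unfolding countably_presented_def presented_by_def a_kernel_def'
    by (elim exE bexE conjE) (rule that)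
  note Fr = R.right_module_free
  obtain N e where N: "N \<in> Rmod R \<U>" and e: "e \<in> mod_hom R (free_module R I) N"
    and e_bij: "bij_betw e (carrier (free_module R I)) (carrier N)"
    by (rule small_module_copy[OF Fr small_free[OF small_countable]])
  have Nm: "right_module R N" and NU: "carrier N \<in> \<U>" using N by (simp_all add: Rmod_def)
  obtain e' where e': "e' \<in> mod_hom R N (free_module R I)"
    "\<And>u. u \<in> carrier (free_module R I) \<Longrightarrow> e' (e u) = u" "\<And>x. x \<in> carrier N \<Longrightarrow> e (e' x) = x"
    using mod_iso_inverse[OF Fr Nm e e_bij] by metis
  define P where "P = compose (carrier N) p e'"
  have P: "P \<in> mod_hom R N M" unfolding P_def by (rule mod_hom_comp[OF Nm e'(1) p0])
  have P_eq: "P x = p (e' x)" if "x \<in> carrier N" for x using that by (simp add: P_def compose_eq)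
  define b where "b i = e (free_basis R I i)" for i
  define r where "r j = e (q (free_basis R J j))" for j
  have bN: "b i \<in> carrier N" for i unfolding b_def by (rule mod_hom_closed[OF e R.free_basis_closed])
  have rN: "r j \<in> carrier N" for j
    unfolding r_def by (rule mod_hom_closed[OF e mod_hom_closed[OF q0 R.free_basis_closed]])
  define span where "span X v = linear_combination N R X v ` carrier (free_module R X)"
    for X :: "nat set" and v
  have sp_mem: "v i \<in> span X v" if "\<And>i. v i \<in> carrier N" "i \<in> X" for v X i
    using linear_combination_image(1)[OF Nm, of X v i] that by (simp add: span_def)
  have sp_sub: "span X v \<subseteq> S" if "\<And>i. v i \<in> carrier N" "module_closed R N S" "\<And>i. i \<in> X \<Longrightarrow> v i \<in> S" for v X S
    using linear_combination_image(2)[OF Nm, of X v S] that by (simp add: span_def)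
  have sp_cl: "module_closed R N (span X v)" if "\<And>i. v i \<in> carrier N" for v X
    using linear_combination_image(3)[OF Nm, of X v] that by (simp add: span_def)
  have sp_mono: "span X v \<subseteq> span X' v" if "\<And>i. v i \<in> carrier N" "X \<subseteq> X'" for v X X'
    using that by (intro sp_sub sp_cl) (auto intro: sp_mem)
  define T where "T n = span {i \<in> I. i < n} b" for n
  have T_cl: "module_closed R N (T n)" for n unfolding T_def by (rule sp_cl[OF bN])
  have T_mono: "T m \<subseteq> T n" if "m \<le> n" for m n unfolding T_def using that by (intro sp_mono bN) auto
  have T_all: "\<exists>n. x \<in> T n" if x: "x \<in> carrier N" for x
  proof -
    interpret e: module_hom R "free_module R I" N e by (intro module_homI Fr Nm e)
    have cl: "module_closed R N (\<Union>n. T n)" by (rule module_closed_UN[OF T_cl T_mono])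
    have "b i \<in> (\<Union>n. T n)" if "i \<in> I" for i
      using sp_mem[of b i "{i \<in> I. i < Suc i}", OF bN] that unfolding T_def
      by (intro UN_I[of "Suc i"]) (auto intro!: sp_mem bN)
    then have eq: "{u \<in> carrier (free_module R I). e u \<in> (\<Union>n. T n)} = carrier (free_module R I)"
      by (intro R.free_span e.vimage_closed[OF cl]) (simp add: R.free_basis_closed b_def)
    have "e' x \<in> {u \<in> carrier (free_module R I). e u \<in> (\<Union>n. T n)}"
      unfolding eq by (rule mod_hom_closed[OF e'(1) x])
    then show ?thesis using e'(3)[OF x] by auto
  qed
  \<comment> \<open>At stage \<open>\<nu> j\<close> the generators suffice to write the relation
    \<open>r j\<close>. In the definition of \<open>g\<close>, the sum is at least
    \<open>\<nu> j\<close> for all \<open>j < n\<close>, so the relations of stage \<open>n\<close>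
    lie in \<open>D n\<close>; the summand \<open>n\<close> makes every generator appear
    eventually.\<close>
  obtain \<nu> where \<nu>: "\<And>j. r j \<in> T (\<nu> j)" using T_all[OF rN] by metis
  define g where "g n = n + (\<Sum>j<n. \<nu> j)" for n
  have g_mono: "g m \<le> g n" if "m \<le> n" for m n
    unfolding g_def using that by (intro add_mono sum_mono2) auto
  define I' where "I' n = {i \<in> I. i < g n}" for n
  define J' where "J' n = {j \<in> J. j < n}" for n
  define D where "D n = span (I' n) b" for n
  define K where "K n = span (J' n) r" for n
  have D_cl: "module_closed R N (D n)" for n unfolding D_def by (rule sp_cl[OF bN])
  have K_cl: "module_closed R N (K n)" for n unfolding K_def by (rule sp_cl[OF rN])
  have DT: "D n = T (g n)" for n unfolding D_def T_def I'_def ..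
  have D_mono: "D m \<subseteq> D n" if "m \<le> n" for m n unfolding DT by (rule T_mono[OF g_mono[OF that]])
  have K_mono: "K m \<subseteq> K n" if "m \<le> n" for m n unfolding K_def J'_def using that by (intro sp_mono rN) auto
  have KD: "K n \<subseteq> D n" for n
    unfolding K_def
  proof (rule sp_sub[OF rN D_cl])
    fix j assume j: "j \<in> J' n"
    have "\<nu> j \<le> (\<Sum>j<n. \<nu> j)" using j by (intro member_le_sum) (auto simp: J'_def)
    then have "T (\<nu> j) \<subseteq> D n" unfolding DT by (intro T_mono) (simp add: g_def)
    then show "r j \<in> D n" using \<nu> by blast
  qed
  have D_all: "\<exists>n. x \<in> D n" if x: "x \<in> carrier N" for x
  proof -
    obtain n where "x \<in> T n" using T_all[OF x] by blast
    moreover have "T n \<subseteq> D n" unfolding DT by (rule T_mono) (simp add: g_def)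
    ultimately show ?thesis by blast
  qed
  interpret P: module_hom R N M P by (intro module_homI Nm M P)
  have Pr: "P (r j) = \<zero>\<^bsub>M\<^esub>" for j
  proof -
    have "q (free_basis R J j) \<in> q ` carrier (free_module R J)" by (rule imageI[OF R.free_basis_closed])
    then have "q (free_basis R J j) \<in> carrier (free_module R I)" "p (q (free_basis R J j)) = \<zero>\<^bsub>M\<^esub>"
      unfolding ker0 by simp_all
    then show ?thesis using P_eq[OF rN] e'(2) by (simp add: r_def)
  qed
  have PK: "P x = \<zero>\<^bsub>M\<^esub>" if "x \<in> K n" for x n
  proof -
    have "K n \<subseteq> {x \<in> carrier N. P x = \<zero>\<^bsub>M\<^esub>}"
      unfolding K_def by (rule sp_sub[OF rN P.kernel_closed]) (simp add: rN Pr)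
    then show ?thesis using that by blast
  qed
  have K_all: "\<exists>n. x \<in> K n" if x: "x \<in> carrier N" "P x = \<zero>\<^bsub>M\<^esub>" for x
  proof -
    have cl: "module_closed R N (\<Union>n. K n)" by (rule module_closed_UN[OF K_cl K_mono])
    have qe: "compose (carrier (free_module R J)) e q \<in> mod_hom R (free_module R J) N"
      by (rule mod_hom_comp[OF Fr q0 e])
    interpret qe: module_hom R "free_module R J" N "compose (carrier (free_module R J)) e q"
      by (intro module_homI Fr Nm qe)
    have "r j \<in> (\<Union>n. K n)" if "j \<in> J" for j
      unfolding K_def J'_def using that by (intro UN_I[of "Suc j"]) (auto intro!: sp_mem rN)
    then have eq: "{v \<in> carrier (free_module R J). compose (carrier (free_module R J)) e q v \<in> (\<Union>n. K n)}
        = carrier (free_module R J)"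
      by (intro R.free_span qe.vimage_closed[OF cl]) (simp add: R.free_basis_closed r_def compose_eq)
    have "e' x \<in> {u \<in> carrier (free_module R I). p u = \<zero>\<^bsub>M\<^esub>}"
      using x mod_hom_closed[OF e'(1)] P_eq by simp
    then have "e' x \<in> q ` carrier (free_module R J)" unfolding ker0 .
    then obtain v where v: "v \<in> carrier (free_module R J)" "e' x = q v" by (elim imageE) (rule that)
    have "v \<in> {v \<in> carrier (free_module R J). compose (carrier (free_module R J)) e q v \<in> (\<Union>n. K n)}"
      unfolding eq by (rule v)
    then show ?thesis using v e'(3)[OF x(1)] by (auto simp: compose_eq)
  qed
  note Dm = right_module_sub[OF Nm D_cl]
  \<comment> \<open>One predicate for all conditions allows the quotient and its projection to be
    chosen together for every \<open>n\<close>.\<close>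
  define quot where "quot n Q \<pi> \<longleftrightarrow> right_module R Q \<and> carrier Q \<subseteq> D n \<and>
      \<pi> \<in> mod_hom R (N\<lparr>carrier := D n\<rparr>) Q \<and> \<pi> ` D n = carrier Q \<and>
      (\<forall>x\<in>D n. \<pi> x = \<zero>\<^bsub>Q\<^esub> \<longleftrightarrow> x \<in> K n)" for n and Q :: "('r, 'm) module" and \<pi>
  have "\<exists>Q \<pi>. quot n Q \<pi>" for n
  proof -
    have "module_closed R (N\<lparr>carrier := D n\<rparr>) (K n)"
      using K_cl[of n] KD[of n] unfolding module_closed_def by simp
    then obtain Q q where "right_module R Q" "carrier Q \<subseteq> carrier (N\<lparr>carrier := D n\<rparr>)"
      "q \<in> mod_hom R (N\<lparr>carrier := D n\<rparr>) Q" "q ` carrier (N\<lparr>carrier := D n\<rparr>) = carrier Q"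
      "\<And>x. x \<in> carrier (N\<lparr>carrier := D n\<rparr>) \<Longrightarrow> q x = \<zero>\<^bsub>Q\<^esub> \<longleftrightarrow> x \<in> K n"
      by (rule quotient_module_exists[OF Dm]) blast
    then show ?thesis by (intro exI[of _ Q] exI[of _ q]) (simp add: quot_def)
  qed
  then obtain C \<pi> where quot: "\<And>n. quot n (C n) (\<pi> n)" by metis
  have C: "\<And>n. right_module R (C n)" "\<And>n. carrier (C n) \<subseteq> D n"
    and \<pi>: "\<And>n. \<pi> n \<in> mod_hom R (N\<lparr>carrier := D n\<rparr>) (C n)" "\<And>n. \<pi> n ` D n = carrier (C n)"
      "\<And>n x. x \<in> D n \<Longrightarrow> \<pi> n x = \<zero>\<^bsub>C n\<^esub> \<longleftrightarrow> x \<in> K n"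
    using quot unfolding quot_def by blast+
  have D_sub: "D n \<subseteq> carrier N" for n using D_cl[of n] by (simp add: module_closed_def)
  have CU: "C n \<in> Rmod R \<U>" for n
    using C[of n] D_sub[of n] U_subset[OF NU] by (auto simp: Rmod_def)
  have "\<exists>f\<in>mod_hom R (C n) (C (Suc n)). \<forall>x\<in>D n. f (\<pi> n x) = \<pi> (Suc n) x" for n
  proof -
    have sub: "D n \<subseteq> D (Suc n)" "K n \<subseteq> K (Suc n)" by (rule D_mono, simp, rule K_mono, simp)
    have cl: "module_closed R (N\<lparr>carrier := D (Suc n)\<rparr>) (D n)"
      using D_cl[of n] sub(1) unfolding module_closed_def by simp
    have h: "restrict (\<pi> (Suc n)) (D n) \<in> mod_hom R (N\<lparr>carrier := D n\<rparr>) (C (Suc n))"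
      using mod_hom_restrict_sub[OF \<pi>(1) cl] by simp
    have "\<exists>f\<in>mod_hom R (C n) (C (Suc n)). \<forall>x\<in>carrier (N\<lparr>carrier := D n\<rparr>). f (\<pi> n x) = restrict (\<pi> (Suc n)) (D n) x"
      using \<pi>(2,3) subsetD[OF sub(1)] subsetD[OF sub(2)]
      by (intro mod_hom_descend[OF Dm C(1) C(1) \<pi>(1) h]) simp_all
    then show ?thesis by simp
  qed
  then obtain f where f: "\<And>n. f n \<in> mod_hom R (C n) (C (Suc n))"
    "\<And>n x. x \<in> D n \<Longrightarrow> f n (\<pi> n x) = \<pi> (Suc n) x" by metis
  have "\<exists>c\<in>mod_hom R (C n) M. \<forall>x\<in>D n. c (\<pi> n x) = P x" for n
  proof -
    have h: "restrict P (D n) \<in> mod_hom R (N\<lparr>carrier := D n\<rparr>) M"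
      by (rule mod_hom_restrict_sub[OF P D_cl])
    have "\<exists>c\<in>mod_hom R (C n) M. \<forall>x\<in>carrier (N\<lparr>carrier := D n\<rparr>). c (\<pi> n x) = restrict P (D n) x"
      using \<pi>(2,3) PK by (intro mod_hom_descend[OF Dm C(1) M \<pi>(1) h]) simp_all
    then show ?thesis by simp
  qed
  then obtain c where c: "\<And>n. c n \<in> mod_hom R (C n) M" "\<And>n x. x \<in> D n \<Longrightarrow> c n (\<pi> n x) = P x" by metis
  have rep: "\<exists>x\<in>D n. y = \<pi> n x" if "y \<in> carrier (C n)" for n y
    using that unfolding \<pi>(2)[symmetric] by blast
  interpret sq: module_sequence R C f by (rule module_sequence.intro) (rule C f)+
  have \<pi>C: "\<pi> n x \<in> carrier (C n)" if "x \<in> D n" for n x using that unfolding \<pi>(2)[symmetric] by blast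
  have smap: "seq_map C f n k (\<pi> n x) = \<pi> (n + k) x" if x: "x \<in> D n" for n k x
  proof (induction k)
    case 0
    show ?case using sq.seq_map_0[OF \<pi>C[OF x]] by simp
  next
    case (Suc k)
    have "x \<in> D (n + k)" using D_mono[of n "n + k"] x by auto
    then show ?case using Suc sq.seq_map_Suc[OF \<pi>C[OF x], of k] f(2) by simp
  qed
  have "sequence_colimit R C f M c"
  proof (intro sequence_colimit.intro sequence_colimit_axioms.intro)
    show "module_sequence R C f" by (rule sq.module_sequence_axioms)
    show "right_module R M" by (rule M)
    show "c n \<in> mod_hom R (C n) M" for n by (rule c)
    show "c (Suc n) (f n y) = c n y" if y: "y \<in> carrier (C n)" for n y
    proof -
      obtain x where x: "x \<in> D n" "y = \<pi> n x" using rep[OF y] by blast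
      moreover have "x \<in> D (Suc n)" using x D_mono[of n "Suc n"] by auto
      ultimately show ?thesis using c(2) f(2) by simp
    qed
    show "\<exists>n. \<exists>x\<in>carrier (C n). y = c n x" if "y \<in> carrier M" for y
    proof -
      have "y \<in> p ` carrier (free_module R I)" unfolding onto0 by (rule that)
      then obtain u where u: "u \<in> carrier (free_module R I)" "y = p u" by (elim imageE) (rule that)
      have eu: "e u \<in> carrier N" by (rule mod_hom_closed[OF e u(1)])
      obtain n where n: "e u \<in> D n" using D_all[OF eu] by blast
      have "y = c n (\<pi> n (e u))" using c(2)[OF n] P_eq[OF eu] e'(2)[OF u(1)] u(2) by simp
      then show ?thesis using \<pi>C[OF n] by blast
    qed
    show "\<exists>k. seq_map C f n k y = \<zero>\<^bsub>C (n + k)\<^esub>" if y: "y \<in> carrier (C n)" "c n y = \<zero>\<^bsub>M\<^esub>" for n y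
    proof -
      obtain x where x: "x \<in> D n" "y = \<pi> n x" using rep[OF y(1)] by blast
      then have "P x = \<zero>\<^bsub>M\<^esub>" using c(2) y(2) by simp
      then obtain k where "x \<in> K k" using K_all x(1) D_sub by blast
      then have "x \<in> K (n + k)" "x \<in> D (n + k)" using K_mono[of k "n + k"] D_mono[of n "n + k"] x(1) by auto
      then have "\<pi> (n + k) x = \<zero>\<^bsub>C (n + k)\<^esub>" using \<pi>(3) by blast
      then show ?thesis using smap[OF x(1)] x(2) by (intro exI[of _ k]) simp
    qed
  qed
  moreover have "finitely_presented R (C n)" for n
  proof -
    let ?I = "free_module R (I' n)" and ?J = "free_module R (J' n)" and ?D = "N\<lparr>carrier := D n\<rparr>"
    let ?lb = "linear_combination N R (I' n) b" and ?lr = "linear_combination N R (J' n) r"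
    have fin: "finite (I' n)" "finite (J' n)" by (simp_all add: I'_def J'_def)
    have lb: "?lb \<in> mod_hom R ?I N" and lr: "?lr \<in> mod_hom R ?J N"
      using linear_combination_hom(1)[OF Nm] bN rN by metis+
    have lb_im: "?lb ` carrier ?I = D n" and lr_im: "?lr ` carrier ?J = K n"
      by (simp_all add: D_def K_def span_def)
    have lbD: "?lb \<in> mod_hom R ?I ?D" using lb_im by (intro mod_hom_corestrict[OF lb]) auto
    have lrD: "?lr \<in> mod_hom R ?J ?D" using lr_im KD[of n] by (intro mod_hom_corestrict[OF lr]) auto
    \<comment> \<open>Injectivity makes \<open>D n\<close> free on \<open>I' n\<close>. The
      relations lift to \<open>s\<close> by projectivity alone, but injectivity is what shows that
      every element of the kernel is in the image of \<open>s\<close>.\<close>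
    have inj: "inj_on ?lb (carrier ?I)"
      using inj_linear_combination_basis[OF Nm e, of "I' n"] e_bij
      by (simp add: b_def[abs_def] bij_betw_def I'_def)
    obtain s where s: "s \<in> mod_hom R ?J ?I" "\<And>v. v \<in> carrier ?J \<Longrightarrow> ?lb (s v) = ?lr v"
      by (rule free_module_lift[OF Fr Dm lbD _ lrD]) (simp_all add: lb_im)
    let ?t = "compose (carrier ?I) (\<pi> n) ?lb"
    have t: "?t \<in> mod_hom R ?I (C n)" by (rule mod_hom_comp[OF Fr lbD \<pi>(1)])
    have lbc: "?lb u \<in> D n" if "u \<in> carrier ?I" for u using that unfolding lb_im[symmetric] by (rule imageI)
    have "s ` carrier ?J = {u \<in> carrier ?I. ?t u = \<zero>\<^bsub>C n\<^esub>}"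
    proof
      show "s ` carrier ?J \<subseteq> {u \<in> carrier ?I. ?t u = \<zero>\<^bsub>C n\<^esub>}"
      proof
        fix u assume "u \<in> s ` carrier ?J"
        then obtain v where v: "v \<in> carrier ?J" "u = s v" by (elim imageE) (rule that)
        have u: "u \<in> carrier ?I" using mod_hom_closed[OF s(1) v(1)] v(2) by simp
        have "?lb u \<in> K n" unfolding v(2) s(2)[OF v(1)] lr_im[symmetric] by (rule imageI[OF v(1)])
        then show "u \<in> {u \<in> carrier ?I. ?t u = \<zero>\<^bsub>C n\<^esub>}"
          using u \<pi>(3)[OF lbc[OF u]] by (simp add: compose_eq)
      qed
      show "{u \<in> carrier ?I. ?t u = \<zero>\<^bsub>C n\<^esub>} \<subseteq> s ` carrier ?J"
      proof
        fix u assume "u \<in> {u \<in> carrier ?I. ?t u = \<zero>\<^bsub>C n\<^esub>}"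
        then have u: "u \<in> carrier ?I" "\<pi> n (?lb u) = \<zero>\<^bsub>C n\<^esub>" by (auto simp: compose_eq)
        then have "?lb u \<in> ?lr ` carrier ?J" using \<pi>(3)[OF lbc[OF u(1)]] unfolding lr_im by simp
        then obtain v where v: "v \<in> carrier ?J" "?lb u = ?lr v" by (elim imageE) (rule that)
        then have "u = s v" using inj_onD[OF inj, of u "s v"] s u mod_hom_closed[OF s(1) v(1)] by simp
        then show "u \<in> s ` carrier ?J" using v(1) by simp
      qed
    qed
    moreover have "?t ` carrier ?I = carrier (C n)"
    proof -
      have "?t ` carrier ?I = \<pi> n ` (?lb ` carrier ?I)" by (auto simp: image_iff compose_eq)
      then show ?thesis unfolding lb_im \<pi>(2) .
    qed
    ultimately have "presented_by R (I' n) (J' n) (C n)"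
      unfolding presented_by_def a_kernel_def' using s(1) t by blast
    then show ?thesis unfolding finitely_presented_def using C(1) fin by blast
  qed
  ultimately show thesis using that CU by blast
qed

end

section \<open>Cotorsion pairs\<close>

locale cotorsion = module_category R \<U>
  for R :: "('r, 'k) ring_scheme" and \<U> :: "'m set set" +
  fixes \<A> \<B> :: "('r, 'm) module set"
  assumes complete: "complete_cotorsion_pair R \<U> \<A> \<B>"
    and hereditary: "hereditary_cotorsion_pair R \<U> \<A> \<B>"
    and sums: "closed_countable_direct_sums R \<U> \<B>"
begin

lemma A_Rmod: "X \<in> \<A> \<Longrightarrow> X \<in> Rmod R \<U>"
  and B_Rmod: "X \<in> \<B> \<Longrightarrow> X \<in> Rmod R \<U>"
  using complete unfolding complete_cotorsion_pair_def cotorsion_pair_def by blast+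

lemma Rmod_module: "X \<in> Rmod R \<U> \<Longrightarrow> right_module R X"
  and Rmod_U: "X \<in> Rmod R \<U> \<Longrightarrow> carrier X \<in> \<U>"
  by (simp_all add: Rmod_def)

lemma A_module: "X \<in> \<A> \<Longrightarrow> right_module R X"
  and B_module: "X \<in> \<B> \<Longrightarrow> right_module R X"
  using A_Rmod B_Rmod Rmod_module by blast+

lemma Ext1_A_B: "\<lbrakk>X \<in> \<A>; Y \<in> \<B>\<rbrakk> \<Longrightarrow> Ext1_vanishes R X Y"
  using complete A_module B_module trivial_Ext1_iff[of R X Y]
  unfolding complete_cotorsion_pair_def cotorsion_pair_def by blast

lemma A_I:
  assumes "X \<in> Rmod R \<U>" "\<And>Y. Y \<in> \<B> \<Longrightarrow> Ext1_vanishes R X Y"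
  shows "X \<in> \<A>"
proof -
  have "trivial_group (Ext1 R X Y)" if "Y \<in> \<B>" for Y
    using assms that B_module Rmod_module trivial_Ext1_iff[of R X Y] by blast
  then show ?thesis
    using assms(1) complete unfolding complete_cotorsion_pair_def cotorsion_pair_def by blast
qed

lemma B_I:
  assumes "Y \<in> Rmod R \<U>" "\<And>X. X \<in> \<A> \<Longrightarrow> Ext1_vanishes R X Y"
  shows "Y \<in> \<B>"
proof -
  have "trivial_group (Ext1 R X Y)" if "X \<in> \<A>" for X
    using assms that A_module Rmod_module trivial_Ext1_iff[of R X Y] by blast
  then show ?thesis
    using assms(1) complete unfolding complete_cotorsion_pair_def cotorsion_pair_def by blast
qed

text \<open>The free module itself has the wrong type, so the claim is about a small copy
  \<open>F\<close>. Lifting \<open>e\<close> through the free cover of \<open>F\<close> gives a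
  section of that cover, and with a section the first Ext group out of \<open>F\<close>
  vanishes.\<close>

lemma free_in_A:
  assumes "small_set \<U> I"
  obtains F e where "F \<in> \<A>" "e \<in> mod_hom R (free_module R I) F"
    "bij_betw e (carrier (free_module R I)) (carrier F)"
proof -
  interpret R: ring R by (rule ring)
  note Fr = R.right_module_free
  obtain F e where F: "F \<in> Rmod R \<U>" and e: "e \<in> mod_hom R (free_module R I) F"
    "bij_betw e (carrier (free_module R I)) (carrier F)"
    by (rule small_module_copy[OF Fr small_free[OF assms]])
  have Fm: "right_module R F" using F by (rule Rmod_module)
  obtain e' where e': "e' \<in> mod_hom R F (free_module R I)" "\<And>x. x \<in> carrier F \<Longrightarrow> e (e' x) = x"
    using mod_iso_inverse[OF Fr Fm e] by metis
  obtain h where h: "h \<in> mod_hom R (free_module R I) (free_module R (carrier F))"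
    "\<And>u. u \<in> carrier (free_module R I) \<Longrightarrow> free_cover_map R F (h u) = e u"
    by (rule free_module_lift[OF Fr Fm free_cover_map[OF Fm] e(1)]) blast
  have "Ext1_vanishes R F Y" if "Y \<in> \<B>" for Y
  proof (rule Ext1_vanishes_of_section[OF Fm B_module[OF that]])
    show "compose (carrier F) h e' \<in> mod_hom R F (free_module R (carrier F))"
      by (rule mod_hom_comp[OF Fm e'(1) h(1)])
    show "free_cover_map R F (compose (carrier F) h e' x) = x" if "x \<in> carrier F" for x
      using that e' h(2)[OF mod_hom_closed[OF e'(1) that]] by (simp add: compose_eq)
  qed
  then have "F \<in> \<A>" using F by (intro A_I)
  then show thesis using that e by blast
qed

text \<open>Dimension shifting: the syzygy of \<open>X\<close> lies in \<open>\<A>\<close> because the pair is hereditary.\<close>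

lemma B_cokernel:
  assumes L: "L \<in> Rmod R \<U>" and B1: "B1 \<in> \<B>" and B2: "B2 \<in> \<B>"
    and f: "f \<in> mod_hom R B1 B2" "inj_on f (carrier B1)"
    and e: "e \<in> mod_hom R B2 L" "e ` carrier B2 = carrier L"
    and ker: "f ` carrier B1 = {x \<in> carrier B2. e x = \<zero>\<^bsub>L\<^esub>}"
  shows "L \<in> \<B>"
proof (rule B_I[OF L])
  fix X assume X: "X \<in> \<A>"
  interpret R: ring R by (rule ring)
  note Xm = A_module[OF X] and Lm = Rmod_module[OF L] and B1m = B_module[OF B1] and B2m = B_module[OF B2]
  let ?F = "free_module R (carrier X)" and ?K = "free_cover_kernel R X" and ?c = "free_cover_map R X"
  note Fr = R.right_module_free[of "carrier X"] and K = free_cover_kernel_sub[OF Xm] and c = free_cover_map[OF Xm]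
  obtain F \<eta> where F: "F \<in> \<A>" and \<eta>: "\<eta> \<in> mod_hom R ?F F" "bij_betw \<eta> (carrier ?F) (carrier F)"
    by (rule free_in_A[OF small_U[OF Rmod_U[OF A_Rmod[OF X]]]])
  note Fm = A_module[OF F]
  obtain \<eta>' where \<eta>': "\<eta>' \<in> mod_hom R F ?F" "\<And>u. u \<in> carrier ?F \<Longrightarrow> \<eta>' (\<eta> u) = u"
    "\<And>x. x \<in> carrier F \<Longrightarrow> \<eta> (\<eta>' x) = x" "bij_betw \<eta>' (carrier F) (carrier ?F)"
    using mod_iso_inverse[OF Fr Fm \<eta>] by metis
  define p where "p = compose (carrier F) ?c \<eta>'"
  have p: "p \<in> mod_hom R F X" unfolding p_def by (rule mod_hom_comp[OF Fm \<eta>'(1) c(1)])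
  have p_eq: "p x = ?c (\<eta>' x)" if "x \<in> carrier F" for x using that by (simp add: p_def compose_eq)
  have p_onto: "p ` carrier F = carrier X"
  proof -
    have "p ` carrier F = ?c ` (\<eta>' ` carrier F)" using p_eq by (auto simp: image_iff)
    then show ?thesis using \<eta>'(4) c(2) by (simp add: bij_betw_def)
  qed
  interpret p: module_hom R F X p by (intro module_homI Fm Xm p)
  \<comment> \<open>The syzygy is realised inside the small copy \<open>F\<close>, because heredity
    is a statement about objects over \<open>'m\<close>.\<close>
  define S where "S = {x \<in> carrier F. p x = \<zero>\<^bsub>X\<^esub>}"
  have S: "module_closed R F S" unfolding S_def by (rule p.kernel_closed)
  let ?S = "F\<lparr>carrier := S\<rparr>"
  note Sm = right_module_sub[OF Fm S]
  have "?S \<in> Rmod R \<U>"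
    using Sm U_subset[OF Rmod_U[OF A_Rmod[OF F]], of S] by (auto simp: Rmod_def S_def)
  moreover have "short_exact R ?S (\<lambda>x\<in>S. x) F p X"
    unfolding short_exact_def a_kernel_def'
    using mod_hom_incl[OF Fm S] p p_onto by (auto simp: S_def inj_on_def)
  ultimately have SA: "?S \<in> \<A>"
    using hereditary X F unfolding hereditary_cotorsion_pair_def by blast
  have \<eta>'S: "\<eta>' x \<in> carrier ?K" if "x \<in> S" for x
    using that p_eq mod_hom_closed[OF \<eta>'(1)] by (auto simp: S_def K(1))
  have \<eta>K: "\<eta> u \<in> S" if "u \<in> carrier ?K" for u
    using that p_eq mod_hom_closed[OF \<eta>(1)] \<eta>'(2) by (auto simp: S_def K(1))
  show "Ext1_vanishes R X L"
    unfolding Ext1_vanishes_def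
  proof
    fix g assume g: "g \<in> mod_hom R ?K L"
    have "restrict \<eta>' S \<in> mod_hom R ?S ?F" by (rule mod_hom_restrict_sub[OF \<eta>'(1) S])
    then have r: "restrict \<eta>' S \<in> mod_hom R ?S ?K"
      by (subst K(3)) (rule mod_hom_corestrict, simp, use \<eta>'S in simp)
    have g': "compose (carrier ?S) g (restrict \<eta>' S) \<in> mod_hom R ?S L" by (rule mod_hom_comp[OF Sm r g])
    \<comment> \<open>Two vanishing groups are used in turn: Ext1(S, B1) = 0 lifts \<open>g\<close>
      from \<open>L\<close> to \<open>B2\<close>, and Ext1(X, B2) = 0 extends the lift from the
      syzygy to the free cover. Following with \<open>e\<close> returns to \<open>L\<close>.\<close>
    obtain t where t: "t \<in> mod_hom R ?S B2" "\<And>x. x \<in> carrier ?S \<Longrightarrow> e (t x) = compose (carrier ?S) g (restrict \<eta>' S) x"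
      by (rule Ext1_vanishes_lift[OF Sm B1m B2m Lm Ext1_A_B[OF SA B1] f e ker g']) blast
    have "restrict \<eta> (carrier ?K) \<in> mod_hom R ?K F"
      using mod_hom_restrict_sub[OF \<eta>(1) K(2)] K(3) by simp
    then have r': "restrict \<eta> (carrier ?K) \<in> mod_hom R ?K ?S"
      by (rule mod_hom_corestrict) (use \<eta>K in simp)
    have "compose (carrier ?K) t (restrict \<eta> (carrier ?K)) \<in> mod_hom R ?K B2"
      by (rule mod_hom_comp[OF K(4) r' t(1)])
    then obtain h where h: "h \<in> mod_hom R ?F B2"
      "\<forall>u\<in>carrier ?K. h u = compose (carrier ?K) t (restrict \<eta> (carrier ?K)) u"
      using Ext1_A_B[OF X B2] unfolding Ext1_vanishes_def by blast
    show "\<exists>h\<in>mod_hom R ?F L. \<forall>u\<in>carrier ?K. h u = g u"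
    proof (intro bexI ballI)
      show "compose (carrier ?F) e h \<in> mod_hom R ?F L" by (rule mod_hom_comp[OF Fr h(1) e(1)])
      fix u assume u: "u \<in> carrier ?K"
      then have uF: "u \<in> carrier ?F" using K(1) by simp
      have "compose (carrier ?F) e h u = e (t (\<eta> u))" using u uF h(2) by (simp add: compose_eq)
      also have "\<dots> = g (\<eta>' (\<eta> u))" using t(2)[of "\<eta> u"] \<eta>K[OF u] by (simp add: compose_eq)
      finally show "compose (carrier ?F) e h u = g u" using \<eta>'(2)[OF uF] by simp
    qed
  qed
qed

section \<open>Closure of \<open>\<B>\<close> under countable sums and limits of sequences\<close>

lemma B_direct_sum:
  assumes "\<And>n. Y n \<in> \<B>"
  obtains D \<delta> where "D \<in> \<B>" "\<delta> \<in> mod_hom R D (direct_sum (UNIV :: nat set) Y)"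
    "bij_betw \<delta> (carrier D) (carrier (direct_sum (UNIV :: nat set) Y))"
proof -
  let ?S = "direct_sum (UNIV :: nat set) Y"
  have S: "right_module R ?S" by (rule right_module_direct_sum[OF ring B_module[OF assms]])
  have "small_set \<U> (carrier ?S)" by (rule small_direct_sum[OF Rmod_U[OF B_Rmod[OF assms]]])
  then obtain D i where D: "D \<in> Rmod R \<U>" and i: "i \<in> mod_hom R ?S D" "bij_betw i (carrier ?S) (carrier D)"
    by (rule small_module_copy[OF S])
  obtain \<delta> where \<delta>: "\<delta> \<in> mod_hom R D ?S" "bij_betw \<delta> (carrier D) (carrier ?S)"
    using mod_iso_inverse[OF S Rmod_module[OF D] i] by metis
  have "mod_iso R D ?S" unfolding mod_iso_def using \<delta> by blast
  then have "D \<in> \<B>"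
    using sums assms D unfolding closed_countable_direct_sums_def by blast
  then show thesis using that \<delta> by blast
qed

text \<open>The limit is exhibited as the cokernel of a monomorphism from one object
  \<open>D\<close> to itself. As \<open>E\<close> lies over another type, the conclusion concerns a
  copy \<open>L\<close>, which is small because \<open>E\<close> is an image of
  \<open>D\<close>.\<close>

lemma B_sequence_colimit:
  fixes E :: "('r, 'e) module"
  assumes seq: "module_sequence R Y b" and Y: "\<And>n. Y n \<in> \<B>"
    and q: "q \<in> mod_hom R (module_sequence.germ_module Y b) E"
      "q ` module_sequence.germs Y b = carrier E"
      "\<And>x. x \<in> module_sequence.germs Y b \<Longrightarrow> q x = \<zero>\<^bsub>E\<^esub> \<longleftrightarrow> x \<in> module_sequence.null_germs Y"
    and E: "right_module R E"
  obtains L i where "L \<in> \<B>" "i \<in> mod_hom R L E" "bij_betw i (carrier L) (carrier E)"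
proof -
  interpret module_sequence R Y b by (rule seq)
  let ?S = "direct_sum (UNIV :: nat set) Y"
  obtain D \<delta> where D: "D \<in> \<B>" and \<delta>: "\<delta> \<in> mod_hom R D ?S" "bij_betw \<delta> (carrier D) (carrier ?S)"
    by (rule B_direct_sum[OF Y])
  note Dm = B_module[OF D]
  have S: "right_module R ?S" by (rule right_module_direct_sum[OF ring C])
  obtain d where d: "d \<in> mod_hom R germ_module ?S" "bij_betw d (carrier germ_module) (carrier ?S)"
    using germs_iso_direct_sum unfolding mod_iso_def by blast
  obtain d' where d': "d' \<in> mod_hom R ?S germ_module" "bij_betw d' (carrier ?S) (carrier germ_module)"
    using mod_iso_inverse[OF right_module_germs S d] by metis
  define \<phi> where "\<phi> = compose (carrier D) d' \<delta>"
  have \<phi>: "\<phi> \<in> mod_hom R D germ_module" unfolding \<phi>_def by (rule mod_hom_comp[OF Dm \<delta>(1) d'(1)])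
  have \<phi>_bij: "bij_betw \<phi> (carrier D) germs"
    unfolding \<phi>_def using bij_betw_compose[OF \<delta>(2) d'(2)] by simp
  obtain \<phi>' where \<phi>': "\<phi>' \<in> mod_hom R germ_module D" "\<And>x. x \<in> germs \<Longrightarrow> \<phi> (\<phi>' x) = x"
    "\<And>y. y \<in> carrier D \<Longrightarrow> \<phi>' (\<phi> y) = y" "bij_betw \<phi>' germs (carrier D)"
    using mod_iso_inverse[OF Dm right_module_germs \<phi>] \<phi>_bij by (metis germ_module_simps(1))
  have incl: "(\<lambda>x\<in>null_germs. x) \<in> mod_hom R ?S germ_module"
    unfolding direct_sum_UNIV_eq by (rule mod_hom_incl[OF right_module_germs null_germs_closed])
  have \<delta>g: "compose (carrier D) (\<lambda>x\<in>null_germs. x) \<delta> \<in> mod_hom R D germ_module"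
    by (rule mod_hom_comp[OF Dm \<delta>(1) incl])
  \<comment> \<open>The inclusion of the null families into the germs, read through
    \<open>\<delta>\<close> on its source and through the isomorphism \<open>\<phi>\<close> on its
    target.\<close>
  define f where "f = compose (carrier D) \<phi>' (compose (carrier D) (\<lambda>x\<in>null_germs. x) \<delta>)"
  have f: "f \<in> mod_hom R D D" unfolding f_def by (rule mod_hom_comp[OF Dm \<delta>g \<phi>'(1)])
  have \<delta>Z: "\<delta> x \<in> null_germs" if "x \<in> carrier D" for x
    using mod_hom_closed[OF \<delta>(1) that] by (simp add: carrier_direct_sum_UNIV)
  have f_eq: "f x = \<phi>' (\<delta> x)" if "x \<in> carrier D" for x
    using that \<delta>Z[OF that] by (simp add: f_def compose_eq)
  have f_inj: "inj_on f (carrier D)"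
  proof (rule inj_onI)
    fix x y assume xy: "x \<in> carrier D" "y \<in> carrier D" "f x = f y"
    then have "\<phi> (\<phi>' (\<delta> x)) = \<phi> (\<phi>' (\<delta> y))" by (simp add: f_eq)
    then have "\<delta> x = \<delta> y" using \<phi>'(2) \<delta>Z xy null_germs_subset by (simp add: subset_iff)
    then show "x = y" using \<delta>(2) xy by (simp add: bij_betw_def inj_on_def)
  qed
  define r where "r = compose (carrier D) q \<phi>"
  have r: "r \<in> mod_hom R D E" unfolding r_def by (rule mod_hom_comp[OF Dm \<phi> q(1)])
  have r_eq: "r x = q (\<phi> x)" if "x \<in> carrier D" for x using that by (simp add: r_def compose_eq)
  have r_onto: "r ` carrier D = carrier E"
  proof -
    have "r ` carrier D = q ` (\<phi> ` carrier D)" using r_eq by (auto simp: image_iff)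
    then show ?thesis using \<phi>_bij q(2) by (simp add: bij_betw_def)
  qed
  have r_ker: "f ` carrier D = {x \<in> carrier D. r x = \<zero>\<^bsub>E\<^esub>}"
  proof
    show "f ` carrier D \<subseteq> {x \<in> carrier D. r x = \<zero>\<^bsub>E\<^esub>}"
    proof
      fix y assume "y \<in> f ` carrier D"
      then obtain x where x: "x \<in> carrier D" "y = f x" by (elim imageE) (rule that)
      have "\<delta> x \<in> germs" using \<delta>Z[OF x(1)] null_germs_subset by blast
      then have "r y = q (\<delta> x)" "y \<in> carrier D"
        using x \<phi>'(2) r_eq mod_hom_closed[OF f x(1)] by (simp_all add: f_eq)
      then show "y \<in> {x \<in> carrier D. r x = \<zero>\<^bsub>E\<^esub>}"
        using q(3) \<delta>Z[OF x(1)] \<open>\<delta> x \<in> germs\<close> by simp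
    qed
    show "{x \<in> carrier D. r x = \<zero>\<^bsub>E\<^esub>} \<subseteq> f ` carrier D"
    proof
      fix x assume "x \<in> {x \<in> carrier D. r x = \<zero>\<^bsub>E\<^esub>}"
      then have x: "x \<in> carrier D" "q (\<phi> x) = \<zero>\<^bsub>E\<^esub>" using r_eq by auto
      have "\<phi> x \<in> germs" using mod_hom_closed[OF \<phi> x(1)] by simp
      then have "\<phi> x \<in> carrier ?S" using q(3) x(2) by (simp add: carrier_direct_sum_UNIV)
      then have "\<phi> x \<in> \<delta> ` carrier D" using \<delta>(2) by (simp add: bij_betw_def)
      then obtain y where y: "y \<in> carrier D" "\<phi> x = \<delta> y" by (elim imageE) (rule that)
      then have "x = f y" using \<phi>'(3)[OF x(1)] by (simp add: f_eq)
      then show "x \<in> f ` carrier D" using y(1) by simp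
    qed
  qed
  have "small_set \<U> (carrier E)"
    unfolding r_onto[symmetric] by (rule small_image[OF small_U[OF Rmod_U[OF B_Rmod[OF D]]]])
  then obtain L j where L: "L \<in> Rmod R \<U>" and j: "j \<in> mod_hom R E L" "bij_betw j (carrier E) (carrier L)"
    by (rule small_module_copy[OF E])
  note Lm = Rmod_module[OF L]
  obtain i where i: "i \<in> mod_hom R L E" "bij_betw i (carrier L) (carrier E)"
    "\<And>x. x \<in> carrier E \<Longrightarrow> i (j x) = x"
    using mod_iso_inverse[OF E Lm j] by metis
  interpret j: module_hom R E L j by (intro module_homI E Lm j(1))
  interpret i: module_hom R L E i by (intro module_homI E Lm i(1))
  have jr: "compose (carrier D) j r \<in> mod_hom R D L" by (rule mod_hom_comp[OF Dm r j(1)])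
  have "L \<in> \<B>"
  proof (rule B_cokernel[OF L D D f f_inj jr])
    have "compose (carrier D) j r ` carrier D = j ` (r ` carrier D)" by (auto simp: image_iff compose_eq)
    then show "compose (carrier D) j r ` carrier D = carrier L" using j(2) r_onto by (simp add: bij_betw_def)
    have "j (r x) = \<zero>\<^bsub>L\<^esub> \<longleftrightarrow> r x = \<zero>\<^bsub>E\<^esub>" if "x \<in> carrier D" for x
      using i(3)[OF mod_hom_closed[OF r that]] i.zero j.zero by metis
    then show "f ` carrier D = {x \<in> carrier D. compose (carrier D) j r x = \<zero>\<^bsub>L\<^esub>}"
      unfolding r_ker by (auto simp: compose_eq)
  qed
  then show thesis using that i by blast
qed

end

section \<open>Factorization through \<open>\<A>\<close>\<close>

lemma (in sequence_colimit) map_colimit: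
  assumes D: "sequence_colimit R D g N d" and h: "\<And>n. h n \<in> mod_hom R (C n) (D n)"
    and h_f: "\<And>n x. x \<in> carrier (C n) \<Longrightarrow> h (Suc n) (f n x) = g n (h n x)"
  shows "\<exists>t\<in>mod_hom R M N. \<forall>n. \<forall>x\<in>carrier (C n). t (c n x) = d n (h n x)"
proof -
  interpret D: sequence_colimit R D g N d by (rule D)
  obtain t where t: "t \<in> mod_hom R M N"
    "\<And>n x. x \<in> carrier (C n) \<Longrightarrow> t (c n x) = compose (carrier (C n)) (d n) (h n) x"
  proof (rule universal[OF D.M.right_module_axioms, of "\<lambda>n. compose (carrier (C n)) (d n) (h n)"])
    show "compose (carrier (C n)) (d n) (h n) \<in> mod_hom R (C n) N" for n
      by (rule mod_hom_comp[OF C h D.c])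
    show "compose (carrier (C (Suc n))) (d (Suc n)) (h (Suc n)) (f n x) = compose (carrier (C n)) (d n) (h n) x"
      if "x \<in> carrier (C n)" for n x
      using that h_f[OF that] D.c_f[OF mod_hom_closed[OF h that]] by (simp add: compose_eq)
  qed blast
  have "t (c n x) = d n (h n x)" if "x \<in> carrier (C n)" for n x
    using t(2)[OF that] that by (simp add: compose_eq)
  then show ?thesis by (intro bexI[OF _ t(1)]) blast
qed

lemma seq_map_natural:
  assumes "module_sequence R C f" "module_sequence R D g" and h: "\<And>n. h n \<in> mod_hom R (C n) (D n)"
    and h_f: "\<And>n x. x \<in> carrier (C n) \<Longrightarrow> h (Suc n) (f n x) = g n (h n x)"
    and x: "x \<in> carrier (C n)"
  shows "h (n + k) (seq_map C f n k x) = seq_map D g n k (h n x)"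
proof -
  interpret C: module_sequence R C f by fact
  interpret D: module_sequence R D g by fact
  note hx = mod_hom_closed[OF h x]
  show ?thesis
  proof (induction k)
    case 0
    show ?case using C.seq_map_0[OF x] D.seq_map_0[OF hx] by simp
  next
    case (Suc k)
    then show ?case
      using C.seq_map_Suc[OF x, of k] D.seq_map_Suc[OF hx, of k] h_f[OF C.seq_map_closed[OF x, of k]]
      by simp
  qed
qed

text \<open>The route through \<open>A m\<close> need not return to \<open>C n\<close> by the given
  maps on the nose, only up to what dies in \<open>M\<close>; making the two agree costs further
  steps. The length \<open>Suc k\<close> is positive so that the stages can be iterated into a
  strictly increasing subsequence.\<close>

lemma (in cotorsion) seq_map_factors:
  assumes col: "sequence_colimit R C f M c" and fp: "\<And>n. finitely_presented R (C n)"
    and CU: "\<And>n. C n \<in> Rmod R \<U>" and MA: "M \<in> \<A>"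
  shows "\<exists>k X g h. X \<in> \<A> \<and> g \<in> mod_hom R (C n) X \<and> h \<in> mod_hom R X (C (n + Suc k)) \<and>
    (\<forall>x\<in>carrier (C n). seq_map C f n (Suc k) x = h (g x))"
proof -
  interpret C: sequence_colimit R C f M c by (rule col)
  have "\<exists>B\<in>\<B>. \<exists>A\<in>\<A>. \<exists>i p. short_exact R B i A p (C n)" for n
    using complete CU unfolding complete_cotorsion_pair_def by blast
  then obtain B A i p where B: "\<And>n. B n \<in> \<B>" and A: "\<And>n. A n \<in> \<A>"
    and se: "\<And>n. short_exact R (B n) (i n) (A n) (p n) (C n)"
    by metis
  note Bm = B_module[OF B] and Am = A_module[OF A]
  have i: "\<And>n. i n \<in> mod_hom R (B n) (A n)" "\<And>n. inj_on (i n) (carrier (B n))"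
    and p: "\<And>n. p n \<in> mod_hom R (A n) (C n)" "\<And>n. p n ` carrier (A n) = carrier (C n)"
    and ip: "\<And>n. i n ` carrier (B n) = {x \<in> carrier (A n). p n x = \<zero>\<^bsub>C n\<^esub>}"
    using se unfolding short_exact_def a_kernel_def' by blast+
  \<comment> \<open>Transition maps exist because Ext1(A n, B (Suc n)) = 0. They are chosen
    independently for each \<open>n\<close>: along a sequence there is no compatibility beyond
    consecutive maps.\<close>
  have "\<exists>a\<in>mod_hom R (A n) (A (Suc n)). \<forall>x\<in>carrier (A n). p (Suc n) (a x) = f n (p n x)" for n
  proof -
    have fp: "compose (carrier (A n)) (f n) (p n) \<in> mod_hom R (A n) (C (Suc n))"
      by (rule mod_hom_comp[OF Am p(1) C.f])
    obtain a where a: "a \<in> mod_hom R (A n) (A (Suc n))"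
      "\<And>x. x \<in> carrier (A n) \<Longrightarrow> p (Suc n) (a x) = compose (carrier (A n)) (f n) (p n) x"
      by (rule Ext1_vanishes_lift[OF Am Bm Am C.C Ext1_A_B[OF A B] i p ip fp]) blast
    show ?thesis by (rule bexI[OF _ a(1)]) (simp add: a(2) compose_eq)
  qed
  then obtain a where a: "\<And>n. a n \<in> mod_hom R (A n) (A (Suc n))"
    and pa: "\<And>n x. x \<in> carrier (A n) \<Longrightarrow> p (Suc n) (a n x) = f n (p n x)" by metis
  have "\<exists>b\<in>mod_hom R (B n) (B (Suc n)). \<forall>x\<in>carrier (B n). i (Suc n) (b x) = a n (i n x)" for n
  proof -
    have ai: "compose (carrier (B n)) (a n) (i n) \<in> mod_hom R (B n) (A (Suc n))"
      by (rule mod_hom_comp[OF Bm i(1) a])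
    have "\<exists>b\<in>mod_hom R (B n) (B (Suc n)). \<forall>x\<in>carrier (B n). i (Suc n) (b x) = compose (carrier (B n)) (a n) (i n) x"
    proof (rule mod_hom_lift_inj[OF Bm Bm Am i ai])
      fix x assume x: "x \<in> carrier (B n)"
      have "i n x \<in> i n ` carrier (B n)" using x by (rule imageI)
      then have "i n x \<in> carrier (A n)" "p n (i n x) = \<zero>\<^bsub>C n\<^esub>" unfolding ip by auto
      then show "compose (carrier (B n)) (a n) (i n) x \<in> i (Suc n) ` carrier (B (Suc n))"
        unfolding ip using x pa mod_hom_closed[OF a] by (simp add: compose_eq)
    qed
    then show ?thesis by (simp add: compose_eq cong: ball_cong)
  qed
  then obtain b where b: "\<And>n. b n \<in> mod_hom R (B n) (B (Suc n))"
    and ib: "\<And>n x. x \<in> carrier (B n) \<Longrightarrow> i (Suc n) (b n x) = a n (i n x)" by metis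
  interpret SA: module_sequence R A a by (rule module_sequence.intro) (rule Am a)+
  interpret SB: module_sequence R B b by (rule module_sequence.intro) (rule Bm b)+
  \<comment> \<open>This limit stays over \<open>nat \<Rightarrow> 'm\<close>: only the kernel of
    its map to \<open>M\<close> has to lie in \<open>\<B>\<close>, up to a copy, and the lifting
    lemma accepts a middle term of any type.\<close>
  obtain EA :: "('r, nat \<Rightarrow> 'm) module" and qA where
    "sequence_colimit R A a EA (\<lambda>n. compose (carrier (A n)) qA (SA.germ_of n))"
    by (rule SA.colimit_exists)
  then obtain cA where EA: "sequence_colimit R A a EA cA" by blast
  interpret EA: sequence_colimit R A a EA cA by (rule EA)
  obtain EB :: "('r, nat \<Rightarrow> 'm) module" and q where q: "q \<in> mod_hom R SB.germ_module EB"
    "q ` SB.germs = carrier EB" "\<And>x. x \<in> SB.germs \<Longrightarrow> q x = \<zero>\<^bsub>EB\<^esub> \<longleftrightarrow> x \<in> SB.null_germs"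
    and EB: "sequence_colimit R B b EB (\<lambda>n. compose (carrier (B n)) q (SB.germ_of n))"
    by (rule SB.colimit_exists) blast
  define cB where "cB n = compose (carrier (B n)) q (SB.germ_of n)" for n
  interpret EB: sequence_colimit R B b EB cB using EB unfolding cB_def[abs_def] .
  obtain L l where L: "L \<in> \<B>" and l: "l \<in> mod_hom R L EB" "bij_betw l (carrier L) (carrier EB)"
    by (rule B_sequence_colimit[OF SB.module_sequence_axioms B q EB.M.right_module_axioms])
  obtain e where e1: "e \<in> mod_hom R EA M" and e2: "\<forall>n. \<forall>x\<in>carrier (A n). e (cA n x) = c n (p n x)"
    using EA.map_colimit[OF col p(1) pa] by (rule bexE)
  note e = e1 e2[rule_format]
  obtain \<iota> where \<iota>1: "\<iota> \<in> mod_hom R EB EA" and \<iota>2: "\<forall>n. \<forall>x\<in>carrier (B n). \<iota> (cB n x) = cA n (i n x)"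
    using EB.map_colimit[OF EA i(1) ib] by (rule bexE)
  note \<iota> = \<iota>1 \<iota>2[rule_format]
  interpret e: module_hom R EA M e by (intro module_homI EA.M.right_module_axioms C.M.right_module_axioms e(1))
  interpret \<iota>: module_hom R EB EA \<iota> by (intro module_homI EA.M.right_module_axioms EB.M.right_module_axioms \<iota>(1))
  have pi: "p n (i n x) = \<zero>\<^bsub>C n\<^esub>" if "x \<in> carrier (B n)" for n x
  proof -
    have "i n x \<in> i n ` carrier (B n)" using that by (rule imageI)
    then show ?thesis unfolding ip by simp
  qed
  have e_onto: "e ` carrier EA = carrier M"
  proof
    show "e ` carrier EA \<subseteq> carrier M" by auto
    show "carrier M \<subseteq> e ` carrier EA"
    proof
      fix y assume y: "y \<in> carrier M"
      obtain n x where x: "x \<in> carrier (C n)" "y = c n x" using C.c_onto[OF y] by blast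
      then have "x \<in> p n ` carrier (A n)" using p(2) by simp
      then obtain z where z: "z \<in> carrier (A n)" "x = p n z" by (elim imageE) (rule that)
      then have "y = e (cA n z)" using x e(2) by simp
      then show "y \<in> e ` carrier EA" using EA.c_closed[OF z(1)] by simp
    qed
  qed
  \<comment> \<open>Here and in \<open>\<iota>_im\<close>, exactness of sequential limits is
    verified on elements: what dies in a limit dies at a finite stage, where the given short exact
    sequence applies.\<close>
  have \<iota>_inj: "inj_on \<iota> (carrier EB)"
  proof -
    have "y = \<zero>\<^bsub>EB\<^esub>" if y: "y \<in> carrier EB" "\<iota> y = \<zero>\<^bsub>EA\<^esub>" for y
    proof -
      obtain n x where x: "x \<in> carrier (B n)" "y = cB n x" using EB.c_onto[OF y(1)] by blast
      then have "cA n (i n x) = \<zero>\<^bsub>EA\<^esub>" using \<iota>(2) y(2) by simp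
      then obtain k where "seq_map A a n k (i n x) = \<zero>\<^bsub>A (n + k)\<^esub>"
        using EA.c_ker[OF mod_hom_closed[OF i(1) x(1)]] by blast
      then have "i (n + k) (seq_map B b n k x) = \<zero>\<^bsub>A (n + k)\<^esub>"
        using seq_map_natural[OF SB.module_sequence_axioms SA.module_sequence_axioms i(1) ib x(1)] by simp
      moreover have "i (n + k) \<zero>\<^bsub>B (n + k)\<^esub> = \<zero>\<^bsub>A (n + k)\<^esub>"
        by (rule module_hom.zero[OF module_homI[OF Bm Am i(1)]])
      ultimately have "seq_map B b n k x = \<zero>\<^bsub>B (n + k)\<^esub>"
        using inj_onD[OF i(2)] SB.seq_map_closed[OF x(1)] SB.C_zero_closed by metis
      then show ?thesis using EB.c_seq_map[OF x(1), of k] x(2) by simp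
    qed
    then show ?thesis
      using EB.M.diff_eq_zero_iff EA.M.diff_eq_zero_iff \<iota>.diff EB.M.minus_closed
      by (intro inj_onI) (metis \<iota>.closed)
  qed
  have \<iota>_im: "\<iota> ` carrier EB = {x \<in> carrier EA. e x = \<zero>\<^bsub>M\<^esub>}"
  proof
    show "\<iota> ` carrier EB \<subseteq> {x \<in> carrier EA. e x = \<zero>\<^bsub>M\<^esub>}"
    proof
      fix y assume "y \<in> \<iota> ` carrier EB"
      then obtain z where z: "z \<in> carrier EB" "y = \<iota> z" by (elim imageE) (rule that)
      obtain n x where x: "x \<in> carrier (B n)" "z = cB n x" using EB.c_onto[OF z(1)] by blast
      have "e y = c n (p n (i n x))" using z x \<iota>(2) e(2) mod_hom_closed[OF i(1) x(1)] by simp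
      then show "y \<in> {x \<in> carrier EA. e x = \<zero>\<^bsub>M\<^esub>}" using z pi[OF x(1)] by simp
    qed
    show "{x \<in> carrier EA. e x = \<zero>\<^bsub>M\<^esub>} \<subseteq> \<iota> ` carrier EB"
    proof
      fix y assume "y \<in> {x \<in> carrier EA. e x = \<zero>\<^bsub>M\<^esub>}"
      then have y: "y \<in> carrier EA" "e y = \<zero>\<^bsub>M\<^esub>" by auto
      obtain n x where x: "x \<in> carrier (A n)" "y = cA n x" using EA.c_onto[OF y(1)] by blast
      then have "c n (p n x) = \<zero>\<^bsub>M\<^esub>" using e(2) y(2) by simp
      then obtain k where "seq_map C f n k (p n x) = \<zero>\<^bsub>C (n + k)\<^esub>"
        using C.c_ker[OF mod_hom_closed[OF p(1) x(1)]] by blast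
      then have "p (n + k) (seq_map A a n k x) = \<zero>\<^bsub>C (n + k)\<^esub>"
        using seq_map_natural[OF SA.module_sequence_axioms C.module_sequence_axioms p(1) pa x(1)] by simp
      then have "seq_map A a n k x \<in> i (n + k) ` carrier (B (n + k))"
        unfolding ip using SA.seq_map_closed[OF x(1)] by simp
      then obtain w where w: "w \<in> carrier (B (n + k))" "seq_map A a n k x = i (n + k) w"
        by (elim imageE) (rule that)
      have "y = \<iota> (cB (n + k) w)" using EA.c_seq_map[OF x(1), of k] x(2) w \<iota>(2) by simp
      then show "y \<in> \<iota> ` carrier EB" using EB.c_closed[OF w(1)] by simp
    qed
  qed
  note Lm = B_module[OF L]
  define j where "j = compose (carrier L) \<iota> l"
  have j: "j \<in> mod_hom R L EA" unfolding j_def by (rule mod_hom_comp[OF Lm l(1) \<iota>(1)])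
  have j_im: "j ` carrier L = {x \<in> carrier EA. e x = \<zero>\<^bsub>M\<^esub>}"
  proof -
    have "j ` carrier L = \<iota> ` (l ` carrier L)" by (auto simp: j_def image_iff compose_eq)
    then show ?thesis using l(2) \<iota>_im by (simp add: bij_betw_def)
  qed
  have j_inj: "inj_on j (carrier L)"
  proof -
    have "inj_on (\<iota> \<circ> l) (carrier L)"
      using l(2) \<iota>_inj by (intro comp_inj_on) (simp_all add: bij_betw_def)
    then show ?thesis by (simp add: j_def inj_on_def compose_eq)
  qed
  obtain s where s: "s \<in> mod_hom R M EA" "\<And>y. y \<in> carrier M \<Longrightarrow> e (s y) = (\<lambda>x\<in>carrier M. x) y"
    by (rule Ext1_vanishes_lift[OF C.M.right_module_axioms Lm EA.M.right_module_axioms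
          C.M.right_module_axioms Ext1_A_B[OF MA L] j j_inj e(1) e_onto j_im
          mod_hom_id[OF C.M.right_module_axioms]]) blast
  have sc: "compose (carrier (C n)) s (c n) \<in> mod_hom R (C n) EA" by (rule mod_hom_comp[OF C.C C.c s(1)])
  obtain m g where g: "g \<in> mod_hom R (C n) (A m)"
    and cg: "\<forall>x\<in>carrier (C n). cA m (g x) = compose (carrier (C n)) s (c n) x"
    using EA.finitely_presented_factor[OF fp sc] by blast
  have cpg: "c m (p m (g x)) = c n x" if x: "x \<in> carrier (C n)" for x
    using cg x e(2)[OF mod_hom_closed[OF g x]] s(2)[OF C.c_closed[OF x]] by (simp add: compose_eq)
  \<comment> \<open>A stage that both \<open>C n\<close> and \<open>C m\<close> reach, and at least
    one step away from \<open>n\<close>.\<close>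
  let ?N = "n + Suc m"
  have N: "?N = m + Suc n" by simp
  define h1 where "h1 = compose (carrier (A m)) (seq_map C f m (Suc n)) (p m)"
  have h1: "h1 \<in> mod_hom R (A m) (C ?N)"
    unfolding h1_def N by (rule mod_hom_comp[OF Am p(1) C.seq_map_hom])
  have h1g: "compose (carrier (C n)) h1 g \<in> mod_hom R (C n) (C ?N)" by (rule mod_hom_comp[OF C.C g h1])
  \<comment> \<open>The route through \<open>A m\<close> and the direct route from
    \<open>C n\<close> become equal in \<open>M\<close>, but need not be equal in
    \<open>C ?N\<close>. Their difference has image zero in \<open>M\<close>, and finite generation
    of \<open>C n\<close> kills it after \<open>k\<close> more steps.\<close>
  define d where "d = (\<lambda>x\<in>carrier (C n). compose (carrier (C n)) h1 g x \<ominus>\<^bsub>C ?N\<^esub> seq_map C f n (Suc m) x)"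
  have d: "d \<in> mod_hom R (C n) (C ?N)"
    unfolding d_def by (rule mod_hom_diff[OF C.C C.C h1g C.seq_map_hom])
  interpret cN: module_hom R "C ?N" M "c ?N"
    by (intro module_homI C.C C.M.right_module_axioms C.c)
  have "c ?N (d x) = \<zero>\<^bsub>M\<^esub>" if x: "x \<in> carrier (C n)" for x
  proof -
    note gx = mod_hom_closed[OF g x]
    have "c ?N (h1 (g x)) = c n x"
      using C.c_seq_map[OF mod_hom_closed[OF p(1) gx], of "Suc n"] cpg[OF x] gx
      by (simp add: h1_def compose_eq add.commute del: seq_map.simps)
    moreover have "c ?N (seq_map C f n (Suc m) x) = c n x" by (rule C.c_seq_map[OF x])
    moreover have "h1 (g x) \<in> carrier (C ?N)" by (rule mod_hom_closed[OF h1 gx])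
    moreover have "seq_map C f n (Suc m) x \<in> carrier (C ?N)" by (rule C.seq_map_closed[OF x])
    ultimately show ?thesis
      using x mod_hom_closed[OF C.c x] by (simp add: d_def compose_eq del: seq_map.simps add_Suc_right)
  qed
  then obtain k where k: "\<And>x. x \<in> carrier (C n) \<Longrightarrow> seq_map C f ?N k (d x) = \<zero>\<^bsub>C (?N + k)\<^esub>"
    using C.finitely_generated_vanish[OF C.C finitely_presented_imp_generated[OF fp] d] by blast
  define h where "h = compose (carrier (A m)) (seq_map C f ?N k) h1"
  have h: "h \<in> mod_hom R (A m) (C (?N + k))" unfolding h_def by (rule mod_hom_comp[OF Am h1 C.seq_map_hom])
  have fin: "seq_map C f n (Suc (m + k)) x = h (g x)" if x: "x \<in> carrier (C n)" for x
  proof -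
    interpret sm: module_hom R "C ?N" "C (?N + k)" "seq_map C f ?N k"
      by (intro module_homI C.C C.seq_map_hom)
    note gx = mod_hom_closed[OF g x]
    have cl: "h1 (g x) \<in> carrier (C ?N)" "seq_map C f n (Suc m) x \<in> carrier (C ?N)"
      using mod_hom_closed[OF h1 gx] C.seq_map_closed[OF x] by blast+
    have "seq_map C f ?N k (h1 (g x) \<ominus>\<^bsub>C ?N\<^esub> seq_map C f n (Suc m) x) = \<zero>\<^bsub>C (?N + k)\<^esub>"
      using k[OF x] x by (simp add: d_def compose_eq del: seq_map.simps add_Suc_right)
    then have "seq_map C f ?N k (h1 (g x)) = seq_map C f ?N k (seq_map C f n (Suc m) x)"
      using cl sm.N.diff_eq_zero_iff[of "seq_map C f ?N k (h1 (g x))" "seq_map C f ?N k (seq_map C f n (Suc m) x)"]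
      by (simp del: seq_map.simps add_Suc_right)
    then show ?thesis
      using C.seq_map_add[OF x, of "Suc m" k] gx by (simp add: h_def compose_eq del: seq_map.simps)
  qed
  show ?thesis
    by (rule exI[of _ "m + k"], rule exI[of _ "A m"], rule exI[of _ g], rule exI[of _ h])
      (use A g h fin in \<open>simp add: add.assoc del: seq_map.simps\<close>)
qed

text \<open>Cofinality: positive steps give \<open>r i + j \<le> r (i + j)\<close>, so the
  subsequence passes every stage and inherits both elementwise conditions.\<close>

lemma sequence_colimit_subsequence:
  assumes col: "sequence_colimit R C f M c" and r: "\<And>i. r (Suc i) = r i + k i" "\<And>i. k i > 0"
  shows "sequence_colimit R (\<lambda>i. C (r i)) (\<lambda>i. seq_map C f (r i) (k i)) M (\<lambda>i. c (r i))"
proof -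
  interpret C: sequence_colimit R C f M c by (rule col)
  interpret S: module_sequence R "\<lambda>i. C (r i)" "\<lambda>i. seq_map C f (r i) (k i)"
    by (rule module_sequence.intro) (simp_all add: C.C r C.seq_map_hom)
  have ge: "r i + j \<le> r (i + j)" for i j
  proof (induction j)
    case (Suc j)
    then show ?case using r(1)[of "i + j"] r(2)[of "i + j"] by simp
  qed simp
  have sm: "seq_map (\<lambda>i. C (r i)) (\<lambda>i. seq_map C f (r i) (k i)) i j x = seq_map C f (r i) (r (i + j) - r i) x"
    if x: "x \<in> carrier (C (r i))" for i j x
  proof (induction j)
    case 0
    show ?case using S.seq_map_0[OF x] C.seq_map_0[OF x] by simp
  next
    case (Suc j)
    have "r i \<le> r (i + j)" using ge[of i j] by simp
    then have e: "r (i + Suc j) - r i = (r (i + j) - r i) + k (i + j)" using r(1)[of "i + j"] by simp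
    show ?case
      unfolding S.seq_map_Suc[OF x] Suc e C.seq_map_add[OF x] using \<open>r i \<le> r (i + j)\<close> by simp
  qed
  show ?thesis
  proof (intro sequence_colimit.intro sequence_colimit_axioms.intro)
    show "module_sequence R (\<lambda>i. C (r i)) (\<lambda>i. seq_map C f (r i) (k i))" by (rule S.module_sequence_axioms)
    show "right_module R M" by (rule C.M.right_module_axioms)
    show "c (r i) \<in> mod_hom R (C (r i)) M" for i by (rule C.c)
    show "c (r (Suc i)) (seq_map C f (r i) (k i) x) = c (r i) x" if "x \<in> carrier (C (r i))" for i x
      using C.c_seq_map[OF that] r(1) by simp
    show "\<exists>i. \<exists>x\<in>carrier (C (r i)). y = c (r i) x" if y: "y \<in> carrier M" for y
    proof -
      obtain n x where x: "x \<in> carrier (C n)" "y = c n x" using C.c_onto[OF y] by blast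
      have "n \<le> r n" using ge[of 0 n] by simp
      then have "y = c (r n) (seq_map C f n (r n - n) x)" "seq_map C f n (r n - n) x \<in> carrier (C (r n))"
        using C.c_seq_map[OF x(1), of "r n - n"] C.seq_map_closed[OF x(1), of "r n - n"] x(2) by simp_all
      then show ?thesis by blast
    qed
    show "\<exists>j. seq_map (\<lambda>i. C (r i)) (\<lambda>i. seq_map C f (r i) (k i)) i j x = \<zero>\<^bsub>C (r (i + j))\<^esub>"
      if x: "x \<in> carrier (C (r i))" "c (r i) x = \<zero>\<^bsub>M\<^esub>" for i x
    proof -
      obtain j where j: "seq_map C f (r i) j x = \<zero>\<^bsub>C (r i + j)\<^esub>" using C.c_ker[OF x] by blast
      have "j \<le> r (i + j) - r i" using ge[of i j] by simp
      from C.seq_map_zero_mono[OF x(1) j this] show ?thesis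
        using sm[OF x(1), of j] ge[of i j] by (intro exI[of _ j]) simp
    qed
  qed
qed

section \<open>The implications between the conditions\<close>

context cotorsion
begin

lemma A_imp_sequence:
  assumes MA: "M \<in> \<A>" and cp: "countably_presented R M"
  shows "\<exists>C f. is_sequence_limit R \<U> C f M \<and>
           (\<forall>n. finitely_presented R (C n)) \<and>
           (\<forall>n. f n \<in> factor_ideal R \<A> (C n) (C (Suc n))) \<and>
           (\<forall>B\<in>\<B>. Mittag_Leffler (\<lambda>n. Hom_group R (C n) B)
                      (\<lambda>n g. compose (carrier (C n)) g (f n)))"
proof -
  obtain C :: "nat \<Rightarrow> ('r, 'm) module" and f c where CU: "\<And>n. C n \<in> Rmod R \<U>"
    and fp: "\<And>n. finitely_presented R (C n)" and col: "sequence_colimit R C f M c"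
    by (rule countably_presented_colimit[OF cp]) blast
  obtain k X g h where X: "\<And>n. X n \<in> \<A>" and g: "\<And>n. g n \<in> mod_hom R (C n) (X n)"
    and h: "\<And>n. h n \<in> mod_hom R (X n) (C (n + Suc (k n)))"
    and hg: "\<And>n x. x \<in> carrier (C n) \<Longrightarrow> seq_map C f n (Suc (k n)) x = h n (g n x)"
    using seq_map_factors[OF col fp CU MA] by metis
  \<comment> \<open>From stage \<open>n\<close> the subsequence jumps to
    \<open>n + Suc (k n)\<close>, up to which the composite is known to factor. The Mittag-Leffler
    property is then proved for the subsequence itself, which again has colimit
    \<open>M\<close>.\<close>
  define r where "r = rec_nat 0 (\<lambda>_ n. n + Suc (k n))"
  have r: "r (Suc i) = r i + Suc (k (r i))" for i by (simp add: r_def)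
  let ?C = "\<lambda>i. C (r i)" and ?f = "\<lambda>i. seq_map C f (r i) (Suc (k (r i)))"
  have col': "sequence_colimit R ?C ?f M (\<lambda>i. c (r i))"
    by (rule sequence_colimit_subsequence[OF col, of r]) (simp_all add: r)
  interpret C': sequence_colimit R ?C ?f M "\<lambda>i. c (r i)" by (rule col')
  have lim: "is_sequence_limit R \<U> ?C ?f M"
    by (rule sequence_colimit_imp_limit[OF CU A_Rmod[OF MA] col'])
  have fac: "?f i \<in> factor_ideal R \<A> (?C i) (?C (Suc i))" for i
  proof -
    have "?f i = compose (carrier (?C i)) (h (r i)) (g (r i))"
      using hg by (intro extensionalityI[of _ "carrier (?C i)"] mod_hom_extensional[OF C'.f])
        (simp_all add: compose_eq del: seq_map.simps)
    moreover have "h (r i) \<in> mod_hom R (X (r i)) (?C (Suc i))" using h r by simp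
    ultimately show ?thesis
      unfolding factor_ideal_def using C'.f fp X g by blast
  qed
  have "Mittag_Leffler (\<lambda>n. Hom_group R (?C n) B) (\<lambda>n g. compose (carrier (?C n)) g (?f n))"
    if B: "B \<in> \<B>" for B
  proof (rule C'.Mittag_Leffler_Hom[OF B_module[OF B]])
    obtain D \<delta> where D: "D \<in> \<B>" and \<delta>: "\<delta> \<in> mod_hom R D (direct_sum UNIV (\<lambda>_::nat. B))"
      "bij_betw \<delta> (carrier D) (carrier (direct_sum UNIV (\<lambda>_::nat. B)))"
      by (rule B_direct_sum[of "\<lambda>_. B", OF B])
    show "Ext1_vanishes R M (direct_sum UNIV (\<lambda>_::nat. B))"
      by (rule Ext1_vanishes_iso[OF A_module[OF MA] B_module[OF D]
            right_module_direct_sum[OF ring B_module[OF B]] Ext1_A_B[OF MA D] \<delta>])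
    show "finitely_generated R (?C n)" for n by (rule finitely_presented_imp_generated[OF fp])
  qed
  with lim fp fac show ?thesis by (intro exI[of _ ?C] exI[of _ ?f]) blast
qed

text \<open>Given a cocycle \<open>g\<close> on the kernel of the free cover of \<open>M\<close>, its pushout extension \<open>E\<close> of \<open>M\<close> by \<open>Y\<close>
  has local sections over the \<open>C n\<close>, since the maps \<open>f n\<close> factor through \<open>\<A>\<close>; the vanishing of
  the first derived limit allows one to correct them to a compatible family.\<close>

lemma sequence_imp_A:
  assumes lim: "is_sequence_limit R \<U> C f M"
    and fac: "\<And>n. f n \<in> factor_ideal R \<A> (C n) (C (Suc n))"
    and ml: "\<And>B. B \<in> \<B> \<Longrightarrow> Mittag_Leffler (\<lambda>n. Hom_group R (C n) B)
                      (\<lambda>n g. compose (carrier (C n)) g (f n))"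
  shows "M \<in> \<A>"
proof -
  have f: "f n \<in> mod_hom R (C n) (C (Suc n))" and CU: "C n \<in> Rmod R \<U>" and MU: "M \<in> Rmod R \<U>" for n
    using lim unfolding is_sequence_limit_iff by blast+
  obtain c where c: "\<And>n. c n \<in> mod_hom R (C n) M" and c_f: "\<And>n x. x \<in> carrier (C n) \<Longrightarrow> c (Suc n) (f n x) = c n x"
    and up: "\<forall>N\<in>Rmod R \<U>. \<forall>d. (\<forall>n. d n \<in> mod_hom R (C n) N) \<and>
           (\<forall>n. \<forall>x\<in>carrier (C n). d (Suc n) (f n x) = d n x) \<longrightarrow>
           (\<exists>!h. h \<in> mod_hom R M N \<and> (\<forall>n. \<forall>x\<in>carrier (C n). h (c n x) = d n x))"
    using lim unfolding is_sequence_limit_iff by blast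
  note Cm = Rmod_module[OF CU] and Mm = Rmod_module[OF MU]
  have "\<exists>X\<in>\<A>. \<exists>g\<in>mod_hom R (C n) X. \<exists>h\<in>mod_hom R X (C (Suc n)). f n = compose (carrier (C n)) h g" for n
    using fac[of n] unfolding factor_ideal_def by blast
  then obtain X g h where X: "\<And>n. X n \<in> \<A>" and g: "\<And>n. g n \<in> mod_hom R (C n) (X n)"
    and h: "\<And>n. h n \<in> mod_hom R (X n) (C (Suc n))" and fhg: "\<And>n. f n = compose (carrier (C n)) (h n) (g n)"
    by metis
  have f_eq: "f n x = h n (g n x)" if "x \<in> carrier (C n)" for n x using that fhg[of n] by (simp add: compose_eq)
  interpret seq: module_sequence R C f by (rule module_sequence.intro) (rule Cm f)+
  interpret R: ring R by (rule ring)
  show ?thesis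
  proof (rule A_I[OF MU])
    fix Y assume Y: "Y \<in> \<B>"
    note Ym = B_module[OF Y]
    interpret Y: right_module R Y by (rule Ym)
    let ?F = "free_module R (carrier M)" and ?K = "free_cover_kernel R M" and ?c = "free_cover_map R M"
    note Fr = R.right_module_free[of "carrier M"] and K = free_cover_kernel_sub[OF Mm] and cov = free_cover_map[OF Mm]
    interpret F: right_module R ?F by (rule Fr)
    interpret cov: module_hom R ?F M ?c by (intro module_homI Fr Mm cov(1))
    show "Ext1_vanishes R M Y"
      unfolding Ext1_vanishes_def
    proof
      fix \<gamma> assume \<gamma>: "\<gamma> \<in> mod_hom R ?K Y"
      interpret \<gamma>: module_hom R ?K Y \<gamma> by (intro module_homI K(4) Ym \<gamma>)
      have \<gamma>_ops: "\<gamma> \<zero>\<^bsub>?F\<^esub> = \<zero>\<^bsub>Y\<^esub>"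
        "\<And>u v. \<lbrakk>u \<in> carrier ?K; v \<in> carrier ?K\<rbrakk> \<Longrightarrow> \<gamma> (u \<oplus>\<^bsub>?F\<^esub> v) = \<gamma> u \<oplus>\<^bsub>Y\<^esub> \<gamma> v"
        "\<And>a u. \<lbrakk>a \<in> carrier R; u \<in> carrier ?K\<rbrakk> \<Longrightarrow> \<gamma> (a \<odot>\<^bsub>?F\<^esub> u) = a \<odot>\<^bsub>Y\<^esub> \<gamma> u"
        using \<gamma>.zero \<gamma>.add \<gamma>.smult K(3)
        by (simp_all add: free_cover_kernel_def)
      have Kcl: "u \<in> carrier ?F" "\<zero>\<^bsub>?F\<^esub> \<in> carrier ?K" if "u \<in> carrier ?K" for u
        using that K(2) unfolding module_closed_def by auto
      let ?P = "pair_module ?F Y"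
      have P: "right_module R ?P" by (rule right_module_pair[OF Fr Ym])
      have Pc: "carrier ?P = carrier ?F \<times> carrier Y" "\<zero>\<^bsub>?P\<^esub> = (\<zero>\<^bsub>?F\<^esub>, \<zero>\<^bsub>Y\<^esub>)"
        and Pa: "\<And>u y v z. (u, y) \<oplus>\<^bsub>?P\<^esub> (v, z) = (u \<oplus>\<^bsub>?F\<^esub> v, y \<oplus>\<^bsub>Y\<^esub> z)"
        and Ps: "\<And>a u y. a \<odot>\<^bsub>?P\<^esub> (u, y) = (a \<odot>\<^bsub>?F\<^esub> u, a \<odot>\<^bsub>Y\<^esub> y)"
        by (simp_all add: pair_module_def)
      \<comment> \<open>The extension is the pushout of the free cover along
        \<open>\<gamma>\<close>: pairs modulo the identification of \<open>(u, 0)\<close> with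
        \<open>(0, \<gamma> u)\<close> for \<open>u\<close> in the syzygy. The condition says that
        the second entry is minus \<open>\<gamma> u\<close>.\<close>
      define W where "W = {(u, y). u \<in> carrier ?K \<and> y \<in> carrier Y \<and> \<gamma> u \<oplus>\<^bsub>Y\<^esub> y = \<zero>\<^bsub>Y\<^esub>}"
      have W: "module_closed R ?P W"
      proof (rule module_closedI)
        show "W \<subseteq> carrier ?P" using Kcl by (auto simp: W_def Pc)
        show "\<zero>\<^bsub>?P\<^esub> \<in> W" using K(2) \<gamma>_ops(1) by (simp add: W_def Pc module_closed_def)
      next
        fix x y assume "x \<in> W" "y \<in> W"
        then obtain u z v w where xy: "x = (u, z)" "y = (v, w)" "u \<in> carrier ?K" "z \<in> carrier Y"
          "\<gamma> u \<oplus>\<^bsub>Y\<^esub> z = \<zero>\<^bsub>Y\<^esub>" "v \<in> carrier ?K" "w \<in> carrier Y" "\<gamma> v \<oplus>\<^bsub>Y\<^esub> w = \<zero>\<^bsub>Y\<^esub>"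
          unfolding W_def by auto
        have "(\<gamma> u \<oplus>\<^bsub>Y\<^esub> \<gamma> v) \<oplus>\<^bsub>Y\<^esub> (z \<oplus>\<^bsub>Y\<^esub> w) = (\<gamma> u \<oplus>\<^bsub>Y\<^esub> z) \<oplus>\<^bsub>Y\<^esub> (\<gamma> v \<oplus>\<^bsub>Y\<^esub> w)"
          using xy(3,4,6,7) \<gamma>.closed by (simp only: Y.a_ac Y.a_closed)
        then have "(\<gamma> u \<oplus>\<^bsub>Y\<^esub> \<gamma> v) \<oplus>\<^bsub>Y\<^esub> (z \<oplus>\<^bsub>Y\<^esub> w) = \<zero>\<^bsub>Y\<^esub>" using xy by simp
        moreover have "u \<oplus>\<^bsub>?F\<^esub> v \<in> carrier ?K" using xy K(2) by (simp add: module_closed_def)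
        ultimately show "x \<oplus>\<^bsub>?P\<^esub> y \<in> W" using xy by (simp add: Pa W_def \<gamma>_ops)
      next
        fix a x assume a: "a \<in> carrier R" and "x \<in> W"
        then obtain u z where x: "x = (u, z)" "u \<in> carrier ?K" "z \<in> carrier Y" "\<gamma> u \<oplus>\<^bsub>Y\<^esub> z = \<zero>\<^bsub>Y\<^esub>"
          unfolding W_def by auto
        have "a \<odot>\<^bsub>Y\<^esub> \<gamma> u \<oplus>\<^bsub>Y\<^esub> a \<odot>\<^bsub>Y\<^esub> z = a \<odot>\<^bsub>Y\<^esub> (\<gamma> u \<oplus>\<^bsub>Y\<^esub> z)"
          using x(2,3) a \<gamma>.closed by (simp only: Y.ract_add_module)
        then have "a \<odot>\<^bsub>Y\<^esub> \<gamma> u \<oplus>\<^bsub>Y\<^esub> a \<odot>\<^bsub>Y\<^esub> z = \<zero>\<^bsub>Y\<^esub>" using x a by (simp add: Y.smult_r_null)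
        moreover have "a \<odot>\<^bsub>?F\<^esub> u \<in> carrier ?K" using x a K(2) by (simp add: module_closed_def)
        ultimately show "a \<odot>\<^bsub>?P\<^esub> x \<in> W" using x a by (simp add: Ps W_def \<gamma>_ops Y.ract_closed)
      qed
      obtain Q \<xi>0 where Q: "right_module R Q" "carrier Q \<subseteq> carrier ?P" and \<xi>0: "\<xi>0 \<in> mod_hom R ?P Q"
        "\<xi>0 ` carrier ?P = carrier Q" "\<And>x. x \<in> carrier ?P \<Longrightarrow> \<xi>0 x = \<zero>\<^bsub>Q\<^esub> \<longleftrightarrow> x \<in> W"
        by (rule quotient_module_exists[OF P W]) blast
      \<comment> \<open>The universal property of \<open>M\<close> is available only against small
        modules, hence the pushout is replaced by a small copy \<open>E\<close>.\<close>
      have "small_set \<U> (carrier ?P)"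
        unfolding Pc by (intro small_Times small_free small_U Rmod_U[OF MU] Rmod_U[OF B_Rmod[OF Y]])
      then have "small_set \<U> (carrier Q)" using Q(2) by (rule small_subset)
      then obtain E \<tau> where EU: "E \<in> Rmod R \<U>" and \<tau>: "\<tau> \<in> mod_hom R Q E" "bij_betw \<tau> (carrier Q) (carrier E)"
        by (rule small_module_copy[OF Q(1)])
      note Em = Rmod_module[OF EU]
      interpret \<tau>: module_hom R Q E \<tau> by (intro module_homI Q(1) Em \<tau>(1))
      define \<xi> where "\<xi> = compose (carrier ?P) \<tau> \<xi>0"
      have \<xi>: "\<xi> \<in> mod_hom R ?P E" unfolding \<xi>_def by (rule mod_hom_comp[OF P \<xi>0(1) \<tau>(1)])
      have \<xi>_onto: "\<xi> ` carrier ?P = carrier E"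
      proof -
        have "\<xi> ` carrier ?P = \<tau> ` (\<xi>0 ` carrier ?P)" by (auto simp: \<xi>_def image_iff compose_eq)
        then show ?thesis using \<tau>(2) \<xi>0(2) by (simp add: bij_betw_def)
      qed
      have \<xi>_ker: "\<xi> x = \<zero>\<^bsub>E\<^esub> \<longleftrightarrow> x \<in> W" if x: "x \<in> carrier ?P" for x
      proof -
        have inj: "inj_on \<tau> (carrier Q)" using \<tau>(2) by (simp add: bij_betw_def)
        have "\<tau> (\<xi>0 x) = \<zero>\<^bsub>E\<^esub> \<longleftrightarrow> \<xi>0 x = \<zero>\<^bsub>Q\<^esub>"
          using inj_on_eq_iff[OF inj mod_hom_closed[OF \<xi>0(1) x] \<tau>.M.zero_closed] by simp
        then show ?thesis using x \<xi>0(3)[OF x] by (simp add: \<xi>_def compose_eq)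
      qed
      interpret \<xi>: module_hom R ?P E \<xi> by (intro module_homI P Em \<xi>)
      have j: "(\<lambda>y\<in>carrier Y. \<xi> (\<zero>\<^bsub>?F\<^esub>, y)) \<in> mod_hom R Y E" (is "?j \<in> _")
      proof (rule mod_hom_restrictI[OF Ym])
        fix y assume y: "y \<in> carrier Y"
        show "\<xi> (\<zero>\<^bsub>?F\<^esub>, y) \<in> carrier E" using y by (intro \<xi>.closed) (simp add: Pc)
        show "\<xi> (\<zero>\<^bsub>?F\<^esub>, y \<oplus>\<^bsub>Y\<^esub> z) = \<xi> (\<zero>\<^bsub>?F\<^esub>, y) \<oplus>\<^bsub>E\<^esub> \<xi> (\<zero>\<^bsub>?F\<^esub>, z)" if "z \<in> carrier Y" for z
          using \<xi>.add[of "(\<zero>\<^bsub>?F\<^esub>, y)" "(\<zero>\<^bsub>?F\<^esub>, z)"] y that by (simp add: Pc Pa)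
        show "\<xi> (\<zero>\<^bsub>?F\<^esub>, a \<odot>\<^bsub>Y\<^esub> y) = a \<odot>\<^bsub>E\<^esub> \<xi> (\<zero>\<^bsub>?F\<^esub>, y)" if "a \<in> carrier R" for a
          using \<xi>.smult[of a "(\<zero>\<^bsub>?F\<^esub>, y)"] y that by (simp add: Pc Ps F.smult_r_null)
      qed
      define j where "j = ?j"
      have jh: "j \<in> mod_hom R Y E" unfolding j_def by (rule j)
      have j_eq: "j y = \<xi> (\<zero>\<^bsub>?F\<^esub>, y)" if "y \<in> carrier Y" for y using that by (simp add: j_def)
      interpret j: module_hom R Y E j by (intro module_homI Ym Em jh)
      have j_inj: "inj_on j (carrier Y)"
      proof (rule inj_onI)
        fix y z assume yz: "y \<in> carrier Y" "z \<in> carrier Y" "j y = j z"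
        then have "j (y \<ominus>\<^bsub>Y\<^esub> z) = \<zero>\<^bsub>E\<^esub>" by simp
        then have "(\<zero>\<^bsub>?F\<^esub>, y \<ominus>\<^bsub>Y\<^esub> z) \<in> W" using \<xi>_ker yz by (simp add: j_eq Pc)
        then have "y \<ominus>\<^bsub>Y\<^esub> z = \<zero>\<^bsub>Y\<^esub>" using yz by (simp add: W_def \<gamma>_ops)
        then show "y = z" using yz Y.diff_eq_zero_iff by simp
      qed
      let ?pr = "\<lambda>x\<in>carrier ?P. ?c (fst x)"
      have pr: "?pr \<in> mod_hom R ?P M"
        by (rule mod_hom_restrictI[OF P]) (auto simp: Pc pair_module_def)
      have "\<exists>e\<in>mod_hom R E M. \<forall>x\<in>carrier ?P. e (\<xi> x) = ?pr x"
      proof (rule mod_hom_descend[OF P Em Mm \<xi> pr \<xi>_onto])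
        fix x assume x: "x \<in> carrier ?P" "\<xi> x = \<zero>\<^bsub>E\<^esub>"
        then have "fst x \<in> carrier ?K" using \<xi>_ker by (auto simp: W_def)
        then show "?pr x = \<zero>\<^bsub>M\<^esub>" using x(1) by (simp add: K(1))
      qed
      then obtain e where e: "e \<in> mod_hom R E M" and e\<xi>': "\<forall>x\<in>carrier ?P. e (\<xi> x) = ?pr x" by (rule bexE)
      have e\<xi>: "e (\<xi> (u, y)) = ?c u" if "u \<in> carrier ?F" "y \<in> carrier Y" for u y
        using bspec[OF e\<xi>', of "(u, y)"] that by (simp add: Pc)
      have rep: "\<exists>u\<in>carrier ?F. \<exists>y\<in>carrier Y. z = \<xi> (u, y)" if "z \<in> carrier E" for z
        using that unfolding \<xi>_onto[symmetric] Pc by auto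
      interpret e: module_hom R E M e by (intro module_homI Em Mm e)
      have e_onto: "e ` carrier E = carrier M"
      proof
        show "e ` carrier E \<subseteq> carrier M" by auto
        show "carrier M \<subseteq> e ` carrier E"
        proof
          fix z assume "z \<in> carrier M"
          then have "z \<in> ?c ` carrier ?F" using cov(2) by simp
          then obtain u where u: "u \<in> carrier ?F" "z = ?c u" by (elim imageE) (rule that)
          then have "z = e (\<xi> (u, \<zero>\<^bsub>Y\<^esub>))" using e\<xi> by simp
          moreover have "\<xi> (u, \<zero>\<^bsub>Y\<^esub>) \<in> carrier E" using u by (intro \<xi>.closed) (simp add: Pc)
          ultimately show "z \<in> e ` carrier E" by simp
        qed
      qed
      have \<xi>K: "\<xi> (u, \<zero>\<^bsub>Y\<^esub>) = j (\<gamma> u)" if u: "u \<in> carrier ?K" for u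
      proof -
        have uF: "u \<in> carrier ?F" using Kcl u by blast
        have "(u, \<ominus>\<^bsub>Y\<^esub> \<gamma> u) \<in> W" using u \<gamma>.closed by (simp add: W_def Y.r_neg)
        then have "\<xi> (u, \<ominus>\<^bsub>Y\<^esub> \<gamma> u) = \<zero>\<^bsub>E\<^esub>" using \<xi>_ker u uF \<gamma>.closed by (simp add: Pc)
        moreover have "(u, \<zero>\<^bsub>Y\<^esub>) = (u, \<ominus>\<^bsub>Y\<^esub> \<gamma> u) \<oplus>\<^bsub>?P\<^esub> (\<zero>\<^bsub>?F\<^esub>, \<gamma> u)"
          using u uF \<gamma>.closed by (simp add: Pa Y.l_neg)
        moreover have "\<xi> ((u, \<ominus>\<^bsub>Y\<^esub> \<gamma> u) \<oplus>\<^bsub>?P\<^esub> (\<zero>\<^bsub>?F\<^esub>, \<gamma> u)) = \<xi> (u, \<ominus>\<^bsub>Y\<^esub> \<gamma> u) \<oplus>\<^bsub>E\<^esub> \<xi> (\<zero>\<^bsub>?F\<^esub>, \<gamma> u)"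
          using u uF \<gamma>.closed by (intro \<xi>.add) (simp_all add: Pc)
        ultimately show ?thesis using u \<gamma>.closed by (simp add: j_eq[symmetric])
      qed
      have ker: "j ` carrier Y = {x \<in> carrier E. e x = \<zero>\<^bsub>M\<^esub>}"
      proof
        show "j ` carrier Y \<subseteq> {x \<in> carrier E. e x = \<zero>\<^bsub>M\<^esub>}" using e\<xi>[of "\<zero>\<^bsub>?F\<^esub>"] j_eq j.closed by auto
        show "{x \<in> carrier E. e x = \<zero>\<^bsub>M\<^esub>} \<subseteq> j ` carrier Y"
        proof
          fix z assume "z \<in> {x \<in> carrier E. e x = \<zero>\<^bsub>M\<^esub>}"
          then have z: "z \<in> carrier E" "e z = \<zero>\<^bsub>M\<^esub>" by auto
          obtain u y where uy: "u \<in> carrier ?F" "y \<in> carrier Y" "z = \<xi> (u, y)" using rep[OF z(1)] by blast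
          then have u: "u \<in> carrier ?K" using z(2) e\<xi> by (simp add: K(1))
          have "(u, y) = (u, \<zero>\<^bsub>Y\<^esub>) \<oplus>\<^bsub>?P\<^esub> (\<zero>\<^bsub>?F\<^esub>, y)" using uy by (simp add: Pa)
          then have "z = \<xi> (u, \<zero>\<^bsub>Y\<^esub>) \<oplus>\<^bsub>E\<^esub> \<xi> (\<zero>\<^bsub>?F\<^esub>, y)"
            using uy \<xi>.add[of "(u, \<zero>\<^bsub>Y\<^esub>)" "(\<zero>\<^bsub>?F\<^esub>, y)"] by (simp add: Pc)
          then have "z = j (\<gamma> u \<oplus>\<^bsub>Y\<^esub> y)" using \<xi>K[OF u] uy u \<gamma>.closed by (simp add: j_eq[symmetric])
          moreover have "\<gamma> u \<oplus>\<^bsub>Y\<^esub> y \<in> carrier Y" using u uy \<gamma>.closed by simp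
          ultimately show "z \<in> j ` carrier Y" by (rule image_eqI)
        qed
      qed
      \<comment> \<open>The map \<open>c n\<close> equals \<open>c (Suc n)\<close> after
        \<open>h n\<close> after \<open>g n\<close>. The part starting at \<open>X n\<close> lifts
        to \<open>E\<close> because Ext1(X n, Y) = 0, and \<open>g n\<close> is put in front of the
        lift.\<close>
      have "\<exists>s\<in>mod_hom R (C n) E. \<forall>x\<in>carrier (C n). e (s x) = c n x" for n
      proof -
        note Xm = A_module[OF X]
        have ch: "compose (carrier (X n)) (c (Suc n)) (h n) \<in> mod_hom R (X n) M" by (rule mod_hom_comp[OF Xm h c])
        obtain t where t: "t \<in> mod_hom R (X n) E"
          "\<And>x. x \<in> carrier (X n) \<Longrightarrow> e (t x) = compose (carrier (X n)) (c (Suc n)) (h n) x"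
          by (rule Ext1_vanishes_lift[OF Xm Ym Em Mm Ext1_A_B[OF X Y] jh j_inj e e_onto ker ch]) blast
        show ?thesis
        proof (intro bexI ballI)
          show "compose (carrier (C n)) t (g n) \<in> mod_hom R (C n) E" by (rule mod_hom_comp[OF Cm g t(1)])
          show "e (compose (carrier (C n)) t (g n) x) = c n x" if x: "x \<in> carrier (C n)" for x
            using x t(2)[OF mod_hom_closed[OF g x]] mod_hom_closed[OF g x] c_f[OF x] f_eq[OF x]
            by (simp add: compose_eq)
        qed
      qed
      then obtain s where s: "\<And>n. s n \<in> mod_hom R (C n) E"
        and es: "\<And>n x. x \<in> carrier (C n) \<Longrightarrow> e (s n x) = c n x" by metis
      have sc: "s n x \<in> carrier E" if "x \<in> carrier (C n)" for n x by (rule mod_hom_closed[OF s that])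
      \<comment> \<open>Consecutive local sections differ by a map into the kernel of
        \<open>e\<close>, that is, into \<open>Y\<close>.\<close>
      have "\<exists>y\<in>mod_hom R (C n) Y. \<forall>x\<in>carrier (C n). j (y x) = s n x \<ominus>\<^bsub>E\<^esub> s (Suc n) (f n x)" for n
      proof -
        let ?d = "\<lambda>x\<in>carrier (C n). s n x \<ominus>\<^bsub>E\<^esub> compose (carrier (C n)) (s (Suc n)) (f n) x"
        have d: "?d \<in> mod_hom R (C n) E" by (rule mod_hom_diff[OF Cm Em s mod_hom_comp[OF Cm f s]])
        have "\<exists>y\<in>mod_hom R (C n) Y. \<forall>x\<in>carrier (C n). j (y x) = ?d x"
        proof (rule mod_hom_lift_inj[OF Cm Ym Em jh j_inj d])
          fix x assume x: "x \<in> carrier (C n)"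
          have "e (s n x \<ominus>\<^bsub>E\<^esub> s (Suc n) (f n x)) = \<zero>\<^bsub>M\<^esub>"
            using x es c_f sc mod_hom_closed[OF c x] by (simp add: cov.N.diff_self)
          then show "?d x \<in> j ` carrier Y" unfolding ker using x sc by (simp add: compose_eq)
        qed
        then show ?thesis by (simp add: compose_eq cong: ball_cong)
      qed
      then obtain y where y: "\<And>n. y n \<in> mod_hom R (C n) Y"
        and jy: "\<And>n x. x \<in> carrier (C n) \<Longrightarrow> j (y n x) = s n x \<ominus>\<^bsub>E\<^esub> s (Suc n) (f n x)" by metis
      let ?H = "\<lambda>n. Hom_group R (C n) Y" and ?h = "\<lambda>n (g :: 'm \<Rightarrow> 'm). compose (carrier (C n)) g (f n)"
      have "inverse_sequence ?H ?h"
      proof (rule inverse_sequence.intro)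
        show "comm_group (?H n)" "?h n \<in> hom (?H (Suc n)) (?H n)" for n
          using ml[OF Y] unfolding Mittag_Leffler_def by blast+
      qed
      then interpret H: inverse_sequence ?H ?h .
      have yH: "y n \<in> carrier (?H n)" for n using y by (simp add: Hom_group_def)
      obtain x where "\<forall>n. x n \<in> carrier (?H n) \<and> x n = ?h n (x (Suc n)) \<otimes>\<^bsub>?H n\<^esub> y n"
        using H.Mittag_Leffler_telescope[OF ml[OF Y] yH] by (rule exE)
      then have x: "x n \<in> carrier (?H n)" "x n = ?h n (x (Suc n)) \<otimes>\<^bsub>?H n\<^esub> y n" for n
        by blast+
      have xh: "x n \<in> mod_hom R (C n) Y" for n using x(1) by (simp add: Hom_group_def)
      have x_eq: "x n a = x (Suc n) (f n a) \<oplus>\<^bsub>Y\<^esub> y n a" if a: "a \<in> carrier (C n)" for n a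
        using fun_cong[OF x(2)[of n], of a] a by (simp add: Hom_group_def compose_eq)
      \<comment> \<open>The signs fit the telescoping equation: \<open>x n\<close> exceeds
        \<open>x (Suc n)\<close> after \<open>f n\<close> by the discrepancy \<open>y n\<close>, so
        subtracting \<open>j\<close> after \<open>x n\<close> from \<open>s n\<close> makes the
        sections compatible.\<close>
      define \<sigma> where "\<sigma> n = (\<lambda>a\<in>carrier (C n). s n a \<ominus>\<^bsub>E\<^esub> compose (carrier (C n)) j (x n) a)" for n
      have \<sigma>: "\<sigma> n \<in> mod_hom R (C n) E" for n
        unfolding \<sigma>_def by (rule mod_hom_diff[OF Cm Em s mod_hom_comp[OF Cm xh jh]])
      have \<sigma>_eq: "\<sigma> n a = s n a \<ominus>\<^bsub>E\<^esub> j (x n a)" if "a \<in> carrier (C n)" for n a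
        using that by (simp add: \<sigma>_def compose_eq)
      have \<sigma>_f: "\<sigma> (Suc n) (f n a) = \<sigma> n a" if a: "a \<in> carrier (C n)" for n a
      proof -
        note fa = mod_hom_closed[OF f a]
        have cl: "s n a \<in> carrier E" "s (Suc n) (f n a) \<in> carrier E" "j (x (Suc n) (f n a)) \<in> carrier E"
          using sc[OF a] sc[OF fa] j.closed[OF mod_hom_closed[OF xh fa]] by blast+
        have "j (x n a) = j (x (Suc n) (f n a)) \<oplus>\<^bsub>E\<^esub> (s n a \<ominus>\<^bsub>E\<^esub> s (Suc n) (f n a))"
          using x_eq[OF a] jy[OF a] mod_hom_closed[OF xh fa] mod_hom_closed[OF y a] by simp
        then have "\<sigma> n a = s n a \<ominus>\<^bsub>E\<^esub> (j (x (Suc n) (f n a)) \<oplus>\<^bsub>E\<^esub> (s n a \<ominus>\<^bsub>E\<^esub> s (Suc n) (f n a)))"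
          by (simp add: \<sigma>_eq[OF a])
        also have "\<dots> = s (Suc n) (f n a) \<ominus>\<^bsub>E\<^esub> j (x (Suc n) (f n a))"
          using cl by (simp add: \<tau>.N.minus_eq \<tau>.N.minus_add \<tau>.N.a_ac \<tau>.N.r_neg \<tau>.N.r_neg1 \<tau>.N.r_neg2)
        finally show ?thesis by (simp add: \<sigma>_eq[OF fa])
      qed
      have "\<exists>!h. h \<in> mod_hom R M E \<and> (\<forall>n. \<forall>x\<in>carrier (C n). h (c n x) = \<sigma> n x)"
        using up EU \<sigma> \<sigma>_f by blast
      then obtain t where t: "t \<in> mod_hom R M E" and tc: "\<And>n a. a \<in> carrier (C n) \<Longrightarrow> t (c n a) = \<sigma> n a"
        by (elim ex1E conjE) blast
      \<comment> \<open>Only the universal property of \<open>M\<close> is at hand, so the section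
        property is checked by uniqueness: \<open>e\<close> after \<open>t\<close> and the identity
        both mediate the cocone \<open>c\<close>.\<close>
      have et: "compose (carrier M) e t = (\<lambda>z\<in>carrier M. z)"
      proof -
        have "e (t (c n a)) = c n a" if a: "a \<in> carrier (C n)" for n a
        proof -
          have "j (x n a) \<in> j ` carrier Y" using mod_hom_closed[OF xh a] by (rule imageI)
          then have "e (j (x n a)) = \<zero>\<^bsub>M\<^esub>" "j (x n a) \<in> carrier E" unfolding ker by auto
          then show ?thesis
            using tc[OF a] \<sigma>_eq[OF a] es[OF a] sc[OF a] mod_hom_closed[OF c a] by (simp add: cov.N.diff_zero)
        qed
        then have "compose (carrier M) e t \<in> mod_hom R M M \<and>
            (\<forall>n. \<forall>a\<in>carrier (C n). compose (carrier M) e t (c n a) = c n a)"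
          using mod_hom_comp[OF Mm t e] mod_hom_closed[OF c] by (simp add: compose_eq)
        moreover have "(\<lambda>z\<in>carrier M. z) \<in> mod_hom R M M \<and>
            (\<forall>n. \<forall>a\<in>carrier (C n). (\<lambda>z\<in>carrier M. z) (c n a) = c n a)"
          using mod_hom_id[OF Mm] mod_hom_closed[OF c] by simp
        moreover have "\<exists>!h. h \<in> mod_hom R M M \<and> (\<forall>n. \<forall>x\<in>carrier (C n). h (c n x) = c n x)"
          using bspec[OF up MU] c c_f by blast
        ultimately show ?thesis by (elim ex1E) metis
      qed
      have et': "e (t z) = z" if "z \<in> carrier M" for z
        using fun_cong[OF et, of z] that by (simp add: compose_eq)
      \<comment> \<open>There are two maps from the free module to \<open>E\<close> over
        \<open>M\<close>: the canonical one, and the free cover followed by the section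
        \<open>t\<close>. Their difference lands in \<open>Y\<close>; on the syzygy the second map
        vanishes and the first is \<open>j\<close> after \<open>\<gamma>\<close>, so the difference
        extends \<open>\<gamma>\<close>.\<close>
      let ?d = "\<lambda>u\<in>carrier ?F. (\<lambda>u\<in>carrier ?F. \<xi> (u, \<zero>\<^bsub>Y\<^esub>)) u \<ominus>\<^bsub>E\<^esub> compose (carrier ?F) t ?c u"
      have \<xi>1: "(\<lambda>u\<in>carrier ?F. \<xi> (u, \<zero>\<^bsub>Y\<^esub>)) \<in> mod_hom R ?F E"
      proof (rule mod_hom_restrictI[OF Fr])
        fix u assume u: "u \<in> carrier ?F"
        show "\<xi> (u, \<zero>\<^bsub>Y\<^esub>) \<in> carrier E" using u by (intro \<xi>.closed) (simp add: Pc)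
        show "\<xi> (u \<oplus>\<^bsub>?F\<^esub> v, \<zero>\<^bsub>Y\<^esub>) = \<xi> (u, \<zero>\<^bsub>Y\<^esub>) \<oplus>\<^bsub>E\<^esub> \<xi> (v, \<zero>\<^bsub>Y\<^esub>)" if "v \<in> carrier ?F" for v
          using \<xi>.add[of "(u, \<zero>\<^bsub>Y\<^esub>)" "(v, \<zero>\<^bsub>Y\<^esub>)"] u that by (simp add: Pc Pa)
        show "\<xi> (a \<odot>\<^bsub>?F\<^esub> u, \<zero>\<^bsub>Y\<^esub>) = a \<odot>\<^bsub>E\<^esub> \<xi> (u, \<zero>\<^bsub>Y\<^esub>)" if "a \<in> carrier R" for a
          using \<xi>.smult[of a "(u, \<zero>\<^bsub>Y\<^esub>)"] u that by (simp add: Pc Ps Y.smult_r_null)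
      qed
      have d: "?d \<in> mod_hom R ?F E" by (rule mod_hom_diff[OF Fr Em \<xi>1 mod_hom_comp[OF Fr cov(1) t]])
      have tcl: "t (?c u) \<in> carrier E" "\<xi> (u, \<zero>\<^bsub>Y\<^esub>) \<in> carrier E" if "u \<in> carrier ?F" for u
        using mod_hom_closed[OF t cov.closed[OF that]] mod_hom_closed[OF \<xi>1 that] that by simp_all
      have "\<exists>h\<in>mod_hom R ?F Y. \<forall>u\<in>carrier ?F. j (h u) = ?d u"
      proof (rule mod_hom_lift_inj[OF Fr Ym Em jh j_inj d])
        fix u assume u: "u \<in> carrier ?F"
        have "e (\<xi> (u, \<zero>\<^bsub>Y\<^esub>) \<ominus>\<^bsub>E\<^esub> t (?c u)) = \<zero>\<^bsub>M\<^esub>"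
          using u tcl[OF u] e\<xi>[OF u, of "\<zero>\<^bsub>Y\<^esub>"] et'[of "?c u"] by (simp add: cov.N.diff_self)
        then show "?d u \<in> j ` carrier Y" unfolding ker using u tcl[OF u] by (simp add: compose_eq)
      qed
      then obtain k where k: "k \<in> mod_hom R ?F Y" and jk: "\<forall>u\<in>carrier ?F. j (k u) = ?d u" by (rule bexE)
      show "\<exists>h\<in>mod_hom R ?F Y. \<forall>u\<in>carrier ?K. h u = \<gamma> u"
      proof (rule bexI[OF _ k], rule ballI)
        fix u assume u: "u \<in> carrier ?K"
        then have uF: "u \<in> carrier ?F" "?c u = \<zero>\<^bsub>M\<^esub>" by (simp_all add: K(1))
        have "t \<zero>\<^bsub>M\<^esub> = \<zero>\<^bsub>E\<^esub>" by (rule module_hom.zero[OF module_homI[OF Mm Em t]])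
        then have "j (k u) = \<xi> (u, \<zero>\<^bsub>Y\<^esub>)"
          using bspec[OF jk uF(1)] uF tcl[OF uF(1)] by (simp add: compose_eq)
        then have "j (k u) = j (\<gamma> u)" using \<xi>K[OF u] by simp
        then show "k u = \<gamma> u" using inj_onD[OF j_inj] mod_hom_closed[OF k uF(1)] \<gamma>.closed[OF u] by simp
      qed
    qed
  qed
qed

text \<open>The modules through which the maps \<open>f n\<close> factor form an interleaved system with the same limit.\<close>

lemma sequence_imp_A_of_limits:
  assumes lim: "is_sequence_limit R \<U> C f M"
    and fac: "\<And>n. f n \<in> factor_ideal R \<A> (C n) (C (Suc n))"
    and closed: "closed_countable_direct_limits R \<U> \<A>"
  shows "M \<in> \<A>"
proof -
  have f: "f n \<in> mod_hom R (C n) (C (Suc n))" and CU: "C n \<in> Rmod R \<U>" and MU: "M \<in> Rmod R \<U>" for n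
    using lim unfolding is_sequence_limit_iff by blast+
  obtain c where c: "\<And>n. c n \<in> mod_hom R (C n) M" and c_f: "\<And>n x. x \<in> carrier (C n) \<Longrightarrow> c (Suc n) (f n x) = c n x"
    and up: "\<forall>N\<in>Rmod R \<U>. \<forall>d. (\<forall>n. d n \<in> mod_hom R (C n) N) \<and>
           (\<forall>n. \<forall>x\<in>carrier (C n). d (Suc n) (f n x) = d n x) \<longrightarrow>
           (\<exists>!h. h \<in> mod_hom R M N \<and> (\<forall>n. \<forall>x\<in>carrier (C n). h (c n x) = d n x))"
    using lim unfolding is_sequence_limit_iff by blast
  note Cm = Rmod_module[OF CU] and Mm = Rmod_module[OF MU]
  have "\<exists>X\<in>\<A>. \<exists>g\<in>mod_hom R (C n) X. \<exists>h\<in>mod_hom R X (C (Suc n)). f n = compose (carrier (C n)) h g" for n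
    using fac[of n] unfolding factor_ideal_def by blast
  then obtain X g h where X: "\<And>n. X n \<in> \<A>" and g: "\<And>n. g n \<in> mod_hom R (C n) (X n)"
    and h: "\<And>n. h n \<in> mod_hom R (X n) (C (Suc n))" and fhg: "\<And>n. f n = compose (carrier (C n)) (h n) (g n)"
    by metis
  have f_eq: "f n x = h n (g n x)" if "x \<in> carrier (C n)" for n x using that fhg[of n] by (simp add: compose_eq)
  note Xm = A_module[OF X]
  \<comment> \<open>In the alternating sequence \<open>C n\<close>, \<open>X n\<close>,
    \<open>C (Suc n)\<close>, \<open>X (Suc n)\<close>, dropping the \<open>C n\<close> leaves a
    sequence in \<open>\<A>\<close>.\<close>
  define z where "z n = compose (carrier (X n)) (g (Suc n)) (h n)" for n
  define c' where "c' n = compose (carrier (X n)) (c (Suc n)) (h n)" for n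
  have z: "z n \<in> mod_hom R (X n) (X (Suc n))" for n unfolding z_def by (rule mod_hom_comp[OF Xm h g])
  have c': "c' n \<in> mod_hom R (X n) M" for n unfolding c'_def by (rule mod_hom_comp[OF Xm h c])
  have hc: "h n x \<in> carrier (C (Suc n))" if "x \<in> carrier (X n)" for n x by (rule mod_hom_closed[OF h that])
  have gc: "g n x \<in> carrier (X n)" if "x \<in> carrier (C n)" for n x by (rule mod_hom_closed[OF g that])
  have z_eq: "z n x = g (Suc n) (h n x)" and c'_eq: "c' n x = c (Suc n) (h n x)" if "x \<in> carrier (X n)" for n x
    using that by (simp_all add: z_def c'_def compose_eq)
  have "is_sequence_limit R \<U> X z M"
    unfolding is_sequence_limit_iff
  proof (intro conjI allI exI[of _ c'] ballI impI)
    show "z n \<in> mod_hom R (X n) (X (Suc n))" "X n \<in> Rmod R \<U>" "c' n \<in> mod_hom R (X n) M" for n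
      by (rule z, rule A_Rmod[OF X], rule c')
    show "M \<in> Rmod R \<U>" by (rule MU)
    show "c' (Suc n) (z n x) = c' n x" if x: "x \<in> carrier (X n)" for n x
      using c_f[OF hc[OF x]] f_eq[OF hc[OF x]] z_eq[OF x] c'_eq[OF x] c'_eq[OF gc[OF hc[OF x]]] by simp
    fix N d
    assume N: "N \<in> Rmod R \<U>" and dd: "(\<forall>n. d n \<in> mod_hom R (X n) N) \<and>
      (\<forall>n. \<forall>x\<in>carrier (X n). d (Suc n) (z n x) = d n x)"
    have d: "\<And>n. d n \<in> mod_hom R (X n) N" "\<And>n x. x \<in> carrier (X n) \<Longrightarrow> d (Suc n) (z n x) = d n x"
      using dd by blast+
    define d' where "d' n = compose (carrier (C n)) (d n) (g n)" for n
    have d': "d' n \<in> mod_hom R (C n) N" for n unfolding d'_def by (rule mod_hom_comp[OF Cm g d(1)])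
    have d'_eq: "d' n x = d n (g n x)" if "x \<in> carrier (C n)" for n x using that by (simp add: d'_def compose_eq)
    have d'_f: "d' (Suc n) (f n x) = d' n x" if x: "x \<in> carrier (C n)" for n x
      using d(2)[OF gc[OF x]] z_eq[OF gc[OF x]] f_eq[OF x] d'_eq[OF x] d'_eq[OF mod_hom_closed[OF f x]] by simp
    \<comment> \<open>A map mediates for the \<open>X n\<close> precisely when it mediates for the
      \<open>C n\<close> with the induced cocone \<open>d'\<close>, so existence and uniqueness
      transfer together.\<close>
    have iff: "(\<forall>n. \<forall>x\<in>carrier (X n). t (c' n x) = d n x) \<longleftrightarrow> (\<forall>n. \<forall>x\<in>carrier (C n). t (c n x) = d' n x)" for t
    proof
      assume a: "\<forall>n. \<forall>x\<in>carrier (X n). t (c' n x) = d n x"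
      show "\<forall>n. \<forall>x\<in>carrier (C n). t (c n x) = d' n x"
      proof (intro allI ballI)
        fix n x assume x: "x \<in> carrier (C n)"
        have "c n x = c' n (g n x)" using c_f[OF x] f_eq[OF x] c'_eq[OF gc[OF x]] by simp
        then show "t (c n x) = d' n x" using a gc[OF x] d'_eq[OF x] by simp
      qed
    next
      assume a: "\<forall>n. \<forall>x\<in>carrier (C n). t (c n x) = d' n x"
      show "\<forall>n. \<forall>x\<in>carrier (X n). t (c' n x) = d n x"
      proof (intro allI ballI)
        fix n x assume x: "x \<in> carrier (X n)"
        show "t (c' n x) = d n x"
          using a hc[OF x] c'_eq[OF x] d'_eq[OF hc[OF x]] z_eq[OF x] d(2)[OF x] by simp
      qed
    qed
    have "\<exists>!t. t \<in> mod_hom R M N \<and> (\<forall>n. \<forall>x\<in>carrier (C n). t (c n x) = d' n x)"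
      using bspec[OF up N] d' d'_f by blast
    then show "\<exists>!t. t \<in> mod_hom R M N \<and> (\<forall>n. \<forall>x\<in>carrier (X n). t (c' n x) = d n x)"
      unfolding iff .
  qed
  then show ?thesis
    using closed X unfolding is_sequence_limit_def closed_countable_direct_limits_def by blast
qed

end

theorem theorem4p8:
  fixes R :: "('r, 'k) ring_scheme"
    and \<U> :: "'m set set"
    and \<A> \<B> :: "('r, 'm) module set"
    and M :: "('r, 'm) module"
  assumes "ring R" and "right_coherent R"
    and "module_universe R \<U>"
    and "complete_cotorsion_pair R \<U> \<A> \<B>"
    and "hereditary_cotorsion_pair R \<U> \<A> \<B>"
    and "closed_countable_direct_sums R \<U> \<B>"
    and "M \<in> Rmod R \<U>" and "countably_presented R M"
  shows
    "(M \<in> \<A> \<longleftrightarrow>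
        (\<exists>C f. is_sequence_limit R \<U> C f M \<and>
           (\<forall>n. finitely_presented R (C n)) \<and>
           (\<forall>n. f n \<in> factor_ideal R \<A> (C n) (C (Suc n))) \<and>
           (\<forall>B\<in>\<B>. Mittag_Leffler (\<lambda>n. Hom_group R (C n) B)
                      (\<lambda>n g. compose (carrier (C n)) g (f n))))) \<and>
     (closed_countable_direct_limits R \<U> \<A> \<longrightarrow>
        (M \<in> \<A> \<longleftrightarrow>
          (\<exists>C f. is_sequence_limit R \<U> C f M \<and>
             (\<forall>n. finitely_presented R (C n)) \<and>
             (\<forall>n. f n \<in> factor_ideal R \<A> (C n) (C (Suc n))))))"
proof -
  interpret cotorsion R \<U> \<A> \<B>
    by (intro cotorsion.intro module_category.intro cotorsion_axioms.intro assms)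
  show ?thesis
  proof (intro conjI impI iffI)
    assume "M \<in> \<A>"
    note seq = A_imp_sequence[OF this \<open>countably_presented R M\<close>]
    then show "\<exists>C f. is_sequence_limit R \<U> C f M \<and>
           (\<forall>n. finitely_presented R (C n)) \<and>
           (\<forall>n. f n \<in> factor_ideal R \<A> (C n) (C (Suc n))) \<and>
           (\<forall>B\<in>\<B>. Mittag_Leffler (\<lambda>n. Hom_group R (C n) B)
                      (\<lambda>n g. compose (carrier (C n)) g (f n)))" .
    from seq show "\<exists>C f. is_sequence_limit R \<U> C f M \<and>
             (\<forall>n. finitely_presented R (C n)) \<and>
             (\<forall>n. f n \<in> factor_ideal R \<A> (C n) (C (Suc n)))" by blast
  next
    assume "\<exists>C f. is_sequence_limit R \<U> C f M \<and>
           (\<forall>n. finitely_presented R (C n)) \<and>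
           (\<forall>n. f n \<in> factor_ideal R \<A> (C n) (C (Suc n))) \<and>
           (\<forall>B\<in>\<B>. Mittag_Leffler (\<lambda>n. Hom_group R (C n) B)
                      (\<lambda>n g. compose (carrier (C n)) g (f n)))"
    then show "M \<in> \<A>" by (elim exE conjE) (rule sequence_imp_A, auto)
  next
    assume "closed_countable_direct_limits R \<U> \<A>"
      and "\<exists>C f. is_sequence_limit R \<U> C f M \<and>
             (\<forall>n. finitely_presented R (C n)) \<and>
             (\<forall>n. f n \<in> factor_ideal R \<A> (C n) (C (Suc n)))"
    then show "M \<in> \<A>" by (elim exE conjE) (rule sequence_imp_A_of_limits, auto)
  qed
qed

end
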